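(* Let $\dot x=F(x)=Ax+X(x)$ be an analytic system near $0\in\mathbb C^n$ (not necessarily in normal form), where $X$ has only terms of degree at least two and $A$ is in lower-triangular Jordan form with diagonal $\lambda=(\lambda_1,\dots,\lambda_n)^\top$. Assume that $\lambda$ and its complex conjugate $\bar\lambda$ are linearly independent, and that the system admits $n-2$ independent formally meromorphic first integrals. Then any normal form of the system satisfies Condition AS, and Condition $\omega$ holds; therefore there exists a convergent normalizing transformation.
   Context: The matrix $A$ has diagonal entries $\lambda_1,\dots,\lambda_n$, subdiagonal entries $\sigma_2,\dots,\sigma_n\in\mathbb C$ with $\sigma_i=0$ whenever $\lambda_i\ne\lambda_{i-1}$, and all other entries zero. For $Q\in\mathbb Z^n$ put $\|Q\|=|q_1+\dots+q_n|$, $x^Q=x_1^{q_1}\cdots x_n^{q_n}$, $\langle Q,v\rangle=\sum_i q_iv_i$. $\mathbf N_i=\{Q\in\mathbb Z^n: q_i\ge -1,\ q_j\ge 0 \text{ for } j\ne i\}$, $\mathbf N=\bigcup_i\mathbf N_i$. $\odot$ is the componentwise product. Every formal power series vector field is written uniquely as $\sum_{Q\in\mathbf N}(x\odot F_Q)x^Q$, $F_Q\in\mathbb C^n$ (the $i$-th entry of $F_Q$ being $0$ unless $Q\in\mathbf N_i$); it is in Poincaré-Dulac normal form if $F_Q=0$ whenever $\langle Q,\lambda\rangle\ne0$. A transformation is a formal substitution $x=H(y)=y+h(y)$ with $h$ having only terms of degree at least two; the transformed field $\widetilde F$ is defined by $DH(y)\widetilde F(y)=F(H(y))$. It is normalizing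 if $\widetilde F$ is in normal form (then $\widetilde F$ is called a normal form of $F$), and convergent if $H$ converges near $0$. Formally meromorphic functions are elements of the fraction field $\mathbb C((x_1,\dots,x_n))$ of $\mathbb C[[x_1,\dots,x_n]]$; a first integral is such a $\psi$ with $D\psi(x)F(x)=0$; independence means that the Jacobian matrix has full rank over $\mathbb C((x_1,\dots,x_n))$. Condition $\omega$: with $\omega_k=\min\{|\langle Q,\lambda\rangle|: Q\in\mathbf N,\langle Q,\lambda\rangle\ne0,\|Q\|<2^k\}$, one has $\sum_{k\ge1}2^{-k}\log(\omega_k^{-1})<\infty$. An additive decomposition of $\lambda$ consists of linearly independent $\lambda^{(1)},\dots,\lambda^{(r)}\in\mathbb C^n$ ($r\ge 1$) with $\lambda=\sum_j\gamma_j\lambda^{(j)}$ for some $\gamma_j\in\mathbb C$. It satisfies the diophantine hull condition if there is $c>0$ with $|\langle Q,\lambda^{(j)}\rangle|\le c|\langle Q,\lambda\rangle|$ for all $j$ and all $Q\in\mathbf N$. Let $M_\lambda^+=\{P\in\mathbb Z_{\ge0}^n:\langle P,\lambda\rangle=0\}$. A vector field $G$ in normal form satisfies Condition AS if there is an additive decomposition of $\lambda$ satisfying the diophantine hull condition such that $G(x)=\sum_{P\in M_\lambda^+}(x\odot G_P)x^P$ with every $G_P$ a $\mathbb C$-linear combination of $\lambda^{(1)},\dots,\lambda^{(r)}$. *)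

theory Defs
  imports "HOL-Analysis.Analysis" "HOL-Computational_Algebra.Fraction_Field"
begin

section \<open>Formal power series in several variables\<close>

typedef ('a, 'n) mfps = "UNIV :: (nat ^ 'n \<Rightarrow> 'a) set"
  morphisms mcoeff Abs_mfps
  by simp

setup_lifting type_definition_mfps

lemma mcoeff_Abs_mfps [simp]: "mcoeff (Abs_mfps f) = f"
  by (simp add: Abs_mfps_inverse)

lemma mfps_eq_iff: "f = g \<longleftrightarrow> (\<forall>M. mcoeff f M = mcoeff g M)"
  by (metis mcoeff_inject ext)

lemma mfps_eqI: "(\<And>M. mcoeff f M = mcoeff g M) \<Longrightarrow> f = g"
  by (simp add: mfps_eq_iff)

definition splits :: "nat ^ 'n \<Rightarrow> ((nat ^ 'n) \<times> (nat ^ 'n)) set" where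
  "splits M = {(a, b). a + b = M}"

lemma finite_below: "finite {a :: nat ^ 'n. \<forall>i. a $ i \<le> m}"
proof -
  have "{a :: nat ^ 'n. \<forall>i. a $ i \<le> m} \<subseteq> (\<lambda>f. \<chi> i. f i) ` (PiE UNIV (\<lambda>_. {..m}))"
  proof
    fix a :: "nat ^ 'n" assume "a \<in> {a. \<forall>i. a $ i \<le> m}"
    then have "a = (\<chi> i. ($) a i)" "($) a \<in> PiE UNIV (\<lambda>_. {..m})"
      by (auto simp: PiE_def)
    then show "a \<in> (\<lambda>f. \<chi> i. f i) ` (PiE UNIV (\<lambda>_. {..m}))" by blast
  qed
  then show ?thesis
    by (rule finite_subset) (intro finite_imageI finite_PiE; simp)
qed

lemma finite_splits [simp]: "finite (splits M)"
proof -
  let ?B = "{a :: nat ^ 'n. \<forall>i. a $ i \<le> (\<Sum>j\<in>UNIV. M $ j)}"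
  have le: "M $ i \<le> (\<Sum>j\<in>UNIV. M $ j)" for i
    by (rule member_le_sum) auto
  have "splits M \<subseteq> ?B \<times> ?B"
    unfolding splits_def
    by (auto simp: vec_eq_iff) (metis le le_add1 le_add2 le_trans)+
  then show ?thesis
    by (rule finite_subset) (simp add: finite_below)
qed

instantiation mfps :: (comm_ring_1, finite) comm_ring_1
begin

definition zero_mfps :: "('a, 'b :: finite) mfps" where
  "0 = Abs_mfps (\<lambda>_. 0)"
definition one_mfps :: "('a, 'b :: finite) mfps" where
  "1 = Abs_mfps (\<lambda>M. if M = 0 then 1 else 0)"
definition plus_mfps :: "('a, 'b :: finite) mfps \<Rightarrow> ('a, 'b) mfps \<Rightarrow> ('a, 'b) mfps" where
  "f + g = Abs_mfps (\<lambda>M. mcoeff f M + mcoeff g M)"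
definition minus_mfps :: "('a, 'b :: finite) mfps \<Rightarrow> ('a, 'b) mfps \<Rightarrow> ('a, 'b) mfps" where
  "f - g = Abs_mfps (\<lambda>M. mcoeff f M - mcoeff g M)"
definition uminus_mfps :: "('a, 'b :: finite) mfps \<Rightarrow> ('a, 'b) mfps" where
  "- f = Abs_mfps (\<lambda>M. - mcoeff f M)"
definition times_mfps :: "('a, 'b :: finite) mfps \<Rightarrow> ('a, 'b) mfps \<Rightarrow> ('a, 'b) mfps" where
  "f * g = Abs_mfps (\<lambda>M. \<Sum>(a, b)\<in>splits M. mcoeff f a * mcoeff g b)"

instance
proof
  fix f g h :: "('a, 'b) mfps"
  show "f + g + h = f + (g + h)" "f + g = g + f" "0 + f = f" "- f + f = 0" "f - g = f + - g"
    by (simp_all add: mfps_eq_iff plus_mfps_def zero_mfps_def minus_mfps_def uminus_mfps_def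
        algebra_simps)
  show "(0 :: ('a, 'b) mfps) \<noteq> 1"
    by (auto simp: mfps_eq_iff zero_mfps_def one_mfps_def)
  show "f * g = g * f"
  proof (rule mfps_eqI)
    fix M
    show "mcoeff (f * g) M = mcoeff (g * f) M"
      unfolding times_mfps_def mcoeff_Abs_mfps
      by (rule sum.reindex_bij_witness[of _ prod.swap prod.swap])
         (auto simp: splits_def add.commute mult.commute)
  qed
  show "(f + g) * h = f * h + g * h"
    by (simp add: mfps_eq_iff times_mfps_def plus_mfps_def algebra_simps case_prod_unfold
        sum.distrib)
  show "1 * f = f"
  proof (rule mfps_eqI)
    fix M
    have "mcoeff (1 * f) M = (\<Sum>p\<in>splits M. if p = (0, M) then mcoeff f M else 0)"
      unfolding times_mfps_def one_mfps_def mcoeff_Abs_mfps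
      by (rule sum.cong) (auto simp: splits_def split: if_splits)
    also have "\<dots> = mcoeff f M"
      by simp (simp add: splits_def)
    finally show "mcoeff (1 * f) M = mcoeff f M" .
  qed
  show "f * g * h = f * (g * h)"
  proof (rule mfps_eqI)
    fix M
    have "mcoeff (f * g * h) M = (\<Sum>p\<in>splits M. \<Sum>q\<in>splits (fst p).
        mcoeff f (fst q) * mcoeff g (snd q) * mcoeff h (snd p))"
      by (simp add: times_mfps_def case_prod_unfold sum_distrib_right)
    also have "\<dots> = (\<Sum>(p, q)\<in>(SIGMA p:splits M. splits (fst p)).
        mcoeff f (fst q) * mcoeff g (snd q) * mcoeff h (snd p))"
      by (subst sum.Sigma) auto
    also have "\<dots> = (\<Sum>(p, q)\<in>(SIGMA p:splits M. splits (snd p)).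
        mcoeff f (fst p) * (mcoeff g (fst q) * mcoeff h (snd q)))"
      by (rule sum.reindex_bij_witness[of _
            "\<lambda>(p, q). ((fst p + fst q, snd q), (fst p, fst q))"
            "\<lambda>(p, q). ((fst q, snd q + snd p), (snd q, snd p))"])
         (auto simp: splits_def algebra_simps)
    also have "\<dots> = (\<Sum>p\<in>splits M. \<Sum>q\<in>splits (snd p).
        mcoeff f (fst p) * (mcoeff g (fst q) * mcoeff h (snd q)))"
      by (subst sum.Sigma) auto
    also have "\<dots> = mcoeff (f * (g * h)) M"
      by (simp add: times_mfps_def case_prod_unfold sum_distrib_left)
    finally show "mcoeff (f * g * h) M = mcoeff (f * (g * h)) M" .
  qed
qed

end

lemma mcoeff_0 [simp]: "mcoeff 0 M = 0"
  and mcoeff_1: "mcoeff 1 M = (if M = 0 then 1 else 0)"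
  and mcoeff_add [simp]: "mcoeff (f + g) M = mcoeff f M + mcoeff g M"
  and mcoeff_diff [simp]: "mcoeff (f - g) M = mcoeff f M - mcoeff g M"
  and mcoeff_uminus [simp]: "mcoeff (- f) M = - mcoeff f M"
  and mcoeff_mult: "mcoeff (f * g) M = (\<Sum>(a, b)\<in>splits M. mcoeff f a * mcoeff g b)"
  by (simp_all add: zero_mfps_def one_mfps_def plus_mfps_def minus_mfps_def uminus_mfps_def
      times_mfps_def)

lemma unique_split:
  fixes A B :: "(nat ^ 'n) set"
  assumes "finite S" "A \<noteq> {}" "B \<noteq> {}"
  shows "\<exists>a\<in>A. \<exists>b\<in>B. \<forall>a'\<in>A. \<forall>b'\<in>B. a' + b' = a + b \<longrightarrow>
           (\<forall>i\<in>S. a' $ i = a $ i \<and> b' $ i = b $ i)"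
  using assms
proof (induction S arbitrary: A B rule: finite_induct)
  case (insert i S)
  define A0 where "A0 = {a\<in>A. \<forall>a'\<in>A. a $ i \<le> a' $ i}"
  define B0 where "B0 = {b\<in>B. \<forall>b'\<in>B. b $ i \<le> b' $ i}"
  have least: "{a\<in>T. \<forall>a'\<in>T. a $ i \<le> a' $ i} \<noteq> {}" if "T \<noteq> {}" for T :: "(nat ^ 'n) set"
  proof -
    obtain t where "t \<in> T" using \<open>T \<noteq> {}\<close> by blast
    then have "\<exists>a. a \<in> T \<and> (\<forall>a'. a' \<in> T \<longrightarrow> a $ i \<le> a' $ i)"
      by (rule ex_has_least_nat)
    then show ?thesis by blast
  qed
  have "A0 \<noteq> {}" "B0 \<noteq> {}"
    unfolding A0_def B0_def by (rule least; fact)+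
  then obtain a b where ab: "a \<in> A0" "b \<in> B0"
    "\<And>a' b'. a' \<in> A0 \<Longrightarrow> b' \<in> B0 \<Longrightarrow> a' + b' = a + b \<Longrightarrow>
      (\<forall>i\<in>S. a' $ i = a $ i \<and> b' $ i = b $ i)"
    using insert.IH[of A0 B0] by blast
  show ?case
  proof (intro bexI ballI impI)
    show "a \<in> A" "b \<in> B" using ab(1,2) by (auto simp: A0_def B0_def)
    fix a' b' j assume *: "a' \<in> A" "b' \<in> B" "a' + b' = a + b" "j \<in> insert i S"
    have "a $ i \<le> a' $ i" "b $ i \<le> b' $ i" using ab(1,2) *(1,2) by (auto simp: A0_def B0_def)
    moreover have "a' $ i + b' $ i = a $ i + b $ i"
      using *(3) by (metis vector_add_component)
    ultimately have eq: "a' $ i = a $ i" "b' $ i = b $ i" by linarith+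
    then have "a' \<in> A0" "b' \<in> B0" using *(1,2) ab(1,2) by (auto simp: A0_def B0_def)
    from ab(3)[OF this *(3)] show "a' $ j = a $ j \<and> b' $ j = b $ j" using *(4) eq by blast
  qed
qed auto

instance mfps :: (idom, finite) idom
proof
  fix f g :: "('a, 'b) mfps"
  assume "f \<noteq> 0" "g \<noteq> 0"
  then have "{M. mcoeff f M \<noteq> 0} \<noteq> {}" "{M. mcoeff g M \<noteq> 0} \<noteq> {}"
    by (auto simp: mfps_eq_iff)
  then obtain a b where ab: "mcoeff f a \<noteq> 0" "mcoeff g b \<noteq> 0"
    and *: "\<forall>a'\<in>{M. mcoeff f M \<noteq> 0}. \<forall>b'\<in>{M. mcoeff g M \<noteq> 0}. a' + b' = a + b \<longrightarrow>
        (\<forall>i\<in>UNIV. a' $ i = a $ i \<and> b' $ i = b $ i)"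
    using unique_split[of "UNIV :: 'b set" "{M. mcoeff f M \<noteq> 0}" "{M. mcoeff g M \<noteq> 0}"]
    by auto
  have uniq: "a' = a \<and> b' = b" if "mcoeff f a' \<noteq> 0" "mcoeff g b' \<noteq> 0" "a' + b' = a + b" for a' b'
    using *[rule_format, of a' b'] that by (simp add: vec_eq_iff)
  have "mcoeff (f * g) (a + b) =
      (\<Sum>p\<in>splits (a + b). if p = (a, b) then mcoeff f a * mcoeff g b else 0)"
    unfolding mcoeff_mult
  proof (rule sum.cong)
    fix p assume "p \<in> splits (a + b)"
    then show "(case p of (a, b) \<Rightarrow> mcoeff f a * mcoeff g b) =
        (if p = (a, b) then mcoeff f a * mcoeff g b else 0)"
      using uniq[of "fst p" "snd p"] by (auto simp: splits_def)
  qed simp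
  also have "\<dots> = mcoeff f a * mcoeff g b"
    by simp (simp add: splits_def)
  finally show "f * g \<noteq> 0" using ab by auto
qed

definition mconst :: "'a \<Rightarrow> ('a :: comm_ring_1, 'n :: finite) mfps" where
  "mconst c = Abs_mfps (\<lambda>M. if M = 0 then c else 0)"

definition mvar :: "'n \<Rightarrow> ('a :: comm_ring_1, 'n :: finite) mfps" where
  "mvar i = Abs_mfps (\<lambda>M. if M = axis i 1 then 1 else 0)"

definition mdeg :: "nat ^ 'n \<Rightarrow> nat" where
  "mdeg M = (\<Sum>i\<in>UNIV. M $ i)"

definition order_ge :: "nat \<Rightarrow> ('a :: zero, 'n :: finite) mfps \<Rightarrow> bool" where
  "order_ge k f \<longleftrightarrow> (\<forall>M. mdeg M < k \<longrightarrow> mcoeff f M = 0)"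

definition mpartial :: "'n \<Rightarrow> ('a :: comm_ring_1, 'n :: finite) mfps \<Rightarrow> ('a, 'n) mfps" where
  "mpartial i f = Abs_mfps (\<lambda>M. of_nat (M $ i + 1) * mcoeff f (M + axis i 1))"

text \<open>Substitution of \<open>H\<close> into \<open>f\<close>, meant for \<open>H\<close> without constant terms: the product
  \<open>\<Prod>i. (H $ i) ^ (M $ i)\<close> then has order at least \<open>mdeg M\<close>, so that the exponents \<open>M\<close> with
  \<open>mdeg M > mdeg P\<close>, which are left out below, do not contribute to the coefficient of \<open>P\<close>.\<close>

definition msubst :: "('a :: comm_ring_1, 'n :: finite) mfps \<Rightarrow> ('a, 'n) mfps ^ 'n \<Rightarrow> ('a, 'n) mfps"
  where "msubst f H = Abs_mfps (\<lambda>P. \<Sum>M\<in>{M. mdeg M \<le> mdeg P}.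
           mcoeff f M * mcoeff (\<Prod>i\<in>UNIV. (H $ i) ^ (M $ i)) P)"

lemma finite_mdeg_le [simp]: "finite {M :: nat ^ 'n. mdeg M \<le> k}"
proof (rule finite_subset[OF _ finite_below[of k]], safe)
  fix M :: "nat ^ 'n" and i assume "mdeg M \<le> k"
  moreover have "M $ i \<le> mdeg M"
    unfolding mdeg_def by (rule member_le_sum) auto
  ultimately show "M $ i \<le> k" by simp
qed

text \<open>Convergence on a polydisc around 0. An analytic map near 0 is identified with its Taylor
  series, i.e. with a series having this property.\<close>

definition mconvergent :: "(complex, 'n :: finite) mfps \<Rightarrow> bool" where
  "mconvergent f \<longleftrightarrow> (\<exists>r>0. \<forall>z :: complex ^ 'n. (\<forall>i. norm (z $ i) < r) \<longrightarrow>
     (\<lambda>M. mcoeff f M * (\<Prod>i\<in>UNIV. (z $ i) ^ (M $ i))) summable_on UNIV)"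

section \<open>Partial derivatives on the fraction field\<close>

lemma mpartial_mult_aux:
  fixes f g :: "('a :: comm_ring_1, 'n :: finite) mfps"
  shows "(\<Sum>(a, b)\<in>splits (M + axis i 1). of_nat (a $ i) * (mcoeff f a * mcoeff g b)) =
    mcoeff (mpartial i f * g) M"
proof -
  have "(\<Sum>(a, b)\<in>splits (M + axis i 1). of_nat (a $ i) * (mcoeff f a * mcoeff g b)) =
    (\<Sum>(a, b)\<in>{p \<in> splits (M + axis i 1). fst p $ i \<noteq> 0}.
       of_nat (a $ i) * (mcoeff f a * mcoeff g b))"
    unfolding case_prod_unfold by (rule sum.mono_neutral_right) auto
  also have "\<dots> = (\<Sum>(a, b)\<in>splits M. mcoeff (mpartial i f) a * mcoeff g b)"
  proof (rule sum.reindex_bij_witness[of _ "\<lambda>(a, b). (a + axis i 1, b)"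
          "\<lambda>(a, b). (a - axis i 1, b)"], goal_cases)
    case (1 p)
    then show ?case by (cases p) (auto simp: vec_eq_iff axis_def)
  next
    case (2 p)
    then obtain a b where p: "p = (a, b)" "a + b = M + axis i 1" "a $ i \<noteq> 0"
      by (auto simp: splits_def)
    have "(a - axis i 1) $ j + b $ j = M $ j" for j
      using p(3) arg_cong[OF p(2), of "\<lambda>v. v $ j"] by (cases "j = i") (auto simp: axis_def)
    with p(1) show ?case by (auto simp: splits_def vec_eq_iff)
  next
    case (3 p)
    then show ?case by (cases p) (auto simp: vec_eq_iff axis_def)
  next
    case (4 p)
    then show ?case by (auto simp: splits_def algebra_simps axis_def)
  next
    case (5 p)
    then obtain a b where p: "p = (a, b)" "a $ i \<noteq> 0" by (cases p) auto
    then have "a - axis i 1 + axis i 1 = a" by (auto simp: vec_eq_iff axis_def)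
    with p show ?case by (simp add: mpartial_def algebra_simps)
  qed
  finally show ?thesis by (simp add: mcoeff_mult)
qed

lemma mpartial_mult: "mpartial i (f * g) = mpartial i f * g + f * mpartial i g"
proof (rule mfps_eqI)
  fix M
  let ?S = "splits (M + axis i 1)"
  have "mcoeff (mpartial i (f * g)) M =
      (\<Sum>(a, b)\<in>?S. of_nat ((M + axis i 1) $ i) * (mcoeff f a * mcoeff g b))"
    by (simp add: mpartial_def mcoeff_mult sum_distrib_left case_prod_unfold axis_def)
  also have "\<dots> = (\<Sum>(a, b)\<in>?S. of_nat (a $ i) * (mcoeff f a * mcoeff g b) +
      of_nat (b $ i) * (mcoeff g b * mcoeff f a))"
  proof (rule sum.cong, simp, safe)
    fix a b assume "(a, b) \<in> ?S"
    then have "(M + axis i 1) $ i = a $ i + b $ i"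
      by (metis (mono_tags, lifting) case_prodD mem_Collect_eq splits_def vector_add_component)
    then show "of_nat ((M + axis i 1) $ i) * (mcoeff f a * mcoeff g b) =
        of_nat (a $ i) * (mcoeff f a * mcoeff g b) + of_nat (b $ i) * (mcoeff g b * mcoeff f a)"
      by (simp only: of_nat_add) (simp add: algebra_simps)
  qed
  also have "\<dots> = (\<Sum>(a, b)\<in>?S. of_nat (a $ i) * (mcoeff f a * mcoeff g b)) +
      (\<Sum>(a, b)\<in>?S. of_nat (b $ i) * (mcoeff g b * mcoeff f a))"
    by (simp add: case_prod_unfold sum.distrib)
  also have "(\<Sum>(a, b)\<in>?S. of_nat (b $ i) * (mcoeff g b * mcoeff f a)) =
      (\<Sum>(a, b)\<in>?S. of_nat (a $ i) * (mcoeff g a * mcoeff f b))"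
    by (rule sum.reindex_bij_witness[of _ prod.swap prod.swap])
       (auto simp: splits_def add.commute)
  finally show "mcoeff (mpartial i (f * g)) M = mcoeff (mpartial i f * g + f * mpartial i g) M"
    by (simp only: mpartial_mult_aux mcoeff_add mult.commute[of f "mpartial i g"])
qed

lift_definition fpartial :: "'n \<Rightarrow> ('a :: idom, 'n :: finite) mfps fract \<Rightarrow> ('a, 'n) mfps fract"
  is "\<lambda>i pq. (mpartial i (fst pq) * snd pq - fst pq * mpartial i (snd pq), snd pq * snd pq)"
proof -
  fix i and x y :: "('a, 'n) mfps \<times> ('a, 'n) mfps"
  assume "fractrel x y"
  obtain p q p' q' where xy: "x = (p, q)" "y = (p', q')" by (cases x, cases y)
  with \<open>fractrel x y\<close> have nz: "q \<noteq> 0" "q' \<noteq> 0" and eq: "p * q' = p' * q" by auto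
  have d: "mpartial i p * q' + p * mpartial i q' = mpartial i p' * q + p' * mpartial i q"
    using arg_cong[OF eq, of "mpartial i"] by (simp add: mpartial_mult)
  have "(mpartial i p * q - p * mpartial i q) * (q' * q') -
        (mpartial i p' * q' - p' * mpartial i q') * (q * q) =
      q * q' * ((mpartial i p * q' + p * mpartial i q') - (mpartial i p' * q + p' * mpartial i q))
      + (p' * q - p * q') * (q * mpartial i q' + q' * mpartial i q)"
    by (simp add: algebra_simps)
  also have "\<dots> = 0" by (simp only: d eq) simp
  finally show "fractrel
     (mpartial i (fst x) * snd x - fst x * mpartial i (snd x), snd x * snd x)
     (mpartial i (fst y) * snd y - fst y * mpartial i (snd y), snd y * snd y)"
    using nz by (simp add: xy)
qed

lemma fpartial_Fract:
  "q \<noteq> 0 \<Longrightarrow> fpartial i (Fract p q) = Fract (mpartial i p * q - p * mpartial i q) (q * q)"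
  by transfer auto

section \<open>Vector fields and normal forms\<close>

type_synonym 'n cvec = "complex ^ 'n"
type_synonym 'n cmat = "complex ^ 'n ^ 'n"
type_synonym 'n fvec = "(complex, 'n) mfps ^ 'n"

definition Ni :: "'n :: finite \<Rightarrow> (int ^ 'n) set" where
  "Ni i = {Q. Q $ i \<ge> -1 \<and> (\<forall>j. j \<noteq> i \<longrightarrow> Q $ j \<ge> 0)}"

definition NN :: "(int ^ 'n :: finite) set" where
  "NN = (\<Union>i. Ni i)"

definition qnorm :: "int ^ 'n \<Rightarrow> int" where
  "qnorm Q = \<bar>\<Sum>i\<in>UNIV. Q $ i\<bar>"

definition pair :: "int ^ 'n \<Rightarrow> complex ^ 'n \<Rightarrow> complex" where
  "pair Q v = (\<Sum>i\<in>UNIV. of_int (Q $ i) * v $ i)"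

text \<open>\<open>vf_series S C\<close> is the vector field \<open>\<Sum>Q\<in>S. (x \<odot> C Q) x^Q\<close>. Its \<open>i\<close>-th component is
  \<open>\<Sum>Q\<in>S. (C Q)\<^sub>i x^(Q + e\<^sub>i)\<close>, so the monomial \<open>x^M\<close> in it comes from \<open>Q = M - e\<^sub>i\<close>.\<close>

definition lower :: "'n :: finite \<Rightarrow> nat ^ 'n \<Rightarrow> int ^ 'n" where
  "lower i M = (\<chi> k. int (M $ k)) - axis i 1"

definition vf_series :: "(int ^ 'n) set \<Rightarrow> (int ^ 'n \<Rightarrow> complex ^ 'n) \<Rightarrow> 'n :: finite fvec" where
  "vf_series S C = (\<chi> i. Abs_mfps (\<lambda>M. if lower i M \<in> S then C (lower i M) $ i else 0))"

definition vf_coeff :: "'n :: finite fvec \<Rightarrow> int ^ 'n \<Rightarrow> complex ^ 'n" where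
  "vf_coeff F Q =
     (\<chi> i. if Q \<in> Ni i then mcoeff (F $ i) (\<chi> k. nat ((Q + axis i 1) $ k)) else 0)"

lemma lower_in_Ni: "lower i M \<in> Ni i"
  by (auto simp: lower_def Ni_def axis_def)

lemma nat_lower: "(\<chi> k. nat ((lower i M + axis i 1) $ k)) = M"
  by (simp add: lower_def vec_eq_iff)

lemma lower_nat: "Q \<in> Ni i \<Longrightarrow> lower i (\<chi> k. nat ((Q + axis i 1) $ k)) = Q"
  by (auto simp: lower_def vec_eq_iff Ni_def axis_def)

lemma vf_series_vf_coeff:
  fixes F :: "'n :: finite fvec"
  shows "vf_series NN (vf_coeff F) = F"
proof -
  have "lower i M \<in> NN" for i :: 'n and M using lower_in_Ni by (auto simp: NN_def)
  then show ?thesis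
    by (simp add: vf_series_def vf_coeff_def vec_eq_iff mfps_eq_iff lower_in_Ni nat_lower
        del: vector_add_component)
qed

lemma vf_coeff_unique:
  assumes "vf_series NN C = F" "\<And>Q i. Q \<in> NN \<Longrightarrow> Q \<notin> Ni i \<Longrightarrow> C Q $ i = 0" "Q \<in> NN"
  shows "C Q = vf_coeff F Q"
proof -
  have "C Q $ i = vf_coeff F Q $ i" for i
  proof (cases "Q \<in> Ni i")
    case True
    then show ?thesis
      unfolding assms(1)[symmetric] using assms(3)
      by (simp add: vf_coeff_def vf_series_def lower_nat del: vector_add_component)
  next
    case False
    then show ?thesis using assms by (simp add: vf_coeff_def)
  qed
  then show ?thesis by (simp add: vec_eq_iff)
qed

definition normal_form :: "complex ^ 'n \<Rightarrow> 'n :: finite fvec \<Rightarrow> bool" where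
  "normal_form lam F \<longleftrightarrow> (\<forall>Q\<in>NN. pair Q lam \<noteq> 0 \<longrightarrow> vf_coeff F Q = 0)"

definition linear_vf :: "complex ^ 'n ^ 'n \<Rightarrow> 'n :: finite fvec" where
  "linear_vf A = (\<chi> i. \<Sum>j\<in>UNIV. mconst (A $ i $ j) * mvar j)"

text \<open>\<open>covers i j\<close>: in the given order of the indices, \<open>j\<close> is the predecessor \<open>i - 1\<close> of \<open>i\<close>.\<close>

definition covers :: "'n :: linorder \<Rightarrow> 'n \<Rightarrow> bool" where
  "covers i j \<longleftrightarrow> j < i \<and> \<not> (\<exists>k. j < k \<and> k < i)"

definition lower_jordan :: "'n :: {finite, linorder} cvec \<Rightarrow> 'n cmat \<Rightarrow> bool" where
  "lower_jordan lam A \<longleftrightarrow>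
     (\<forall>i. A $ i $ i = lam $ i) \<and>
     (\<forall>i j. covers i j \<longrightarrow> lam $ i \<noteq> lam $ j \<longrightarrow> A $ i $ j = 0) \<and>
     (\<forall>i j. i \<noteq> j \<longrightarrow> \<not> covers i j \<longrightarrow> A $ i $ j = 0)"

definition transformation :: "'n :: finite fvec \<Rightarrow> bool" where
  "transformation H \<longleftrightarrow> (\<exists>h. (\<forall>i. order_ge 2 (h $ i)) \<and> H = (\<chi> i. mvar i) + h)"

definition transforms :: "'n :: finite fvec \<Rightarrow> 'n fvec \<Rightarrow> 'n fvec \<Rightarrow> bool" where
  "transforms H F G \<longleftrightarrow>
     (\<chi> i j. mpartial j (H $ i)) *v G = (\<chi> i. msubst (F $ i) H)"

definition normalizing :: "complex ^ 'n \<Rightarrow> 'n :: finite fvec \<Rightarrow> 'n fvec \<Rightarrow> bool" where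
  "normalizing lam F H \<longleftrightarrow> transformation H \<and> (\<exists>G. transforms H F G \<and> normal_form lam G)"

definition is_normal_form_of :: "complex ^ 'n \<Rightarrow> 'n :: finite fvec \<Rightarrow> 'n fvec \<Rightarrow> bool" where
  "is_normal_form_of lam F G \<longleftrightarrow>
     (\<exists>H. transformation H \<and> transforms H F G \<and> normal_form lam G)"

section \<open>First integrals\<close>

type_synonym 'n fmero = "(complex, 'n) mfps fract"

definition gradient :: "'n :: finite fmero \<Rightarrow> 'n fmero ^ 'n" where
  "gradient \<psi> = (\<chi> i. fpartial i \<psi>)"

definition first_integral :: "'n :: finite fvec \<Rightarrow> 'n fmero \<Rightarrow> bool" where
  "first_integral F \<psi> \<longleftrightarrow> (\<Sum>i\<in>UNIV. gradient \<psi> $ i * Fract (F $ i) 1) = 0"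

text \<open>The Jacobian matrix of \<open>\<psi> 0, \<dots>, \<psi> (m - 1)\<close> has rank \<open>m\<close>; the rank is written as the
  dimension of the row space, as in the definition of \<^const>\<open>rank\<close>, because \<open>m\<close> is not a type here.\<close>

definition independent_functions :: "nat \<Rightarrow> (nat \<Rightarrow> 'n :: finite fmero) \<Rightarrow> bool" where
  "independent_functions m \<psi> \<longleftrightarrow> vec.dim ((\<lambda>j. gradient (\<psi> j)) ` {..<m}) = m"

section \<open>The conditions on the eigenvalues and on normal forms\<close>

lemma finite_qnorm_less: "finite {Q :: int ^ 'n :: finite. Q \<in> NN \<and> qnorm Q < m}"
proof -
  have "{Q :: int ^ 'n. Q \<in> NN \<and> qnorm Q < m} \<subseteq>
      (\<lambda>f. \<chi> i. f i) ` (PiE UNIV (\<lambda>_. {-1..m + 1}))"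
  proof
    fix Q :: "int ^ 'n" assume "Q \<in> {Q. Q \<in> NN \<and> qnorm Q < m}"
    then obtain i where Q: "Q \<in> Ni i" and m: "qnorm Q < m" by (auto simp: NN_def)
    have ge: "(Q + axis i 1) $ k \<ge> 0" for k using Q by (auto simp: Ni_def axis_def)
    have "Q $ j \<in> {-1..m + 1}" for j
    proof -
      have "(Q + axis i 1) $ j \<le> (\<Sum>k\<in>UNIV. (Q + axis i 1) $ k)"
        by (rule member_le_sum) (use ge in auto)
      also have "\<dots> = (\<Sum>k\<in>UNIV. Q $ k) + 1"
        by (simp add: sum.distrib axis_def)
      also have "\<dots> \<le> m + 1" using m by (simp add: qnorm_def)
      finally have "Q $ j \<le> m + 1" by (simp add: axis_def split: if_splits)
      moreover have "Q $ i \<ge> -1" "j \<noteq> i \<Longrightarrow> Q $ j \<ge> 0" using Q by (auto simp: Ni_def)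
      then have "Q $ j \<ge> -1" by (cases "j = i") auto
      ultimately show ?thesis by simp
    qed
    then have "Q = (\<chi> i. ($) Q i)" "($) Q \<in> PiE UNIV (\<lambda>_. {-1..m + 1})"
      by (auto simp: PiE_def)
    then show "Q \<in> (\<lambda>f. \<chi> i. f i) ` (PiE UNIV (\<lambda>_. {-1..m + 1}))" by blast
  qed
  then show ?thesis
    by (rule finite_subset) (intro finite_imageI finite_PiE; simp)
qed

text \<open>The set below is finite, and it is nonempty for \<open>k \<ge> 1\<close> and \<open>lam \<noteq> 0\<close>, since it then
  contains \<open>\<bar>lam\<^sub>i\<bar>\<close> for some \<open>i\<close> (take \<open>Q = - e\<^sub>i\<close>).\<close>

definition omega :: "complex ^ 'n :: finite \<Rightarrow> nat \<Rightarrow> real" where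
  "omega lam k = Min {norm (pair Q lam) |Q. Q \<in> NN \<and> pair Q lam \<noteq> 0 \<and> qnorm Q < 2 ^ k}"

text \<open>The sum starts at \<open>k = 1\<close>. Since \<open>omega lam\<close> is decreasing, the logarithms are bounded
  below, so that finiteness of the sum is the same as convergence of the series.\<close>

definition condition_omega :: "complex ^ 'n :: finite \<Rightarrow> bool" where
  "condition_omega lam \<longleftrightarrow> summable (\<lambda>k. ln (inverse (omega lam (Suc k))) / 2 ^ Suc k)"

definition additive_decomposition ::
    "complex ^ 'n :: finite \<Rightarrow> nat \<Rightarrow> (nat \<Rightarrow> complex ^ 'n) \<Rightarrow> bool" where
  "additive_decomposition lam r \<mu> \<longleftrightarrow>
     r \<ge> 1 \<and> inj_on \<mu> {..<r} \<and> vec.independent (\<mu> ` {..<r}) \<and>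
     (\<exists>\<gamma>. lam = (\<Sum>j<r. \<gamma> j *s \<mu> j))"

definition diophantine_hull ::
    "complex ^ 'n :: finite \<Rightarrow> nat \<Rightarrow> (nat \<Rightarrow> complex ^ 'n) \<Rightarrow> bool" where
  "diophantine_hull lam r \<mu> \<longleftrightarrow>
     (\<exists>c>0. \<forall>j<r. \<forall>Q\<in>NN. norm (pair Q (\<mu> j)) \<le> c * norm (pair Q lam))"

definition Mplus :: "complex ^ 'n :: finite \<Rightarrow> (int ^ 'n) set" where
  "Mplus lam = {P. (\<forall>i. P $ i \<ge> 0) \<and> pair P lam = 0}"

definition condition_AS :: "complex ^ 'n \<Rightarrow> 'n :: finite fvec \<Rightarrow> bool" where
  "condition_AS lam G \<longleftrightarrow>
     (\<exists>r \<mu>. additive_decomposition lam r \<mu> \<and> diophantine_hull lam r \<mu> \<and>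
        (\<exists>C. G = vf_series (Mplus lam) C \<and> (\<forall>P\<in>Mplus lam. C P \<in> vec.span (\<mu> ` {..<r}))))"

end

theory Submission
  imports Defs "HOL-Computational_Algebra.Polynomial_Factorial"
begin

text \<open>Write \<open>\<lambda>\<close> for \<open>lam\<close>, \<open>n\<close> for the dimension, and \<open>\<langle>M, \<lambda>\<rangle>\<close> for the weight of a monomial
\<open>x^M\<close>. For a vector \<open>\<mu>\<close> let \<open>T\<^sub>\<mu>\<close> be the diagonal field \<open>x \<odot> \<mu>\<close>; it multiplies \<open>x^M\<close> by
\<open>\<langle>M, \<mu>\<rangle>\<close>. A conjugate of an integer relation \<open>\<langle>Q, \<lambda>\<rangle> = 0\<close> is the relation
\<open>\<langle>Q, cnj \<lambda>\<rangle> = 0\<close>, so whatever is homogeneous for \<open>T\<^sub>\<lambda>\<close> is homogeneous for \<open>T\<^sub>\<mu>\<close> with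
\<open>\<mu> = cnj \<lambda>\<close>; more generally for every \<open>\<mu>\<close> that is orthogonal to all integer relations of \<open>\<lambda>\<close>.

\<^bold>\<open>Normal forms satisfy Condition AS.\<close> Let \<open>H\<close> transform \<open>F\<close> into a normal form \<open>G\<close>. Substitution of
\<open>H\<close> turns the given first integrals into \<open>n - 2\<close> independent first integrals \<open>a / b\<close> of \<open>G\<close>. The field
\<open>G\<close> preserves weights, and \<open>G - T\<^sub>\<lambda>\<close> strictly raises a suitable weighted degree, so modulo high
order the weight components are the generalized eigenspaces of \<open>G\<close>. The pairs \<open>(p, q)\<close> with
\<open>p * b = a * q\<close> form a space stable under \<open>G\<close>, hence it contains the weight components of \<open>(a, b)\<close>
(\<open>weight_components_of_quotient\<close>). So \<open>a / b\<close> is a quotient of two series of the same weight, and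
every \<open>T\<^sub>\<mu>\<close> as above annihilates it (\<open>kills_integrals_dvf\<close>). The fields that annihilate \<open>n - 2\<close>
independent functions form a space of dimension two over the fraction field; it contains the
independent fields \<open>T\<^sub>\<lambda>\<close> and \<open>T\<^sub>\<mu>\<close> with \<open>\<mu> = cnj \<lambda>\<close>, so \<open>G\<close> is a combination of them. Comparing
coefficients, every coefficient vector of \<open>G\<close> is a combination of \<open>\<lambda>\<close> and \<open>cnj \<lambda>\<close>
(\<open>integrals_force_tangency\<close>), which gives Condition AS with these two vectors; the diophantine hull
condition holds with \<open>c = 1\<close> because \<open>\<langle>Q, cnj \<lambda>\<rangle>\<close> is the conjugate of \<open>\<langle>Q, \<lambda>\<rangle>\<close>.

\<^bold>\<open>There are no small divisors.\<close> The same dimension count shows that only the combinations of \<open>\<lambda>\<close>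
and \<open>cnj \<lambda>\<close> are orthogonal to all integer relations of \<open>\<lambda>\<close>. Expanding \<open>\<lambda>\<close> in a basis of the
rational span of its entries writes it as a combination of such vectors with rational entries, and
this bounds the nonzero values \<open>\<langle>Q, \<lambda>\<rangle>\<close> away from 0 (\<open>weights_discrete\<close>). Condition \<open>\<omega>\<close> follows at
once.

\<^bold>\<open>A convergent transformation.\<close> The formal normalization without resonant terms exists
(\<open>formal_normal_form\<close>). Its normal form is \<open>T\<^sub>\<lambda> + u T\<^sub>\<lambda> + v T\<^sub>\<mu>\<close>, \<open>\<mu> = cnj \<lambda>\<close>, with \<open>u\<close>, \<open>v\<close> of
weight 0. In the conjugation equation \<open>u\<close> and \<open>v\<close> multiply terms of the form
\<open>\<langle>Q, \<lambda>\<rangle> h\<close> and \<open>\<langle>Q, cnj \<lambda>\<rangle> h\<close>, of the same absolute value as the left-hand side. As the divisors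
are bounded below, the truncated weighted \<open>\<ell>\<^sub>1\<close> norms of \<open>h\<close> stay bounded on a small polydisc, by
induction on the degree of truncation (\<open>normalizing_converges\<close>).\<close>

(* Unit exponents are written axis i 1; the simplifier must not turn their 1 into Suc 0. *)
declare One_nat_def [simp del]

section \<open>Weighted order, derivations and substitution of power series\<close>

text \<open>Besides the ordinary degree (all weights 1) the proof uses weights \<open>c\<close> for which the nilpotent part
of a Jordan matrix raises the degree; \<open>wge c\<close> is the resulting filtration, and \<open>order_ge\<close> is its
special case for the weights 1.\<close>

definition wt :: "('n :: finite \<Rightarrow> nat) \<Rightarrow> nat ^ 'n \<Rightarrow> nat" where
  "wt c M = (\<Sum>i\<in>UNIV. c i * M $ i)"

definition wge :: "('n :: finite \<Rightarrow> nat) \<Rightarrow> nat \<Rightarrow> ('a :: zero, 'n) mfps \<Rightarrow> bool" where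
  "wge c k f \<longleftrightarrow> (\<forall>M. wt c M < k \<longrightarrow> mcoeff f M = 0)"

lemma wt_0 [simp]: "wt c 0 = 0"
  by (simp add: wt_def)

lemma wt_add: "wt c (M + N) = wt c M + wt c N"
  by (simp add: wt_def sum.distrib algebra_simps)

lemma wt_axis [simp]: "wt c (axis i 1) = c i"
  by (simp add: wt_def axis_def if_distrib cong: if_cong)

lemma mdeg_eq_wt: "mdeg = wt (\<lambda>_. 1)"
  by (simp add: wt_def mdeg_def fun_eq_iff)

lemma order_ge_eq_wge: "order_ge = wge (\<lambda>_. 1)"
  by (simp add: wge_def order_ge_def fun_eq_iff mdeg_eq_wt)

lemma mdeg_0 [simp]: "mdeg 0 = 0"
  and mdeg_add: "mdeg (M + N) = mdeg M + mdeg N"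
  and mdeg_axis [simp]: "mdeg (axis i 1) = 1"
  by (simp_all add: mdeg_eq_wt wt_add)

lemma mdeg_eq_0_iff: "mdeg M = 0 \<longleftrightarrow> M = 0"
  by (auto simp: mdeg_def vec_eq_iff)

lemma wgeD: "wge c k f \<Longrightarrow> wt c M < k \<Longrightarrow> mcoeff f M = 0"
  by (simp add: wge_def)

lemma wge_zero [simp]: "wge c k 0"
  and wge_0 [simp]: "wge c 0 f"
  by (auto simp: wge_def)

lemma wge_mono: "wge c k f \<Longrightarrow> l \<le> k \<Longrightarrow> wge c l f"
  by (auto simp: wge_def)

lemma wge_add: "wge c k f \<Longrightarrow> wge c k g \<Longrightarrow> wge c k (f + g)"
  and wge_diff: "wge c k f \<Longrightarrow> wge c k g \<Longrightarrow> wge c k (f - g)"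
  and wge_uminus: "wge c k f \<Longrightarrow> wge c k (- f)"
  for f g :: "('a :: comm_ring_1, 'n :: finite) mfps"
  by (auto simp: wge_def)

lemma mcoeff_sum: "mcoeff (sum f A) M = (\<Sum>x\<in>A. mcoeff (f x) M)"
  by (induction A rule: infinite_finite_induct) auto

lemma wge_sum: "(\<And>x. x \<in> A \<Longrightarrow> wge c k (f x)) \<Longrightarrow> wge c k (sum f A)"
  for f :: "_ \<Rightarrow> ('a :: comm_ring_1, 'n :: finite) mfps"
  by (auto simp: wge_def mcoeff_sum)

lemma wge_mult:
  fixes f g :: "('a :: comm_ring_1, 'n :: finite) mfps"
  assumes "wge c k f" "wge c l g"
  shows "wge c (k + l) (f * g)"
  unfolding wge_def
proof safe
  fix M assume M: "wt c M < k + l"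
  have "mcoeff f a * mcoeff g b = 0" if "(a, b) \<in> splits M" for a b
  proof -
    have "wt c a + wt c b = wt c M" using that by (auto simp: splits_def wt_add)
    then have "wt c a < k \<or> wt c b < l" using M by linarith
    then show ?thesis using assms by (auto dest: wgeD)
  qed
  then show "mcoeff (f * g) M = 0"
    unfolding mcoeff_mult by (intro sum.neutral) auto
qed

lemma wge_mult_right: "wge c k g \<Longrightarrow> wge c k (f * g)"
  and wge_mult_left: "wge c k g \<Longrightarrow> wge c k (g * f)"
  for f g :: "('a :: comm_ring_1, 'n :: finite) mfps"
  using wge_mult[of c 0 f k g] by (auto simp: mult.commute)

lemma mcoeff_mpartial: "mcoeff (mpartial i f) M = of_nat (M $ i + 1) * mcoeff f (M + axis i 1)"
  by (simp add: mpartial_def)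

lemma wge_mpartial:
  fixes f :: "('a :: comm_ring_1, 'n :: finite) mfps"
  assumes "wge c k f"
  shows "wge c (k - c i) (mpartial i f)"
  using assms by (auto simp: wge_def mcoeff_mpartial wt_add)

lemma mcoeff_mconst: "mcoeff (mconst a) M = (if M = 0 then a else 0)"
  by (simp add: mconst_def)

lemma mcoeff_mvar: "mcoeff (mvar i) M = (if M = axis i 1 then 1 else 0)"
  by (simp add: mvar_def)

lemma wge_mvar: "wge c (c i) (mvar i)"
  by (auto simp: wge_def mcoeff_mvar)

lemma mcoeff_mconst_mult [simp]: "mcoeff (mconst a * f) M = a * mcoeff f M"
proof -
  have "mcoeff (mconst a * f) M = (\<Sum>p\<in>splits M. if p = (0, M) then a * mcoeff f M else 0)"
    unfolding mcoeff_mult mcoeff_mconst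
    by (rule sum.cong) (auto simp: splits_def split: if_splits)
  also have "\<dots> = a * mcoeff f M"
    by simp (simp add: splits_def)
  finally show ?thesis .
qed

lemma mconst_0 [simp]: "mconst 0 = 0"
  and mconst_1 [simp]: "mconst 1 = 1"
  and mconst_add: "mconst (a + b) = mconst a + mconst b"
  and mconst_diff: "mconst (a - b) = mconst a - mconst b"
  and mconst_mult: "mconst (a * b) = mconst a * mconst b"
  by (auto simp: mfps_eq_iff mcoeff_mconst mcoeff_1)

lemma axis_le_iff: "(\<exists>b. M = axis i 1 + b) \<longleftrightarrow> M $ i \<noteq> 0" for M :: "nat ^ 'n :: finite"
proof
  assume "M $ i \<noteq> 0"
  then have "M = axis i 1 + (M - axis i 1)" by (auto simp: vec_eq_iff axis_def)
  then show "\<exists>b. M = axis i 1 + b" ..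
qed (auto simp: axis_def)

lemma axis_add_diff: "M $ i \<noteq> 0 \<Longrightarrow> M - axis i 1 + axis i 1 = M" for M :: "nat ^ 'n :: finite"
  by (auto simp: vec_eq_iff axis_def)

lemma mcoeff_mvar_mult:
  "mcoeff (mvar i * f) M = (if M $ i = 0 then 0 else mcoeff f (M - axis i 1))"
proof -
  have "mcoeff (mvar i * f) M =
      (\<Sum>p\<in>splits M. if p = (axis i 1, M - axis i 1) then mcoeff f (M - axis i 1) else 0)"
    unfolding mcoeff_mult mcoeff_mvar
    by (rule sum.cong) (auto simp: splits_def split: if_splits)
  also have "\<dots> = (if M $ i = 0 then 0 else mcoeff f (M - axis i 1))"
  proof (cases "M $ i = 0")
    case True
    then have "(axis i 1, M - axis i 1) \<notin> splits M"
      using axis_le_iff[of M i] by (auto simp: splits_def) metis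
    then show ?thesis using True by (intro trans[OF sum.neutral]) auto
  next
    case False
    then have "(axis i 1, M - axis i 1) \<in> splits M"
      using axis_add_diff[of M i] by (simp add: splits_def add.commute)
    then show ?thesis using False by simp
  qed
  finally show ?thesis .
qed

lemma mcoeff_mvar_mult_add [simp]: "mcoeff (mvar i * f) (M + axis i 1) = mcoeff f M"
  by (simp add: mcoeff_mvar_mult axis_def)

lemma mpartial_0 [simp]: "mpartial i 0 = 0"
  and mpartial_add: "mpartial i (f + g) = mpartial i f + mpartial i g"
  and mpartial_diff: "mpartial i (f - g) = mpartial i f - mpartial i g"
  and mpartial_mconst [simp]: "mpartial i (mconst a) = 0"
  and mpartial_1 [simp]: "mpartial i 1 = 0"
  by (auto simp: mfps_eq_iff mcoeff_mpartial mcoeff_mconst mcoeff_1 algebra_simps vec_eq_iff axis_def)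

lemma mpartial_mvar: "mpartial i (mvar j) = (if i = j then 1 else 0)"
proof -
  have *: "M + axis i 1 = axis j 1 \<longleftrightarrow> M = 0 \<and> i = j" for M :: "nat ^ 'b"
  proof (cases "i = j")
    case False
    then have "(M + axis i 1) $ i \<noteq> axis j 1 $ i" by (simp add: axis_def)
    then show ?thesis using False by metis
  qed simp
  show ?thesis
    by (auto simp: mfps_eq_iff mcoeff_mpartial mcoeff_mvar mcoeff_1 *)
qed

definition der :: "('a :: comm_ring_1, 'n :: finite) mfps ^ 'n \<Rightarrow> ('a, 'n) mfps \<Rightarrow> ('a, 'n) mfps" where
  "der V f = (\<Sum>j\<in>UNIV. V $ j * mpartial j f)"

lemma der_0 [simp]: "der V 0 = 0"
  and der_mconst [simp]: "der V (mconst a) = 0"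
  by (simp_all add: der_def)

lemma der_add: "der V (f + g) = der V f + der V g"
  and der_diff: "der V (f - g) = der V f - der V g"
  and der_mult: "der V (f * g) = der V f * g + f * der V g"
  by (simp_all add: der_def mpartial_add mpartial_diff mpartial_mult algebra_simps
      sum.distrib sum_subtractf sum_distrib_left)

lemma der_mconst_mult: "der V (mconst a * f) = mconst a * der V f"
  by (simp add: der_mult)

lemma der_mvar: "der V (mvar i) = V $ i"
proof -
  have "der V (mvar i) = (\<Sum>j\<in>UNIV. if j = i then V $ j else 0)"
    unfolding der_def by (rule sum.cong) (auto simp: mpartial_mvar)
  then show ?thesis by simp
qed

lemma der_vec_add: "der (V + W) f = der V f + der W f"
  and der_vec_diff: "der (V - W) f = der V f - der W f"
  by (simp_all add: der_def algebra_simps sum.distrib sum_subtractf)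

lemma wge_der:
  assumes V: "\<And>j. wge c (c j + r) (V $ j)" and f: "wge c k f"
  shows "wge c (k + r) (der V f)"
  unfolding der_def
proof (rule wge_sum)
  fix j
  show "wge c (k + r) (V $ j * mpartial j f)"
    by (rule wge_mono[OF wge_mult[OF V wge_mpartial[OF f]]]) simp
qed

definition dvf :: "'a :: comm_ring_1 ^ 'n :: finite \<Rightarrow> ('a, 'n) mfps ^ 'n" where
  "dvf v = (\<chi> i. mconst (v $ i) * mvar i)"

definition wgt :: "'a :: comm_ring_1 ^ 'n :: finite \<Rightarrow> nat ^ 'n \<Rightarrow> 'a" where
  "wgt v M = (\<Sum>i\<in>UNIV. of_nat (M $ i) * v $ i)"

lemma wgt_0 [simp]: "wgt v 0 = 0"
  and wgt_add: "wgt v (M + N) = wgt v M + wgt v N"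
  by (simp_all add: wgt_def algebra_simps sum.distrib)

lemma wgt_axis [simp]: "wgt v (axis i 1) = v $ i"
proof -
  have "wgt v (axis i 1) = (\<Sum>j\<in>UNIV. if j = i then v $ j else 0)"
    unfolding wgt_def by (rule sum.cong) (auto simp: axis_def)
  then show ?thesis by simp
qed

lemma mcoeff_der_dvf: "mcoeff (der (dvf v) f) M = wgt v M * mcoeff f M"
proof -
  have "mcoeff (dvf v $ j * mpartial j f) M = of_nat (M $ j) * v $ j * mcoeff f M" for j
  proof -
    have *: "dvf v $ j * mpartial j f = mconst (v $ j) * (mvar j * mpartial j f)"
      by (simp add: dvf_def mult.assoc)
    show ?thesis
    proof (cases "M $ j = 0")
      case False
      then have "(M - axis j 1) $ j + 1 = M $ j" by (simp add: axis_def)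
      then show ?thesis
        unfolding * using False
        by (simp add: mcoeff_mvar_mult mcoeff_mpartial axis_add_diff mult.assoc mult.left_commute
            del: vector_minus_component of_nat_add)
    qed (simp add: * mcoeff_mvar_mult)
  qed
  then show ?thesis
    by (simp add: der_def mcoeff_sum wgt_def sum_distrib_right)
qed

definition mpow :: "('a :: comm_ring_1, 'n :: finite) mfps ^ 'n \<Rightarrow> nat ^ 'n \<Rightarrow> ('a, 'n) mfps" where
  "mpow H M = (\<Prod>i\<in>UNIV. (H $ i) ^ (M $ i))"

lemma mpow_0 [simp]: "mpow H 0 = 1"
  and mpow_add: "mpow H (M + N) = mpow H M * mpow H N"
  by (simp_all add: mpow_def power_add prod.distrib)

lemma mpow_axis [simp]: "mpow H (axis i 1) = H $ i"
proof -
  have "mpow H (axis i 1) = (\<Prod>j\<in>UNIV. if j = i then H $ j else 1)"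
    unfolding mpow_def by (rule prod.cong) (auto simp: axis_def)
  then show ?thesis by simp
qed

lemma exponent_induct [case_names 0 step]:
  fixes M :: "nat ^ 'n :: finite"
  assumes "P 0" "\<And>M i. P M \<Longrightarrow> P (M + axis i 1)"
  shows "P M"
proof (induction "mdeg M" arbitrary: M)
  case 0
  then show ?case using assms(1) by (simp add: mdeg_eq_0_iff)
next
  case (Suc k)
  then have "M \<noteq> 0" by auto
  then obtain i where i: "M $ i \<noteq> 0" by (auto simp: vec_eq_iff)
  have "mdeg (M - axis i 1) + 1 = mdeg M"
    using arg_cong[OF axis_add_diff[OF i], of mdeg] by (simp add: mdeg_add)
  then have "P (M - axis i 1)" using Suc by simp
  from assms(2)[OF this, of i] show ?case by (simp add: axis_add_diff[OF i])
qed

lemma wge_mpow: "(\<And>i. wge c (d i) (H $ i)) \<Longrightarrow> wge c (wt d M) (mpow H M)"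
proof (induction M rule: exponent_induct)
  case (step M i)
  then show ?case by (simp add: mpow_add wt_add wge_mult)
qed simp

text \<open>The factors of \<open>mpow H M\<close> are exchanged for those of \<open>mpow K M\<close> one at a time, and each exchange
gains \<open>r\<close> over the expected order. Through this lemma a substitution depends on its low order
terms only.\<close>

lemma wge_mpow_diff:
  assumes "\<And>i. wge c (c i) (H $ i)" "\<And>i. wge c (c i) (K $ i)"
    and "\<And>i. wge c (c i + r) (H $ i - K $ i)"
  shows "wge c (wt c M + r) (mpow H M - mpow K M)"
proof (induction M rule: exponent_induct)
  case (step M i)
  have "mpow H (M + axis i 1) - mpow K (M + axis i 1) =
      (mpow H M - mpow K M) * H $ i + mpow K M * (H $ i - K $ i)"
    by (simp add: mpow_add algebra_simps)
  moreover have "wge c (wt c (M + axis i 1) + r) ((mpow H M - mpow K M) * H $ i)"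
    using wge_mult[OF step assms(1)[of i]] by (simp add: wt_add algebra_simps)
  moreover have "wge c (wt c (M + axis i 1) + r) (mpow K M * (H $ i - K $ i))"
    using wge_mult[OF wge_mpow[OF assms(2)] assms(3)[of i]] by (simp add: wt_add algebra_simps)
  ultimately show ?case by (simp add: wge_add)
qed simp

lemma mcoeff_mpow_small:
  assumes "\<And>i. order_ge 1 (H $ i)" "mdeg P < mdeg M"
  shows "mcoeff (mpow H M) P = 0"
  using wge_mpow[of "\<lambda>_. 1" "\<lambda>_. 1" H M] assms by (auto simp: order_ge_eq_wge mdeg_eq_wt wge_def)

text \<open>As \<open>mpow H M\<close> has order at least \<open>mdeg M\<close>, larger exponents contribute nothing. A range of summation
that does not depend on \<open>P\<close> is what makes sums over several coefficients manageable.\<close>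

lemma mcoeff_msubst:
  assumes H: "\<And>i. order_ge 1 (H $ i)" and k: "mdeg P \<le> k"
  shows "mcoeff (msubst f H) P = (\<Sum>M | mdeg M \<le> k. mcoeff f M * mcoeff (mpow H M) P)"
proof -
  have "mcoeff (msubst f H) P = (\<Sum>M | mdeg M \<le> mdeg P. mcoeff f M * mcoeff (mpow H M) P)"
    by (simp add: msubst_def mpow_def)
  also have "\<dots> = (\<Sum>M | mdeg M \<le> k. mcoeff f M * mcoeff (mpow H M) P)"
    using k mcoeff_mpow_small[OF H] by (intro sum.mono_neutral_left) auto
  finally show ?thesis .
qed

lemma msubst_add: "msubst (f + g) H = msubst f H + msubst g H"
  and msubst_diff: "msubst (f - g) H = msubst f H - msubst g H"
  by (simp_all add: mfps_eq_iff msubst_def algebra_simps sum.distrib sum_subtractf)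

lemma msubst_0 [simp]: "msubst 0 H = 0"
  by (simp add: mfps_eq_iff msubst_def)

lemma msubst_sum: "msubst (sum f A) H = (\<Sum>x\<in>A. msubst (f x) H)"
  by (induction A rule: infinite_finite_induct) (auto simp: msubst_add)

lemma msubst_mconst [simp]: "msubst (mconst a) H = (mconst a :: ('a :: comm_ring_1, 'b :: finite) mfps)"
proof (rule mfps_eqI)
  fix P :: "nat ^ 'b"
  have "mcoeff (msubst (mconst a) H) P =
      (\<Sum>M :: nat ^ 'b | mdeg M \<le> mdeg P. if M = 0 then mcoeff (mconst a) P else 0)"
    unfolding msubst_def mcoeff_Abs_mfps mpow_def[symmetric]
    by (rule sum.cong) (auto simp: mcoeff_mconst mcoeff_1)
  then show "mcoeff (msubst (mconst a) H) P = mcoeff (mconst a) P" by simp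
qed

lemma msubst_mvar:
  assumes "\<And>i. order_ge 1 (H $ i)"
  shows "msubst (mvar i) H = H $ i"
proof (rule mfps_eqI)
  fix P
  have "mcoeff (msubst (mvar i) H) P =
      (\<Sum>M | mdeg M \<le> mdeg P + 1. if M = axis i 1 then mcoeff (H $ i) P else 0)"
    unfolding mcoeff_msubst[where k = "mdeg P + 1", OF assms le_add1]
    by (rule sum.cong) (auto simp: mcoeff_mvar)
  then show "mcoeff (msubst (mvar i) H) P = mcoeff (H $ i) P" by simp
qed

text \<open>Both sides are sums of \<open>mcoeff f M * mcoeff g N * mcoeff (mpow H (M + N)) P\<close> over pairs \<open>(M, N)\<close>. On one
side they are grouped by \<open>M + N\<close>; the pairs that are missing there have \<open>mdeg (M + N) > mdeg P\<close> and
contribute nothing.\<close>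

lemma msubst_mult:
  fixes f g :: "('a :: comm_ring_1, 'n :: finite) mfps"
  assumes H: "\<And>i. order_ge 1 (H $ i)"
  shows "msubst (f * g) H = msubst f H * msubst g H"
proof (rule mfps_eqI)
  fix P :: "nat ^ 'n"
  define k where "k = mdeg P"
  define S where "S = {M :: nat ^ 'n. mdeg M \<le> k}"
  have S: "finite S" by (simp add: S_def)
  have "mcoeff (msubst f H * msubst g H) P =
      (\<Sum>(a, b)\<in>splits P. \<Sum>M\<in>S. \<Sum>N\<in>S. mcoeff f M * mcoeff g N *
        (mcoeff (mpow H M) a * mcoeff (mpow H N) b))"
    unfolding mcoeff_mult
  proof (rule sum.cong, simp, safe)
    fix a b assume "(a, b) \<in> splits P"
    then have "mdeg a \<le> k" "mdeg b \<le> k" by (auto simp: splits_def k_def mdeg_add)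
    then show "mcoeff (msubst f H) a * mcoeff (msubst g H) b = (\<Sum>M\<in>S. \<Sum>N\<in>S.
        mcoeff f M * mcoeff g N * (mcoeff (mpow H M) a * mcoeff (mpow H N) b))"
      by (simp add: mcoeff_msubst[OF H] S_def[symmetric] sum_product algebra_simps)
  qed
  also have "\<dots> = (\<Sum>M\<in>S. \<Sum>N\<in>S. \<Sum>(a, b)\<in>splits P. mcoeff f M * mcoeff g N *
        (mcoeff (mpow H M) a * mcoeff (mpow H N) b))"
    unfolding case_prod_unfold
    by (subst sum.swap, rule sum.cong, simp, rule sum.swap)
  also have "\<dots> = (\<Sum>M\<in>S. \<Sum>N\<in>S. mcoeff f M * mcoeff g N * mcoeff (mpow H (M + N)) P)"
    by (simp add: mpow_add mcoeff_mult sum_distrib_left case_prod_unfold)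
  also have "\<dots> = (\<Sum>(M, N)\<in>S \<times> S. mcoeff f M * mcoeff g N * mcoeff (mpow H (M + N)) P)"
    by (simp add: sum.cartesian_product)
  also have "\<dots> = (\<Sum>(M, N)\<in>{(M, N). mdeg (M + N) \<le> k}.
        mcoeff f M * mcoeff g N * mcoeff (mpow H (M + N)) P)"
  proof (rule sum.mono_neutral_right)
    have "mcoeff (mpow H (M + N)) P = 0" if "\<not> mdeg (M + N) \<le> k" for M N
      using mcoeff_mpow_small[OF H, of P "M + N"] that by (simp add: k_def)
    then show "\<forall>p\<in>S \<times> S - {(M, N). mdeg (M + N) \<le> k}.
        (case p of (M, N) \<Rightarrow> mcoeff f M * mcoeff g N * mcoeff (mpow H (M + N)) P) = 0"
      by (auto, metis mult_zero_right)
  qed (auto simp: S_def mdeg_add)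
  also have "\<dots> = (\<Sum>(K, p)\<in>(SIGMA K:S. splits K).
        mcoeff f (fst p) * mcoeff g (snd p) * mcoeff (mpow H K) P)"
    by (rule sum.reindex_bij_witness[of _ "\<lambda>(K, p). p" "\<lambda>(M, N). (M + N, (M, N))"])
       (auto simp: S_def splits_def)
  also have "\<dots> = (\<Sum>K\<in>S. \<Sum>p\<in>splits K. mcoeff f (fst p) * mcoeff g (snd p) * mcoeff (mpow H K) P)"
    by (subst sum.Sigma) (auto simp: S)
  also have "\<dots> = mcoeff (msubst (f * g) H) P"
    by (simp add: mcoeff_msubst[OF H, of P k] k_def S_def mcoeff_mult case_prod_unfold
        sum_distrib_right)
  finally show "mcoeff (msubst (f * g) H) P = mcoeff (msubst f H * msubst g H) P" ..
qed

lemma wge_msubst: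
  assumes c: "\<And>i. c i \<ge> 1" and H: "\<And>i. wge c (c i) (H $ i)" and f: "wge c k f"
  shows "wge c k (msubst f H)"
  unfolding wge_def
proof safe
  fix P assume P: "wt c P < k"
  have "mcoeff f M * mcoeff (mpow H M) P = 0" for M
  proof (cases "wt c M < k")
    case False
    then have "mcoeff (mpow H M) P = 0" using wge_mpow[OF H, of M] P by (auto simp: wge_def)
    then show ?thesis by simp
  qed (use f in \<open>simp add: wge_def\<close>)
  then show "mcoeff (msubst f H) P = 0" by (simp add: msubst_def mpow_def[symmetric])
qed

lemma wge_msubst_diff:
  assumes H: "\<And>i. wge c (c i) (H $ i)" and K: "\<And>i. wge c (c i) (K $ i)"
    and d: "\<And>i. wge c (c i + r) (H $ i - K $ i)" and f: "wge c k f"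
  shows "wge c (k + r) (msubst f H - msubst f K)"
  unfolding wge_def
proof safe
  fix P assume P: "wt c P < k + r"
  have "mcoeff f M * mcoeff (mpow H M - mpow K M) P = 0" for M
  proof (cases "wt c M < k")
    case False
    then have "mcoeff (mpow H M - mpow K M) P = 0"
      using wge_mpow_diff[OF H K d, of M] P by (auto simp: wge_def)
    then show ?thesis by simp
  qed (use f in \<open>simp add: wge_def\<close>)
  then have "(\<Sum>M | mdeg M \<le> mdeg P. mcoeff f M * mcoeff (mpow H M - mpow K M) P) = 0"
    by (intro sum.neutral) auto
  then show "mcoeff (msubst f H - msubst f K) P = 0"
    by (simp add: msubst_def mpow_def[symmetric] algebra_simps sum_subtractf)
qed

lemma mpartial_mpow:
  "mpartial j (mpow H M) = (\<Sum>i\<in>UNIV. mconst (of_nat (M $ i)) * mpow H (M - axis i 1) * mpartial j (H $ i))"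
proof (induction M rule: exponent_induct)
  case 0
  have "(0 - axis i 1 :: nat ^ 'b) = 0" for i by (simp add: vec_eq_iff)
  then show ?case by simp
next
  case (step M k)
  have *: "mconst (of_nat ((M + axis k 1) $ i)) * mpow H (M + axis k 1 - axis i 1) =
      mconst (of_nat (M $ i)) * mpow H (M - axis i 1) * H $ k + (if i = k then mpow H M else 0)"
    for i
  proof (cases "i = k")
    case True
    have "mconst (of_nat (M $ k)) * mpow H M = mconst (of_nat (M $ k)) * mpow H (M - axis k 1) * H $ k"
    proof (cases "M $ k = 0")
      case False
      then have "mpow H M = mpow H (M - axis k 1) * H $ k"
        using mpow_add[of H "M - axis k 1" "axis k 1"] axis_add_diff[OF False] by simp
      then show ?thesis by (simp add: mult.assoc)
    qed simp
    with True show ?thesis by (simp add: axis_def mconst_add algebra_simps)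
  next
    case False
    show ?thesis
    proof (cases "M $ i = 0")
      case True
      then show ?thesis using False by (simp add: axis_def)
    next
      case nz: False
      have "M + axis k 1 - axis i 1 = (M - axis i 1) + axis k 1"
        using nz by (auto simp: vec_eq_iff axis_def)
      then show ?thesis using False by (simp add: mpow_add mult.assoc) (simp add: axis_def)
    qed
  qed
  have "(\<Sum>i\<in>UNIV. mconst (of_nat ((M + axis k 1) $ i)) * mpow H (M + axis k 1 - axis i 1) * mpartial j (H $ i))
      = (\<Sum>i\<in>UNIV. mconst (of_nat (M $ i)) * mpow H (M - axis i 1) * mpartial j (H $ i) * H $ k +
          (if i = k then mpow H M * mpartial j (H $ k) else 0))"
    by (rule sum.cong, simp, subst *) (auto simp: algebra_simps)
  also have "\<dots> = mpartial j (mpow H M) * H $ k + mpow H M * mpartial j (H $ k)"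
    by (simp add: sum.distrib step sum_distrib_right)
  also have "\<dots> = mpartial j (mpow H (M + axis k 1))"
    by (simp add: mpow_add mpartial_mult)
  finally show ?case ..
qed

text \<open>The chain rule, obtained termwise from the rule for monomials \<open>mpow H M\<close>; the shift \<open>M = N + e\<^sub>i\<close> of the
exponents matches the two sides.\<close>

lemma mpartial_msubst:
  fixes f :: "('a :: comm_ring_1, 'n :: finite) mfps"
  assumes H: "\<And>i. order_ge 1 (H $ i)"
  shows "mpartial j (msubst f H) = (\<Sum>i\<in>UNIV. msubst (mpartial i f) H * mpartial j (H $ i))"
proof (rule mfps_eqI)
  fix P :: "nat ^ 'n"
  define k where "k = mdeg P + 1"
  define T where "T i N = of_nat (N $ i + 1) * mcoeff f (N + axis i 1) *
      mcoeff (mpow H N * mpartial j (H $ i)) P" for i N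
  have "mcoeff (mpartial j (msubst f H)) P =
      of_nat (P $ j + 1) * (\<Sum>M | mdeg M \<le> k. mcoeff f M * mcoeff (mpow H M) (P + axis j 1))"
    by (simp add: mcoeff_mpartial mcoeff_msubst[OF H, of _ k] k_def mdeg_add)
  also have "\<dots> = (\<Sum>M | mdeg M \<le> k. mcoeff f M * mcoeff (mpartial j (mpow H M)) P)"
    by (simp add: mcoeff_mpartial sum_distrib_left algebra_simps)
  also have "\<dots> = (\<Sum>M | mdeg M \<le> k. \<Sum>i\<in>UNIV. of_nat (M $ i) * mcoeff f M *
      mcoeff (mpow H (M - axis i 1) * mpartial j (H $ i)) P)"
    by (simp add: mpartial_mpow mcoeff_sum sum_distrib_left mult.assoc)
       (simp add: algebra_simps)
  also have "\<dots> = (\<Sum>i\<in>UNIV. \<Sum>M | mdeg M \<le> k. of_nat (M $ i) * mcoeff f M *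
      mcoeff (mpow H (M - axis i 1) * mpartial j (H $ i)) P)"
    by (rule sum.swap)
  also have "\<dots> = (\<Sum>i\<in>UNIV. \<Sum>N | mdeg N \<le> mdeg P. T i N)"
  proof (rule sum.cong)
    fix i :: 'n
    have "(\<Sum>M | mdeg M \<le> k. of_nat (M $ i) * mcoeff f M *
        mcoeff (mpow H (M - axis i 1) * mpartial j (H $ i)) P) =
      (\<Sum>M | mdeg M \<le> k \<and> M $ i \<noteq> 0. of_nat (M $ i) * mcoeff f M *
        mcoeff (mpow H (M - axis i 1) * mpartial j (H $ i)) P)"
      by (rule sum.mono_neutral_right) auto
    also have "\<dots> = (\<Sum>N | mdeg N \<le> mdeg P. T i N)"
    proof (rule sum.reindex_bij_witness[of _ "\<lambda>N. N + axis i 1" "\<lambda>M. M - axis i 1"], goal_cases)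
      case (1 M)
      then show ?case by (simp add: axis_add_diff)
    next
      case (2 M)
      then have "mdeg (M - axis i 1) + 1 = mdeg M"
        using arg_cong[OF axis_add_diff[of M i], of mdeg] by (simp add: mdeg_add)
      with 2 show ?case by (simp add: k_def)
    next
      case (3 N)
      then show ?case by simp
    next
      case (4 N)
      then show ?case by (simp add: k_def mdeg_add)
    next
      case (5 M)
      then show ?case by (simp add: T_def axis_add_diff)
    qed
    finally show "(\<Sum>M | mdeg M \<le> k. of_nat (M $ i) * mcoeff f M *
        mcoeff (mpow H (M - axis i 1) * mpartial j (H $ i)) P) = (\<Sum>N | mdeg N \<le> mdeg P. T i N)" .
  qed simp
  also have "\<dots> = (\<Sum>i\<in>UNIV. mcoeff (msubst (mpartial i f) H * mpartial j (H $ i)) P)"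
  proof (rule sum.cong)
    fix i :: 'n
    have "mcoeff (msubst (mpartial i f) H * mpartial j (H $ i)) P =
        (\<Sum>(a, b)\<in>splits P. \<Sum>N | mdeg N \<le> mdeg P. mcoeff (mpartial i f) N *
          (mcoeff (mpow H N) a * mcoeff (mpartial j (H $ i)) b))"
      unfolding mcoeff_mult
    proof (rule sum.cong, simp, safe)
      fix a b assume "(a, b) \<in> splits P"
      then have "mdeg a \<le> mdeg P" by (auto simp: splits_def mdeg_add)
      then show "mcoeff (msubst (mpartial i f) H) a * mcoeff (mpartial j (H $ i)) b =
          (\<Sum>N | mdeg N \<le> mdeg P. mcoeff (mpartial i f) N *
            (mcoeff (mpow H N) a * mcoeff (mpartial j (H $ i)) b))"
        by (simp add: mcoeff_msubst[OF H] sum_distrib_right mult.assoc)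
    qed
    also have "\<dots> = (\<Sum>N | mdeg N \<le> mdeg P. T i N)"
      unfolding case_prod_unfold
      by (subst sum.swap)
        (simp add: T_def mcoeff_mpartial mcoeff_mult case_prod_unfold sum_distrib_left mult.assoc)
    finally show "(\<Sum>N | mdeg N \<le> mdeg P. T i N) =
        mcoeff (msubst (mpartial i f) H * mpartial j (H $ i)) P" ..
  qed simp
  finally show "mcoeff (mpartial j (msubst f H)) P =
      mcoeff (\<Sum>i\<in>UNIV. msubst (mpartial i f) H * mpartial j (H $ i)) P"
    by (simp add: mcoeff_sum)
qed

lemma order_ge_1_transformation:
  assumes "transformation H"
  shows "order_ge 1 (H $ i)" "order_ge 2 (H $ i - mvar i)"
proof -
  obtain h where h: "\<And>i. order_ge 2 (h $ i)" "H = (\<chi> i. mvar i) + h"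
    using assms by (auto simp: transformation_def)
  then show "order_ge 2 (H $ i - mvar i)" by simp
  have "order_ge 1 (mvar i + h $ i)"
    unfolding order_ge_eq_wge using h(1)[of i] wge_mvar[of "\<lambda>_. 1" i]
    by (intro wge_add) (auto simp: order_ge_eq_wge intro: wge_mono)
  then show "order_ge 1 (H $ i)" using h(2) by simp
qed

lemma mpow_mvar: "mcoeff (mpow (\<chi> i. mvar i) M) P = (if P = M then 1 else 0)"
proof (induction M arbitrary: P rule: exponent_induct)
  case 0
  then show ?case by (simp add: mcoeff_1)
next
  case (step M i)
  have "P = M + axis i 1 \<longleftrightarrow> P $ i \<noteq> 0 \<and> P - axis i 1 = M"
    by (metis add_diff_cancel_right' axis_add_diff axis_le_iff add.commute)
  then show ?case
    by (simp add: mpow_add mult.commute[of _ "mvar i"] mcoeff_mvar_mult step)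
qed

text \<open>A near-identity substitution leaves the homogeneous part of lowest degree unchanged, so it is injective
and preserves nonzero denominators.\<close>

lemma msubst_eq_0_iff:
  assumes H: "transformation H"
  shows "msubst f H = 0 \<longleftrightarrow> f = 0"
proof
  assume *: "msubst f H = 0"
  show "f = 0"
  proof (rule ccontr)
    assume "f \<noteq> 0"
    then have "\<exists>M. mcoeff f M \<noteq> 0" by (auto simp: mfps_eq_iff)
    then obtain P where P: "mcoeff f P \<noteq> 0" "\<And>M. mcoeff f M \<noteq> 0 \<Longrightarrow> mdeg P \<le> mdeg M"
      using ex_has_least_nat[of "\<lambda>M. mcoeff f M \<noteq> 0" _ mdeg] by auto
    have "wge (\<lambda>_. 1) (wt (\<lambda>_. 1) M + 1) (mpow H M - mpow (\<chi> i. mvar i) M)" for M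
      using order_ge_1_transformation[OF H] wge_mvar[of "\<lambda>_. 1"]
      by (intro wge_mpow_diff) (auto simp: order_ge_eq_wge numeral_2_eq_2)
    then have "mcoeff (mpow H M) P = (if P = M then 1 else 0)" if "mdeg M = mdeg P" for M
      using that by (auto simp: wge_def mdeg_eq_wt mpow_mvar)
    then have "mcoeff (msubst f H) P = (\<Sum>M | mdeg M \<le> mdeg P. if M = P then mcoeff f P else 0)"
      unfolding msubst_def mcoeff_Abs_mfps mpow_def[symmetric] using P(2)
      by (intro sum.cong) (auto, metis le_antisym)
    then show False using * P(1) by simp
  qed
qed simp

section \<open>Formal normal forms\<close>

lemma pair_lower: "pair (lower i M) lam = wgt lam M - lam $ i"
proof -
  have "pair (lower i M) lam =
      (\<Sum>k\<in>UNIV. of_nat (M $ k) * lam $ k - (if k = i then lam $ k else 0))"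
    unfolding pair_def lower_def
    by (rule sum.cong) (auto simp: axis_def algebra_simps)
  then show ?thesis by (simp add: sum_subtractf wgt_def)
qed

text \<open>The monomial \<open>x^M\<close> in component \<open>i\<close> belongs to \<open>Q = M - e\<^sub>i\<close>, so being in normal form says that
component \<open>i\<close> has weight \<open>lam $ i\<close>.\<close>

lemma normal_form_iff:
  "normal_form lam G \<longleftrightarrow> (\<forall>i M. mcoeff (G $ i) M \<noteq> 0 \<longrightarrow> wgt lam M = lam $ i)"
proof
  assume *: "normal_form lam G"
  show "\<forall>i M. mcoeff (G $ i) M \<noteq> 0 \<longrightarrow> wgt lam M = lam $ i"
  proof (intro allI impI)
    fix i M assume nz: "mcoeff (G $ i) M \<noteq> 0"
    have "vf_coeff G (lower i M) $ i = mcoeff (G $ i) M"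
      by (simp add: vf_coeff_def lower_in_Ni nat_lower del: vector_add_component)
    with nz have "vf_coeff G (lower i M) \<noteq> 0" by auto
    moreover have "lower i M \<in> NN" using lower_in_Ni by (auto simp: NN_def)
    ultimately have "pair (lower i M) lam = 0" using * by (auto simp: normal_form_def)
    then show "wgt lam M = lam $ i" by (simp add: pair_lower)
  qed
next
  assume *: "\<forall>i M. mcoeff (G $ i) M \<noteq> 0 \<longrightarrow> wgt lam M = lam $ i"
  show "normal_form lam G"
    unfolding normal_form_def
  proof (intro ballI impI)
    fix Q assume Q: "pair Q lam \<noteq> 0"
    have "vf_coeff G Q $ i = 0" for i
    proof (cases "Q \<in> Ni i")
      case True
      define M where "M = (\<chi> k. nat ((Q + axis i 1) $ k))"
      have "lower i M = Q" unfolding M_def by (rule lower_nat[OF True])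
      then have "wgt lam M \<noteq> lam $ i" using Q pair_lower[of i M lam] by simp
      then have "mcoeff (G $ i) M = 0" using * by blast
      then show ?thesis by (simp add: vf_coeff_def M_def)
    qed (simp add: vf_coeff_def)
    then show "vf_coeff G Q = 0" by (simp add: vec_eq_iff)
  qed
qed

lemma transforms_iff: "transforms H F G \<longleftrightarrow> (\<forall>i. der G (H $ i) = msubst (F $ i) H)"
  by (simp add: transforms_def vec_eq_iff matrix_vector_mult_def der_def mult.commute)

text \<open>The value \<open>z\<close> stands in for those values that the recursion must not read.\<close>

lemma recursion_on_levels:
  fixes lev :: "'a \<Rightarrow> nat"
  shows "\<exists>f. \<forall>x. f x = Step x (\<lambda>y. if lev y < lev x then f y else z)"
proof
  define f where "f = wfrec (Wellfounded.measure lev) (\<lambda>f x. Step x (\<lambda>y. if lev y < lev x then f y else z))"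
  show "\<forall>x. f x = Step x (\<lambda>y. if lev y < lev x then f y else z)"
  proof
    fix x
    have "f x = Step x (\<lambda>y. if lev y < lev x then cut f (Wellfounded.measure lev) x y else z)"
      unfolding f_def by (subst wfrec) auto
    also have "(\<lambda>y. if lev y < lev x then cut f (Wellfounded.measure lev) x y else z) =
        (\<lambda>y. if lev y < lev x then f y else z)"
      by (auto simp: cut_apply fun_eq_iff)
    finally show "f x = Step x (\<lambda>y. if lev y < lev x then f y else z)" .
  qed
qed

text \<open>With \<open>H = x + h\<close>, \<open>F = dvf lam + Y\<close> and \<open>G = dvf lam + N\<close> the conjugation equation \<open>DH G = F \<circ> H\<close> reads
\<open>(wgt lam M - lam\<^sub>i) h\<^sub>i\<^sub>,\<^sub>M + N\<^sub>i\<^sub>,\<^sub>M = r\<^sub>i\<^sub>,\<^sub>M\<close>, where \<open>r\<^sub>i\<close> is the following series.\<close>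

definition homological_rhs where
  "homological_rhs Y h N i = msubst (Y $ i) ((\<chi> j. mvar j) + h) - der N (h $ i)"

text \<open>The right-hand side of the homological equation gains one level: since \<open>Y\<close>, \<open>h\<close> and \<open>N\<close> all exceed the
weighted order of the identity by one, its terms up to level \<open>k\<close> are determined by the terms of \<open>h\<close> and
\<open>N\<close> below level \<open>k\<close>.\<close>

lemma homological_rhs_diff:
  fixes Y h N h' N' :: "('a :: comm_ring_1, 'n :: finite) mfps ^ 'n"
  assumes h: "\<And>j. wge c (c j + 1) (h $ j)" "\<And>j. wge c (c j + 1) (h' $ j)"
    and N: "\<And>j. wge c (c j + 1) (N $ j)" "\<And>j. wge c (c j + 1) (N' $ j)"
    and Y: "\<And>j. wge c (c j + 1) (Y $ j)"
    and dh: "\<And>j. wge c (c j + k) (h $ j - h' $ j)"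
    and dN: "\<And>j. wge c (c j + k) (N $ j - N' $ j)"
  shows "wge c (c i + 1 + k) (homological_rhs Y h N i - homological_rhs Y h' N' i)"
proof -
  let ?H = "(\<chi> j. mvar j) + h" and ?H' = "(\<chi> j. mvar j) + h'"
  have H: "wge c (c j) (?H $ j)" "wge c (c j) (?H' $ j)" for j
    using h[of j] by (auto intro!: wge_add wge_mvar intro: wge_mono)
  have "homological_rhs Y h N i - homological_rhs Y h' N' i =
      (msubst (Y $ i) ?H - msubst (Y $ i) ?H') - der (N - N') (h $ i) - der N' (h $ i - h' $ i)"
    by (simp add: homological_rhs_def der_vec_diff der_diff)
  moreover have "wge c (c i + 1 + k) (msubst (Y $ i) ?H - msubst (Y $ i) ?H')"
    by (rule wge_msubst_diff[OF H _ Y]) (simp add: dh)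
  moreover have "wge c (c i + 1 + k) (der (N - N') (h $ i))"
    by (rule wge_der[OF _ h(1)]) (simp add: dN)
  moreover have "wge c (c i + k + 1) (der N' (h $ i - h' $ i))"
    by (rule wge_der[OF N(2) dh])
  ultimately show ?thesis by (simp add: wge_diff add.assoc add.commute[of 1])
qed

lemma wge_homological_rhs:
  fixes Y h N :: "('a :: comm_ring_1, 'n :: finite) mfps ^ 'n"
  assumes c: "\<And>j. c j \<ge> 1"
    and h: "\<And>j. wge c (c j + 1) (h $ j)" and N: "\<And>j. wge c (c j + 1) (N $ j)"
    and Y: "\<And>j. wge c (c j + 1) (Y $ j)"
  shows "wge c (c i + 1) (homological_rhs Y h N i)"
proof -
  have "wge c (c j) (((\<chi> j. mvar j) + h) $ j)" for j
    using h[of j] by (auto intro!: wge_add wge_mvar intro: wge_mono)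
  then have "wge c (c i + 1) (msubst (Y $ i) ((\<chi> j. mvar j) + h))"
    by (intro wge_msubst c Y)
  moreover have "wge c (c i + 1) (der N (h $ i))"
    using wge_der[OF N h] by (rule wge_mono) simp
  ultimately show ?thesis unfolding homological_rhs_def by (rule wge_diff)
qed

lemma mdeg_le_1_cases:
  assumes "mdeg M \<le> 1"
  shows "M = 0 \<or> (\<exists>i. M = axis i 1)"
proof (cases "M = 0")
  case False
  then obtain i where i: "M $ i \<noteq> 0" by (auto simp: vec_eq_iff)
  have eq: "M - axis i 1 + axis i 1 = M" by (rule axis_add_diff[OF i])
  have "mdeg (M - axis i 1) + 1 = mdeg M"
    using arg_cong[OF eq, of mdeg] by (simp add: mdeg_add)
  with assms have "M - axis i 1 = 0" by (simp add: mdeg_eq_0_iff[symmetric])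
  with eq show ?thesis by auto
qed simp

text \<open>A transformation has no influence on linear terms.\<close>

lemma mcoeff_msubst_transformation_axis:
  assumes H: "transformation H"
  shows "mcoeff (msubst f H) (axis l 1) = mcoeff f (axis l 1)"
proof -
  note H1 = order_ge_1_transformation[OF H]
  have lin: "mcoeff (H $ i) (axis l 1) = (if i = l then 1 else 0)" for i
  proof -
    have "mcoeff (H $ i - mvar i) (axis l 1) = 0"
      using H1(2)[of i] by (auto simp: order_ge_def)
    then show ?thesis by (auto simp: mcoeff_mvar axis_eq_axis)
  qed
  have "mcoeff f M * mcoeff (mpow H M) (axis l 1) = (if M = axis l 1 then mcoeff f (axis l 1) else 0)"
    if M: "mdeg M \<le> 1" for M
    using mdeg_le_1_cases[OF M] 
    by (auto simp: mcoeff_1 lin axis_eq_axis)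
  then have "mcoeff (msubst f H) (axis l 1) =
      (\<Sum>M | mdeg M \<le> 1. if M = axis l 1 then mcoeff f (axis l 1) else 0)"
    by (auto simp: mcoeff_msubst[OF H1(1), of _ 1] intro: sum.cong)
  then show ?thesis by simp
qed

text \<open>The Poincare-Dulac theorem. The homological equation is solved by recursion on the level
\<open>wt c M - c i\<close>: at a resonant place the right-hand side goes into the normal form, otherwise it is divided
by \<open>wgt lam M - lam $ i\<close> and goes into the transformation. Weighted levels allow \<open>F\<close> to have a nilpotent
linear part. The assumption on the linear terms keeps \<open>h\<close> free of linear terms, and by construction
\<open>h\<close> has no resonant terms, which matters for convergence.\<close>

theorem formal_normal_form:
  fixes F :: "'n :: finite fvec"
  assumes c: "\<And>j. c j \<ge> 1"
    and F: "\<And>i. wge c (c i + 1) (F $ i - dvf lam $ i)"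
    and lin: "\<And>i l. lam $ i \<noteq> lam $ l \<Longrightarrow> mcoeff (F $ i) (axis l 1) = 0"
  obtains H G where "transformation H" "transforms H F G" "normal_form lam G"
    "\<And>i M. mcoeff (H $ i - mvar i) M \<noteq> 0 \<Longrightarrow> wgt lam M \<noteq> lam $ i"
proof -
  define Y where "Y = F - dvf lam"
  have Y: "wge c (c i + 1) (Y $ i)" for i using F by (simp add: Y_def)
  define C where "C = (\<Sum>j\<in>UNIV. c j)"
  have C: "c j \<le> C" for j unfolding C_def by (rule member_le_sum) auto
  define lev where "lev = (\<lambda>(i, M). wt c M + (C - c i))"
  define hh :: "('n \<times> (nat ^ 'n) \<Rightarrow> complex \<times> complex) \<Rightarrow> 'n fvec"
    where "hh f = (\<chi> j. Abs_mfps (\<lambda>M. fst (f (j, M))))" for f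
  define nn :: "('n \<times> (nat ^ 'n) \<Rightarrow> complex \<times> complex) \<Rightarrow> 'n fvec"
    where "nn f = (\<chi> j. Abs_mfps (\<lambda>M. snd (f (j, M))))" for f
  define Step where "Step = (\<lambda>(i, M) f. let r = mcoeff (homological_rhs Y (hh f) (nn f) i) M in
     if wt c M \<le> c i then (0, 0)
     else if wgt lam M = lam $ i then (0, r)
     else if mdeg M \<le> 1 then (0, 0) else (r / (wgt lam M - lam $ i), 0))"
  obtain f where f: "\<And>x. f x = Step x (\<lambda>y. if lev y < lev x then f y else (0, 0))"
    using recursion_on_levels[of Step lev "(0, 0)"] by blast
  define h where "h = hh f"
  define N where "N = nn f"
  have low: "f (i, M) = (0, 0)" if "wt c M \<le> c i" for i M
    using that by (subst f) (simp add: Step_def)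
  have h: "wge c (c j + 1) (h $ j)" and N: "wge c (c j + 1) (N $ j)" for j
    by (auto simp: wge_def h_def N_def hh_def nn_def low)
  \<comment> \<open>Replacing the truncated series \<open>f'\<close> that the recursion may read by the full series does not change
    the right-hand side at this place. If \<open>lev (i, M) < C\<close>, then \<open>k = 0\<close>, and both sides vanish for
    reasons of order.\<close>
  have rec: "f (i, M) = (let r = mcoeff (homological_rhs Y h N i) M in
     if wt c M \<le> c i then (0, 0)
     else if wgt lam M = lam $ i then (0, r)
     else if mdeg M \<le> 1 then (0, 0) else (r / (wgt lam M - lam $ i), 0))" for i M
  proof -
    define f' where "f' = (\<lambda>y. if lev y < lev (i, M) then f y else (0, 0))"
    define k where "k = lev (i, M) - C"
    have h': "wge c (c j + 1) (hh f' $ j)" and N': "wge c (c j + 1) (nn f' $ j)" for j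
      by (auto simp: wge_def hh_def nn_def low f'_def)
    have eq: "f' (j, P) = f (j, P)" if "wt c P < c j + k" for j P
    proof (cases "C \<le> lev (i, M)")
      case True
      then have "lev (j, P) < lev (i, M)"
        using that C[of j] by (simp add: lev_def k_def)
      then show ?thesis by (simp add: f'_def)
    next
      case False
      then have "wt c P < c j" using that by (simp add: k_def)
      then show ?thesis by (simp add: f'_def low)
    qed
    have "wge c (c j + k) (h $ j - hh f' $ j)" "wge c (c j + k) (N $ j - nn f' $ j)" for j
      by (auto simp: wge_def h_def hh_def N_def nn_def eq)
    then have "wge c (c i + 1 + k) (homological_rhs Y h N i - homological_rhs Y (hh f') (nn f') i)"
      by (intro homological_rhs_diff[OF h h' N N' Y])
    moreover have "wt c M < c i + 1 + k" using C[of i] by (simp add: k_def lev_def)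
    ultimately have "mcoeff (homological_rhs Y h N i) M = mcoeff (homological_rhs Y (hh f') (nn f') i) M"
      by (auto simp: wge_def)
    then show ?thesis
      by (subst f) (simp add: Step_def f'_def[symmetric])
  qed
  have h2: "order_ge 2 (h $ i)" for i
  proof -
    have "fst (f (i, M)) = 0" if "mdeg M < 2" for M
      using that by (subst rec) (simp add: Let_def)
    then show ?thesis by (auto simp: order_ge_def h_def hh_def)
  qed
  define H where "H = (\<chi> j. mvar j) + h"
  define G where "G = dvf lam + N"
  have tr: "transformation H" using h2 by (auto simp: transformation_def H_def)
  note H1 = order_ge_1_transformation[OF tr]
  have N1: "order_ge 1 (N $ j)" for j
  proof -
    have "mcoeff (N $ j) M = 0" if "mdeg M < 1" for M
    proof -
      have "M = 0" using that by (simp add: mdeg_eq_0_iff)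
      then show ?thesis using N[of j] by (simp add: wge_def)
    qed
    then show ?thesis by (auto simp: order_ge_def)
  qed
  have key: "(wgt lam M - lam $ i) * mcoeff (h $ i) M + mcoeff (N $ i) M =
      mcoeff (homological_rhs Y h N i) M" for i M
  proof -
    let ?r = "mcoeff (homological_rhs Y h N i) M"
    have hn: "mcoeff (h $ i) M = fst (f (i, M))" "mcoeff (N $ i) M = snd (f (i, M))"
      by (simp_all add: h_def hh_def N_def nn_def)
    consider "wt c M \<le> c i" | "wt c M > c i" "wgt lam M = lam $ i"
      | "wt c M > c i" "wgt lam M \<noteq> lam $ i" "mdeg M \<le> 1"
      | "wt c M > c i" "wgt lam M \<noteq> lam $ i" "mdeg M > 1" by linarith
    then show ?thesis
    proof cases
      case 1
      then have "?r = 0" using wge_homological_rhs[OF c h N Y, of i] by (simp add: wge_def)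
      with 1 show ?thesis by (simp add: hn low)
    next
      case 2
      then show ?thesis unfolding hn by (subst (1 2) rec) (simp add: Let_def)
    next
      case 3
      then have "M \<noteq> 0" by auto
      with 3 obtain l where l: "M = axis l 1" using mdeg_le_1_cases by blast
      have ne: "lam $ i \<noteq> lam $ l" using 3 l by auto
      then have "i \<noteq> l" by auto
      have "order_ge (2 + 0) (der N (h $ i))"
        unfolding order_ge_eq_wge using N1 h2
        by (intro wge_der) (auto simp: order_ge_eq_wge)
      then have "mcoeff (der N (h $ i)) M = 0" using l by (simp add: order_ge_def)
      moreover have "mcoeff (msubst (Y $ i) H) M = 0"
        unfolding l mcoeff_msubst_transformation_axis[OF tr]
        using lin[OF ne] \<open>i \<noteq> l\<close> by (simp add: Y_def dvf_def mcoeff_mvar axis_eq_axis)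
      ultimately have "?r = 0" by (simp add: homological_rhs_def H_def)
      then show ?thesis unfolding hn using 3 by (subst (1 2) rec) (simp add: Let_def)
    next
      case 4
      then show ?thesis unfolding hn by (subst (1 2) rec) (simp add: Let_def)
    qed
  qed
  show ?thesis
  proof
    show "transformation H" by fact
    show "transforms H F G"
      unfolding transforms_iff
    proof
      fix i
      have "der (dvf lam) (h $ i) - mconst (lam $ i) * h $ i + N $ i = homological_rhs Y h N i"
        using key[of _ i] by (simp add: mfps_eq_iff mcoeff_der_dvf left_diff_distrib)
      then have *: "der (dvf lam) (h $ i) + N $ i + der N (h $ i) =
          msubst (Y $ i) H + mconst (lam $ i) * h $ i"
        by (simp add: homological_rhs_def H_def algebra_simps)
      have "der G (H $ i) = G $ i + (der (dvf lam) (h $ i) + der N (h $ i))"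
        by (simp add: H_def der_add der_mvar G_def der_vec_add)
      also have "\<dots> = dvf lam $ i + mconst (lam $ i) * h $ i + msubst (Y $ i) H"
        using * by (simp add: G_def algebra_simps)
      also have "\<dots> = mconst (lam $ i) * H $ i + msubst (Y $ i) H"
        by (simp add: H_def dvf_def algebra_simps)
      also have "\<dots> = msubst (dvf lam $ i + Y $ i) H"
        by (simp add: msubst_add dvf_def msubst_mult[OF H1(1)] msubst_mvar[OF H1(1)])
      finally show "der G (H $ i) = msubst (F $ i) H" by (simp add: Y_def)
    qed
    show "normal_form lam G"
      unfolding normal_form_iff
    proof (intro allI impI)
      fix i M assume nz: "mcoeff (G $ i) M \<noteq> 0"
      show "wgt lam M = lam $ i"
      proof (rule ccontr)
        assume *: "wgt lam M \<noteq> lam $ i"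
        then have "M \<noteq> axis i 1" by auto
        then have "mcoeff (N $ i) M \<noteq> 0" using nz by (simp add: G_def dvf_def mcoeff_mvar)
        moreover have "snd (f (i, M)) = 0" using * by (subst rec) (simp add: Let_def)
        ultimately show False by (simp add: N_def nn_def)
      qed
    qed
    fix i M assume nz: "mcoeff (H $ i - mvar i) M \<noteq> 0"
    show "wgt lam M \<noteq> lam $ i"
    proof
      assume *: "wgt lam M = lam $ i"
      have "fst (f (i, M)) = 0" using * by (subst rec) (simp add: Let_def)
      then show False using nz by (simp add: H_def h_def hh_def)
    qed
  qed
qed

text \<open>In a lower triangular Jordan matrix the entry below the diagonal puts the preceding variable into an
equation, so the preceding variable must be heavier; this is achieved by weights that decrease along the
index order. All weights lie between \<open>n + 1\<close> and \<open>2 * n\<close>, so that any product of two variables is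
heavier than any single variable.\<close>

definition jwt :: "'n :: {finite, linorder} \<Rightarrow> nat" where
  "jwt i = 2 * CARD('n) - card {k. k < i}"

lemma jwt_bounds: "CARD('n) + 1 \<le> jwt i" "jwt i \<le> 2 * CARD('n)"
  for i :: "'n :: {finite, linorder}"
proof -
  have "card {k. k < i} < CARD('n)"
    by (rule psubset_card_mono) (auto intro: less_irrefl)
  then show "CARD('n) + 1 \<le> jwt i" "jwt i \<le> 2 * CARD('n)" by (auto simp: jwt_def)
qed

lemma jwt_covers:
  fixes i j :: "'n :: {finite, linorder}"
  assumes "covers i j"
  shows "jwt j = jwt i + 1"
proof -
  have "{k. k < i} = insert j {k. k < j}"
    using assms by (auto simp: covers_def not_less) (metis leD le_neq_trans)
  then have "card {k. k < i} = card {k. k < j} + 1" by simp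
  moreover have "card {k. k < i} < CARD('n)"
    by (rule psubset_card_mono) (auto intro: less_irrefl)
  ultimately show ?thesis by (simp add: jwt_def)
qed

lemma wt_jwt_ge: "(CARD('n) + 1) * mdeg M \<le> wt jwt M"
  for M :: "nat ^ 'n :: {finite, linorder}"
  unfolding wt_def mdeg_def sum_distrib_left
  by (intro sum_mono mult_right_mono jwt_bounds) simp

lemma order_ge_2_imp_wge_jwt:
  fixes f :: "('a :: comm_ring_1, 'n :: {finite, linorder}) mfps" and i :: 'n
  assumes "order_ge 2 f"
  shows "wge jwt (jwt i + 1) f"
  unfolding wge_def
proof safe
  fix M :: "(nat, 'n) vec" assume M: "wt jwt M < jwt i + 1"
  have "mdeg M < 2"
  proof (rule ccontr)
    assume "\<not> mdeg M < 2"
    then have "(CARD('n) + 1) * 2 \<le> (CARD('n) + 1) * mdeg M" by (intro mult_left_mono) auto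
    also have "\<dots> \<le> wt jwt M" by (rule wt_jwt_ge)
    finally show False using M jwt_bounds(2)[of i] by simp
  qed
  then show "mcoeff f M = 0" using assms by (simp add: order_ge_def)
qed

lemma mcoeff_linear_vf_axis: "mcoeff (linear_vf A $ i) (axis l 1) = A $ i $ l"
  by (simp add: linear_vf_def mcoeff_sum mcoeff_mvar axis_eq_axis if_distrib cong: if_cong)

text \<open>In the weights \<open>jwt\<close> the nilpotent part of the linear terms behaves like a nonlinear perturbation of
the diagonal part.\<close>

lemma wge_jordan:
  fixes lam :: "'n :: {finite, linorder} cvec"
  assumes A: "lower_jordan lam A" and X: "order_ge 2 (G $ i - linear_vf A $ i)"
  shows "wge jwt (jwt i + 1) (G $ i - dvf lam $ i)"
proof -
  have "linear_vf A $ i - dvf lam $ i = (\<Sum>j\<in>UNIV. if covers i j then mconst (A $ i $ j) * mvar j else 0)"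
  proof -
    have "linear_vf A $ i = (\<Sum>j\<in>UNIV. (if covers i j then mconst (A $ i $ j) * mvar j else 0) +
        (if j = i then dvf lam $ i else 0))"
      unfolding linear_vf_def vec_lambda_beta
    proof (rule sum.cong)
      fix j
      show "mconst (A $ i $ j) * mvar j = (if covers i j then mconst (A $ i $ j) * mvar j else 0) +
          (if j = i then dvf lam $ i else 0)"
        using A by (cases "j = i"; cases "covers i j")
          (simp_all add: lower_jordan_def dvf_def covers_def)
    qed simp
    then show ?thesis by (simp add: sum.distrib)
  qed
  moreover have "wge jwt (jwt i + 1)
      (\<Sum>j\<in>UNIV. if covers i j then mconst (A $ i $ j) * mvar j else 0 :: (complex, 'n) mfps)"
  proof (rule wge_sum)
    fix j
    have "wge jwt (jwt i + 1) (mconst (A $ i $ j) * mvar j)" if "covers i j"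
      using wge_mult_right[OF wge_mvar[of jwt j]] jwt_covers[OF that] by metis
    then show "wge jwt (jwt i + 1) (if covers i j then mconst (A $ i $ j) * mvar j else 0)" by simp
  qed
  moreover have "G $ i - dvf lam $ i = (G $ i - linear_vf A $ i) + (linear_vf A $ i - dvf lam $ i)"
    by simp
  ultimately show ?thesis using order_ge_2_imp_wge_jwt[OF X] by (metis wge_add)
qed

lemma jordan_linear_coeff:
  assumes "lower_jordan lam A" "lam $ i \<noteq> lam $ l"
  shows "A $ i $ l = 0"
  using assms by (cases "i = l"; cases "covers i l") (auto simp: lower_jordan_def)

text \<open>In \<open>G + Dh G = F \<circ> H\<close> the term \<open>Dh G\<close> has order two, because \<open>G\<close> has no constant terms, and \<open>F \<circ> H\<close> has
the linear part of \<open>F\<close>.\<close>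

lemma normal_form_linear_part:
  assumes H: "transformation H" and HG: "transforms H F G"
    and F: "F = linear_vf A + X" and X: "\<forall>i. order_ge 2 (X $ i)"
  shows "order_ge 2 (G $ i - linear_vf A $ i)"
proof -
  note H1 = order_ge_1_transformation[OF H]
  define h where "h = H - (\<chi> j. mvar j)"
  have h2: "order_ge 2 (h $ j)" for j using H1(2) by (simp add: h_def)
  have lin1: "order_ge 1 (linear_vf A $ j)" for j
    unfolding order_ge_eq_wge linear_vf_def vec_lambda_beta
    by (intro wge_sum wge_mult_right) (rule wge_mvar)
  have X1: "order_ge 2 (msubst (X $ j) H)" for j
    unfolding order_ge_eq_wge using H1(1) X
    by (intro wge_msubst) (auto simp: order_ge_eq_wge)
  have main: "G $ j - linear_vf A $ j = msubst (X $ j) H + (\<Sum>l\<in>UNIV. mconst (A $ j $ l) * h $ l) - der G (h $ j)"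
    for j
  proof -
    have "der G (H $ j) = G $ j + der G (h $ j)"
      by (simp add: h_def der_diff der_mvar)
    moreover have "der G (H $ j) = msubst (F $ j) H" using HG by (simp add: transforms_iff)
    moreover have "msubst (F $ j) H = (\<Sum>l\<in>UNIV. mconst (A $ j $ l) * H $ l) + msubst (X $ j) H"
      by (simp add: F msubst_add linear_vf_def msubst_sum msubst_mult[OF H1(1)] msubst_mvar[OF H1(1)])
    moreover have "(\<Sum>l\<in>UNIV. mconst (A $ j $ l) * H $ l) =
        linear_vf A $ j + (\<Sum>l\<in>UNIV. mconst (A $ j $ l) * h $ l)"
      by (simp add: h_def linear_vf_def algebra_simps sum_subtractf)
    ultimately show ?thesis by (simp add: algebra_simps)
  qed
  have Ah: "order_ge 2 (\<Sum>l\<in>UNIV. mconst (A $ j $ l) * h $ l)" for j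
    unfolding order_ge_eq_wge by (intro wge_sum wge_mult_right) (use h2 in \<open>simp add: order_ge_eq_wge\<close>)
  have dG1: "order_ge 1 (der G (h $ j))" for j
  proof -
    have "order_ge (0 + 1) (mpartial l (h $ j))" for l
      using wge_mpartial[of "\<lambda>_. 1" 2 "h $ j" l] h2[of j]
      by (simp add: order_ge_eq_wge numeral_2_eq_2 One_nat_def)
    then show ?thesis unfolding order_ge_eq_wge der_def
      by (intro wge_sum wge_mult_right) simp
  qed
  have G1: "order_ge 1 (G $ j)" for j
  proof -
    have "order_ge 1 (linear_vf A $ j + (G $ j - linear_vf A $ j))"
      unfolding order_ge_eq_wge main
      using lin1[of j] X1[of j] Ah[of j] dG1[of j]
      by (intro wge_add wge_diff) (auto simp: order_ge_eq_wge intro: wge_mono)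
    then show ?thesis by simp
  qed
  have "order_ge (2 + 0) (der G (h $ i))"
    unfolding order_ge_eq_wge using G1 h2 by (intro wge_der) (auto simp: order_ge_eq_wge)
  then show ?thesis
    unfolding main order_ge_eq_wge using X1[of i] Ah[of i]
    by (intro wge_add wge_diff) (auto simp: order_ge_eq_wge)
qed

section \<open>Linear algebra of first integrals\<close>

lemma linearly_dependent_family:
  fixes v :: "nat \<Rightarrow> 'a :: field ^ 'n"
  assumes "CARD('n) < k"
  shows "\<exists>c. (\<exists>j<k. c j \<noteq> 0) \<and> (\<Sum>j<k. c j *s v j) = 0"
proof (cases "inj_on v {..<k}")
  case True
  have "vec.dependent (v ` {..<k})"
  proof (rule ccontr)
    assume "\<not> vec.dependent (v ` {..<k})"
    then have "card (v ` {..<k}) \<le> vec.dim (UNIV :: ('a ^ 'n) set)"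
      by (intro vec.independent_card_le_dim) auto
    then show False using assms True by (simp add: card_image card_cart_basis)
  qed
  then obtain u where u: "\<exists>x\<in>v ` {..<k}. u x \<noteq> 0" "(\<Sum>x\<in>v ` {..<k}. u x *s x) = 0"
    using vec.dependent_finite[of "v ` {..<k}"] by auto
  then have "(\<Sum>j<k. u (v j) *s v j) = 0" by (simp add: sum.reindex[OF True])
  with u(1) show ?thesis by (intro exI[of _ "\<lambda>j. u (v j)"]) auto
next
  case False
  then obtain i j where ij: "i < k" "j < k" "i \<noteq> j" "v i = v j" by (auto simp: inj_on_def)
  define c where "c = (\<lambda>l. if l = i then 1 else if l = j then -1 else 0 :: 'a)"
  have "(\<Sum>l<k. c l *s v l) = (\<Sum>l\<in>{i, j}. c l *s v l)"
    using ij by (intro sum.mono_neutral_right) (auto simp: c_def)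
  also have "\<dots> = 0" using ij by (simp add: c_def)
  finally show ?thesis using ij by (intro exI[of _ c]) (auto simp: c_def)
qed

text \<open>A linear map that sends the \<open>w j\<close> to distinct standard basis vectors exists by linear independence; the
\<open>u k\<close> are rows of its matrix.\<close>

lemma dual_family:
  fixes w :: "nat \<Rightarrow> 'a :: field ^ 'n"
  assumes "vec.dim (w ` {..<m}) = m"
  shows "\<exists>u :: nat \<Rightarrow> 'a ^ 'n. \<forall>j<m. \<forall>k<m. (\<Sum>i\<in>UNIV. u k $ i * w j $ i) = (if j = k then 1 else 0)"
proof -
  have "card (w ` {..<m}) \<le> m" using card_image_le[of "{..<m}" w] by simp
  moreover have "m \<le> card (w ` {..<m})" using vec.dim_le_card'[of "w ` {..<m}"] assms by simp
  ultimately have card: "card (w ` {..<m}) = m" by simp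
  then have inj: "inj_on w {..<m}" by (simp add: eq_card_imp_inj_on)
  have "\<not> vec.dependent (w ` {..<m})"
    using vec.card_eq_dim[of "w ` {..<m}" "w ` {..<m}"] card assms
      vec.span_superset[of "w ` {..<m}"] by simp
  have "m \<le> CARD('n)"
    using vec.dim_subset[of "w ` {..<m}" UNIV] assms by (simp add: card_cart_basis)
  then obtain \<iota> :: "nat \<Rightarrow> 'n" where \<iota>: "inj_on \<iota> {..<m}"
    using card_le_inj[of "{..<m}" "UNIV :: 'n set"] by auto
  obtain g where g: "Vector_Spaces.linear (*s) (*s) g"
    "\<And>x. x \<in> w ` {..<m} \<Longrightarrow> g x = axis (\<iota> (the_inv_into {..<m} w x)) (1 :: 'a)"
    using vec.linear_independent_extend[OF \<open>\<not> vec.dependent (w ` {..<m})\<close>,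
        of "\<lambda>x. axis (\<iota> (the_inv_into {..<m} w x)) (1 :: 'a)"] by blast
  have "(\<Sum>i\<in>UNIV. matrix g $ \<iota> k $ i * w j $ i) = (if j = k then 1 else 0)" if "j < m" "k < m" for j k
  proof -
    have "(\<Sum>i\<in>UNIV. matrix g $ \<iota> k $ i * w j $ i) = (matrix g *v w j) $ \<iota> k"
      by (simp add: matrix_vector_mult_def)
    also have "matrix g *v w j = axis (\<iota> j) 1"
      using that g(2)[of "w j"] by (simp add: matrix_works[OF g(1)] the_inv_into_f_f[OF inj])
    also have "axis (\<iota> j) 1 $ \<iota> k = (if j = k then 1 else 0 :: 'a)"
      using that \<iota> by (auto simp: axis_def inj_on_def)
    finally show ?thesis .
  qed
  then show ?thesis by (intro exI[of _ "\<lambda>k. matrix g $ \<iota> k"]) auto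
qed

lemma common_denominator:
  fixes x :: "'i \<Rightarrow> 'a :: idom fract"
  assumes "finite I"
  shows "\<exists>d y. d \<noteq> 0 \<and> (\<forall>i\<in>I. to_fract d * x i = to_fract (y i))"
  using assms
proof (induction I rule: finite_induct)
  case empty
  then show ?case by (intro exI[of _ 1]) auto
next
  case (insert j I)
  then obtain d y where dy: "d \<noteq> 0" "\<And>i. i \<in> I \<Longrightarrow> to_fract d * x i = to_fract (y i)" by auto
  obtain p q where pq: "x j = Fract p q" "q \<noteq> 0" by (cases "x j")
  have "to_fract (d * q) * x i = to_fract (if i = j then d * p else q * y i)" if "i \<in> insert j I" for i
  proof (cases "i = j")
    case True
    then show ?thesis using pq by (simp add: Fract_conv_to_fract)
  next
    case False
    then have "to_fract (d * q) * x i = to_fract q * (to_fract d * x i)" by simp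
    also have "\<dots> = to_fract (q * y i)" using False that dy(2)[of i] by auto
    finally show ?thesis using False by simp
  qed
  then show ?case using dy(1) pq(2)
    by (intro exI[of _ "d * q"] exI[of _ "\<lambda>i. if i = j then d * p else q * y i"]) auto
qed

lemma gradient_Fract:
  assumes "b \<noteq> 0"
  shows "gradient (Fract a b) $ i * to_fract (b * b) = to_fract (mpartial i a * b - a * mpartial i b)"
proof -
  have "gradient (Fract a b) $ i =
      to_fract (mpartial i a * b - a * mpartial i b) / to_fract (b * b)"
    unfolding gradient_def vec_lambda_beta fpartial_Fract[OF assms] by (rule Fract_conv_to_fract)
  moreover have "to_fract (b * b) \<noteq> 0" using assms by (simp only: to_fract_eq_0_iff) simp
  ultimately show ?thesis by (simp only: nonzero_divide_eq_eq[symmetric] times_divide_eq_left) simp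
qed

text \<open>Independence expressed by equations over the ring of power series alone, with the gradient of \<open>a / b\<close>
replaced by its numerator. In this form it survives the substitution of a transformation.\<close>

lemma independent_functions_dual:
  fixes \<psi> :: "nat \<Rightarrow> 'n :: finite fmero"
  assumes ind: "independent_functions m \<psi>"
    and ab: "\<And>j. j < m \<Longrightarrow> \<psi> j = Fract (a j) (b j)" "\<And>j. j < m \<Longrightarrow> b j \<noteq> 0"
  shows "\<exists>U :: nat \<Rightarrow> 'n fvec. \<forall>j<m. \<forall>k<m.
    (\<Sum>i\<in>UNIV. U k $ i * (mpartial i (a j) * b j - a j * mpartial i (b j))) = 0 \<longleftrightarrow> j \<noteq> k"
proof -
  obtain u :: "nat \<Rightarrow> 'n fmero ^ 'n" where u: "\<And>j k. j < m \<Longrightarrow> k < m \<Longrightarrow>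
      (\<Sum>i\<in>UNIV. u k $ i * gradient (\<psi> j) $ i) = (if j = k then 1 else 0)"
    using dual_family[of "\<lambda>j. gradient (\<psi> j)" m] ind by (auto simp: independent_functions_def)
  have "\<exists>d y. d \<noteq> 0 \<and> (\<forall>i. to_fract d * u k $ i = to_fract (y i))" for k
    using common_denominator[of UNIV "\<lambda>i. u k $ i"] by auto
  then obtain d y where dy: "\<And>k. d k \<noteq> 0" "\<And>k i. to_fract (d k) * u k $ i = to_fract (y k i)"
    by metis
  define w where "w j i = mpartial i (a j) * b j - a j * mpartial i (b j)" for j i
  have grad: "gradient (\<psi> j) $ i * to_fract (b j * b j) = to_fract (w j i)" if "j < m" for i j
    using gradient_Fract[OF ab(2)[OF that]] by (simp only: ab(1)[OF that] w_def)
  have "(\<Sum>i\<in>UNIV. y k i * w j i) = 0 \<longleftrightarrow> j \<noteq> k" if jk: "j < m" "k < m" for j k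
  proof -
    have "to_fract (\<Sum>i\<in>UNIV. y k i * w j i) =
        (\<Sum>i\<in>UNIV. (to_fract (d k) * u k $ i) * (gradient (\<psi> j) $ i * to_fract (b j * b j)))"
      unfolding to_fract_sum dy(2) grad[OF jk(1)] by (simp only: to_fract_mult)
    also have "\<dots> = to_fract (d k * (b j * b j)) * (\<Sum>i\<in>UNIV. u k $ i * gradient (\<psi> j) $ i)"
      unfolding sum_distrib_left by (rule sum.cong) simp_all
    also have "\<dots> = (if j = k then to_fract (d k * (b j * b j)) else 0)"
      by (simp only: u[OF jk] if_distrib[of "(*) _"] mult_1_right mult_zero_right cong: if_cong)
    finally have "to_fract (\<Sum>i\<in>UNIV. y k i * w j i) = (if j = k then to_fract (d k * (b j * b j)) else 0)" .
    then have "to_fract (\<Sum>i\<in>UNIV. y k i * w j i) = 0 \<longleftrightarrow> j \<noteq> k"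
      using dy(1)[of k] ab(2)[OF jk(1)] by (auto simp: to_fract_eq_0_iff simp del: to_fract_mult)
    then show ?thesis by (simp only: to_fract_eq_0_iff)
  qed
  then show ?thesis
    unfolding w_def[symmetric] by (intro exI[of _ "\<lambda>k. \<chi> i. y k i"]) simp
qed

text \<open>The Jacobian matrix of a transformation is the identity up to terms of positive order, so a vector in its
kernel has arbitrarily high order.\<close>

lemma der_transformation_eq_0:
  fixes H V :: "('a :: idom, 'n :: finite) mfps ^ 'n"
  assumes H: "\<And>l. order_ge 2 (H $ l - mvar l)"
    and V: "\<And>l. der V (H $ l) = 0"
  shows "V = 0"
proof -
  have eq: "V $ l = - der V (H $ l - mvar l)" for l
    by (simp add: der_diff der_mvar V)
  have *: "wge (\<lambda>_. 1) k (V $ l)" for k l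
  proof (induction k arbitrary: l)
    case (Suc k)
    have "wge (\<lambda>_. 1) (k + (2 - 1)) (V $ j * mpartial j (H $ l - mvar l))" for j
      using wge_mult[OF Suc wge_mpartial[of "\<lambda>_. 1" 2]] H by (simp add: order_ge_eq_wge)
    then show ?case by (subst eq) (auto simp: der_def intro!: wge_uminus wge_sum)
  qed simp
  have "mcoeff (V $ l) M = 0" for l M
    using *[of "wt (\<lambda>_. 1) M + 1" l] by (simp add: wge_def)
  then show ?thesis by (simp add: vec_eq_iff mfps_eq_iff)
qed

text \<open>Dimension count in the fraction field. The vectors \<open>U k \<circ> H\<close> together with the images \<open>DH V s\<close> are more than
\<open>n\<close> many, hence dependent. Pairing a dependency with \<open>w k \<circ> H\<close> shows that \<open>U k \<circ> H\<close> does not occur in it,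
and then \<open>DH\<close> can be cancelled. As the \<open>w j\<close> stay in the old coordinates, no Jacobian matrix has to be
inverted.\<close>

lemma annihilator_dependent:
  fixes H :: "'n :: finite fvec" and w U V :: "nat \<Rightarrow> 'n fvec"
  assumes H: "transformation H"
    and m: "CARD('n) < m + r"
    and dual: "\<And>j k. j < m \<Longrightarrow> k < m \<Longrightarrow> (\<Sum>i\<in>UNIV. U k $ i * w j $ i) = 0 \<longleftrightarrow> j \<noteq> k"
    and ann: "\<And>j s. j < m \<Longrightarrow> s < r \<Longrightarrow> (\<Sum>l\<in>UNIV. msubst (w j $ l) H * der (V s) (H $ l)) = 0"
  shows "\<exists>a. (\<exists>s<r. a s \<noteq> 0) \<and> (\<forall>i. (\<Sum>s<r. a s * V s $ i) = 0)"
proof -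
  note H1 = order_ge_1_transformation[OF H]
  define v :: "nat \<Rightarrow> 'n fmero ^ 'n" where
    "v t = (if t < m then \<chi> l. to_fract (msubst (U t $ l) H)
            else \<chi> l. to_fract (der (V (t - m)) (H $ l)))" for t
  obtain c where c: "\<exists>t<m + r. c t \<noteq> 0" "(\<Sum>t<m + r. c t *s v t) = 0"
    using linearly_dependent_family[OF m, of v] by blast
  have c_eq: "(\<Sum>t<m + r. c t * v t $ l) = 0" for l
    using arg_cong[OF c(2), of "\<lambda>x. x $ l"] by simp
  \<comment> \<open>Pairing the dependency with \<open>w k \<circ> H\<close> isolates its coefficient \<open>c k\<close>.\<close>
  have pairing: "(\<Sum>l\<in>UNIV. v t $ l * to_fract (msubst (w k $ l) H)) =
      (if t = k then to_fract (msubst (\<Sum>l\<in>UNIV. U k $ l * w k $ l) H) else 0)"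
    if t: "t < m + r" and k: "k < m" for t k
  proof (cases "t < m")
    case True
    have "(\<Sum>l\<in>UNIV. v t $ l * to_fract (msubst (w k $ l) H)) =
        to_fract (msubst (\<Sum>l\<in>UNIV. U t $ l * w k $ l) H)"
      using True by (simp add: v_def to_fract_sum msubst_sum msubst_mult[OF H1(1)])
    then show ?thesis using dual[OF k True] by auto
  next
    case False
    then have "(\<Sum>l\<in>UNIV. v t $ l * to_fract (msubst (w k $ l) H)) =
        to_fract (\<Sum>l\<in>UNIV. msubst (w k $ l) H * der (V (t - m)) (H $ l))"
      by (simp add: v_def to_fract_sum mult.commute)
    then show ?thesis using ann[OF k, of "t - m"] False t k by auto
  qed
  have c0: "c k = 0" if k: "k < m" for k
  proof -
    have "0 = (\<Sum>l\<in>UNIV. (\<Sum>t<m + r. c t * v t $ l) * to_fract (msubst (w k $ l) H))"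
      by (simp add: c_eq)
    also have "\<dots> = (\<Sum>t<m + r. c t * (\<Sum>l\<in>UNIV. v t $ l * to_fract (msubst (w k $ l) H)))"
      unfolding sum_distrib_left sum_distrib_right by (subst sum.swap) (simp add: mult.assoc)
    also have "\<dots> = (\<Sum>t<m + r. if t = k then c t * to_fract (msubst (\<Sum>l\<in>UNIV. U k $ l * w k $ l) H) else 0)"
      using k by (intro sum.cong) (auto simp: pairing)
    also have "\<dots> = c k * to_fract (msubst (\<Sum>l\<in>UNIV. U k $ l * w k $ l) H)"
      using k by simp
    finally show ?thesis
      using dual[OF k k] by (auto simp: to_fract_eq_0_iff msubst_eq_0_iff[OF H])
  qed
  obtain d y where dy: "d \<noteq> 0" "\<And>s. s < r \<Longrightarrow> to_fract d * c (m + s) = to_fract (y s)"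
    using common_denominator[of "{..<r}" "\<lambda>s. c (m + s)"] by auto
  have rel: "(\<Sum>s<r. y s * der (V s) (H $ l)) = 0" for l
  proof -
    have "0 = (\<Sum>t<m + r. c t * v t $ l)" by (simp add: c_eq)
    also have "\<dots> = (\<Sum>t\<in>{m..<m + r}. c t * v t $ l)"
      using c0 by (intro sum.mono_neutral_right) auto
    also have "\<dots> = (\<Sum>s<r. c (m + s) * v (m + s) $ l)"
      by (rule sum.reindex_bij_witness[of _ "\<lambda>s. m + s" "\<lambda>t. t - m"]) auto
    finally have "to_fract d * (\<Sum>s<r. c (m + s) * v (m + s) $ l) = 0" by simp
    moreover have "to_fract d * (\<Sum>s<r. c (m + s) * v (m + s) $ l) =
        (\<Sum>s<r. (to_fract d * c (m + s)) * to_fract (der (V s) (H $ l)))"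
      by (simp add: sum_distrib_left v_def mult.assoc)
    moreover have "\<dots> = to_fract (\<Sum>s<r. y s * der (V s) (H $ l))"
      by (simp add: to_fract_sum dy(2))
    ultimately show ?thesis by (simp only: to_fract_eq_0_iff)
  qed
  have "der (\<chi> i. \<Sum>s<r. y s * V s $ i) (H $ l) = 0" for l
  proof -
    have "der (\<chi> i. \<Sum>s<r. y s * V s $ i) (H $ l) = (\<Sum>s<r. y s * der (V s) (H $ l))"
      unfolding der_def sum_distrib_left vec_lambda_beta sum_distrib_right
      by (subst sum.swap) (simp add: mult.assoc)
    then show ?thesis by (simp add: rel)
  qed
  then have "(\<chi> i. \<Sum>s<r. y s * V s $ i) = 0"
    by (intro der_transformation_eq_0[OF H1(2)])
  then have "\<forall>i. (\<Sum>s<r. y s * V s $ i) = 0" by (simp add: vec_eq_iff)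
  moreover have "\<exists>s<r. y s \<noteq> 0"
  proof -
    obtain t where t: "t < m + r" "c t \<noteq> 0" using c(1) by blast
    then have "m \<le> t" using c0[of t] by force
    with t have "t - m < r" by linarith
    moreover from this have "to_fract (y (t - m)) \<noteq> 0"
      using dy(2)[of "t - m"] t dy(1) \<open>m \<le> t\<close> by (auto simp: to_fract_eq_0_iff)
    ultimately show ?thesis by (intro exI[of _ "t - m"]) (auto simp: to_fract_eq_0_iff)
  qed
  ultimately show ?thesis by blast
qed

text \<open>The quotient rule, with denominators cleared.\<close>

lemma first_integral_Fract:
  assumes "b \<noteq> 0"
  shows "first_integral F (Fract a b) \<longleftrightarrow> der F a * b = a * der F b"
proof -
  have "to_fract (b * b) * (\<Sum>i\<in>UNIV. gradient (Fract a b) $ i * Fract (F $ i) 1) =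
      to_fract (\<Sum>i\<in>UNIV. (mpartial i a * b - a * mpartial i b) * F $ i)"
    unfolding sum_distrib_left to_fract_sum
  proof (rule sum.cong)
    fix i
    have "to_fract (b * b) * (gradient (Fract a b) $ i * Fract (F $ i) 1) =
        (gradient (Fract a b) $ i * to_fract (b * b)) * to_fract (F $ i)"
      by (simp only: to_fract_def mult_ac)
    also have "\<dots> = to_fract ((mpartial i a * b - a * mpartial i b) * F $ i)"
      unfolding gradient_Fract[OF assms] by (rule to_fract_mult[symmetric])
    finally show "to_fract (b * b) * (gradient (Fract a b) $ i * Fract (F $ i) 1) =
        to_fract ((mpartial i a * b - a * mpartial i b) * F $ i)" .
  qed simp
  also have "(\<Sum>i\<in>UNIV. (mpartial i a * b - a * mpartial i b) * F $ i) = der F a * b - a * der F b"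
    by (simp add: der_def sum_distrib_left sum_distrib_right algebra_simps sum_subtractf)
  finally have "first_integral F (Fract a b) \<longleftrightarrow> to_fract (der F a * b - a * der F b) = 0"
    using assms unfolding first_integral_def by (auto simp: to_fract_eq_0_iff)
  then show ?thesis unfolding to_fract_eq_0_iff by simp
qed

lemma der_msubst:
  assumes "transformation H"
  shows "der V (msubst f H) = (\<Sum>l\<in>UNIV. msubst (mpartial l f) H * der V (H $ l))"
  unfolding der_def mpartial_msubst[OF order_ge_1_transformation(1)[OF assms]] sum_distrib_left
  by (subst sum.swap) (simp add: mult_ac)

lemma der_msubst_transforms:
  assumes H: "transformation H" and HG: "transforms H F G"
  shows "der G (msubst f H) = msubst (der F f) H"
  using HG unfolding der_msubst[OF H]
  by (simp add: transforms_iff der_def msubst_sum mult.commute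
      msubst_mult[OF order_ge_1_transformation(1)[OF H]])

section \<open>Weight components of first integrals\<close>

definition wpart :: "'a :: comm_ring_1 ^ 'n :: finite \<Rightarrow> 'a \<Rightarrow> ('a, 'n) mfps \<Rightarrow> ('a, 'n) mfps" where
  "wpart v w f = Abs_mfps (\<lambda>M. if wgt v M = w then mcoeff f M else 0)"

lemma mcoeff_wpart [simp]: "mcoeff (wpart v w f) M = (if wgt v M = w then mcoeff f M else 0)"
  by (simp add: wpart_def)

text \<open>Meant for \<open>T w = L - w\<close> with one linear operator \<open>L\<close>. If finitely many vectors of distinct generalized
eigenspaces add up to an element of a subgroup that is stable under \<open>L\<close>, then each of them belongs to the
subgroup. It suffices that powers of \<open>T w\<close> send them into the subgroup (rather than to 0), which is how the
result is applied modulo terms of high order.\<close>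

locale shifted_operator_stable =
  fixes U :: "'v :: ab_group_add set" and T :: "complex \<Rightarrow> 'v \<Rightarrow> 'v" and sc :: "complex \<Rightarrow> 'v \<Rightarrow> 'v"
  assumes U_diff: "x \<in> U \<Longrightarrow> y \<in> U \<Longrightarrow> x - y \<in> U"
    and U_T: "x \<in> U \<Longrightarrow> T w x \<in> U"
    and U_sc: "r \<noteq> 0 \<Longrightarrow> sc r x \<in> U \<Longrightarrow> x \<in> U"
    and T_T: "T w x - T w' x = sc (w' - w) x"
    and T_diff: "T w (x - y) = T w x - T w y"
    and T_comm: "T w (T w' x) = T w' (T w x)"
begin

lemma U_add: "x \<in> U \<Longrightarrow> y \<in> U \<Longrightarrow> x + y \<in> U"
  using U_diff[of x "y - y - y"] U_diff[of "y - y" y] U_diff[of y y] by (simp add: algebra_simps)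

lemma U_sum: "0 \<in> U \<Longrightarrow> (\<And>x. x \<in> A \<Longrightarrow> f x \<in> U) \<Longrightarrow> sum f A \<in> U"
  by (induction A rule: infinite_finite_induct) (auto intro: U_add)

lemma T_0: "T w 0 = 0"
  using T_diff[of w 0 0] by simp

lemma T_add: "T w (x + y) = T w x + T w y"
  using T_diff[of w x "0 - y"] T_diff[of w 0 y] by (simp add: T_0)

lemma Tn_add: "(T w ^^ n) (x + y) = (T w ^^ n) x + (T w ^^ n) y"
  by (induction n) (simp_all add: T_add)

lemma Tn_0: "(T w ^^ n) 0 = 0"
  by (induction n) (simp_all add: T_0)

lemma Tn_sum: "(T w ^^ n) (sum f A) = (\<Sum>x\<in>A. (T w ^^ n) (f x))"
  by (induction A rule: infinite_finite_induct) (simp_all add: Tn_0 Tn_add)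

lemma T_Tn_comm: "T w ((T w' ^^ n) x) = (T w' ^^ n) (T w x)"
  by (induction n) (simp_all add: T_comm[of w])

lemma Tn_comm: "(T w ^^ m) ((T w' ^^ n) x) = (T w' ^^ n) ((T w ^^ m) x)"
  by (induction m) (simp_all add: T_Tn_comm)

lemma U_Tn: "x \<in> U \<Longrightarrow> (T w ^^ n) x \<in> U"
  by (induction n) (auto intro: U_T)

text \<open>Coprimality of \<open>(L - w)^m\<close> and \<open>(L - w')^n\<close>, by induction on \<open>m + n\<close>: both \<open>T w x\<close> and \<open>T w' x\<close> satisfy the
assumptions with a smaller exponent, and their difference is a nonzero multiple of \<open>x\<close>.\<close>

lemma coprime_shifts:
  assumes "w \<noteq> w'" "(T w ^^ m) x \<in> U" "(T w' ^^ n) x \<in> U"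
  shows "x \<in> U"
  using assms(2,3)
proof (induction "m + n" arbitrary: m n x)
  case 0
  then show ?case by simp
next
  case (Suc k)
  show ?case
  proof (cases "m = 0 \<or> n = 0")
    case True
    then show ?thesis using Suc.prems by auto
  next
    case False
    then obtain m' n' where mn: "m = Suc m'" "n = Suc n'" by (auto simp: gr0_conv_Suc)
    have k: "k = m' + n" "k = m + n'" using Suc.hyps(2) mn by simp_all
    have a: "(T w ^^ m') (T w x) \<in> U" using Suc.prems(1) by (simp add: mn(1) funpow_swap1)
    have b: "(T w' ^^ n) (T w x) \<in> U"
      unfolding T_Tn_comm[symmetric] by (rule U_T[OF Suc.prems(2)])
    have c: "(T w ^^ m) (T w' x) \<in> U"
      unfolding T_Tn_comm[symmetric] by (rule U_T[OF Suc.prems(1)])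
    have d: "(T w' ^^ n') (T w' x) \<in> U" using Suc.prems(2) by (simp add: mn(2) funpow_swap1)
    note 1 = Suc.hyps(1)[OF k(1) a b] and 2 = Suc.hyps(1)[OF k(2) c d]
    have "T w x - T w' x \<in> U" by (rule U_diff[OF 1 2])
    then show ?thesis using assms(1) U_sc[of "w' - w" x] by (simp add: T_T)
  qed
qed

text \<open>A power of \<open>T w0\<close> removes the component for \<open>w0\<close>; the induction hypothesis applies to the images of the
others, and \<open>coprime_shifts\<close> recovers these components themselves.\<close>

lemma components_in_stable_subgroup:
  assumes "finite S" "(\<Sum>w\<in>S. v w) \<in> U" "\<And>w. w \<in> S \<Longrightarrow> (T w ^^ n) (v w) \<in> U" "w \<in> S"
  shows "v w \<in> U"
  using assms
proof (induction S arbitrary: v w rule: finite_induct)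
  case (insert w0 S)
  let ?v = "\<lambda>w. (T w0 ^^ n) (v w)"
  have "?v w0 + (\<Sum>w\<in>S. ?v w) \<in> U"
    using U_Tn[OF insert.prems(1), where w = w0 and n = n] insert.hyps by (simp add: Tn_sum Tn_add)
  then have "(\<Sum>w\<in>S. ?v w) \<in> U"
    using U_diff[OF _ insert.prems(2)[of w0], of "?v w0 + (\<Sum>w\<in>S. ?v w)"] by simp
  moreover have "(T w ^^ n) (?v w) \<in> U" if "w \<in> S" for w
    using U_Tn[OF insert.prems(2)[of w], where w = w0 and n = n] that by (simp add: Tn_comm)
  ultimately have *: "?v w \<in> U" if "w \<in> S" for w
    using insert.IH[of ?v w] that by blast
  have S: "v w \<in> U" if "w \<in> S" for w
    using coprime_shifts[of w w0 n "v w" n] * insert.prems(2)[of w] that insert.hyps by auto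
  have "0 \<in> U" using U_diff[OF insert.prems(1) insert.prems(1)] by simp
  then have "(\<Sum>w\<in>S. v w) \<in> U"
    by (intro U_sum) (auto simp: S)
  then have "v w0 \<in> U" using U_diff[OF insert.prems(1), of "\<Sum>w\<in>S. v w"] insert.hyps by simp
  with S insert.prems(3) show ?case by auto
qed simp

end

lemma mcoeff_mult_nonzero:
  assumes "mcoeff (f * g) M \<noteq> 0"
  obtains a b where "a + b = M" "mcoeff f a \<noteq> 0" "mcoeff g b \<noteq> 0"
proof -
  have "\<exists>p\<in>splits M. mcoeff f (fst p) * mcoeff g (snd p) \<noteq> 0"
    using assms unfolding mcoeff_mult case_prod_unfold by (meson sum.neutral)
  then obtain a b where "(a, b) \<in> splits M" "mcoeff f a * mcoeff g b \<noteq> 0" by auto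
  then show thesis using that[of a b]
    by (metis (mono_tags, lifting) case_prodD mem_Collect_eq mult_zero_left mult_zero_right splits_def)
qed

lemma mcoeff_sum_nonzero:
  assumes "mcoeff (sum f A) M \<noteq> 0"
  obtains x where "x \<in> A" "mcoeff (f x) M \<noteq> 0"
  using assms unfolding mcoeff_sum by (meson sum.neutral)

lemma wgt_der_normal_form:
  assumes N: "\<And>j M. mcoeff (N $ j) M \<noteq> 0 \<Longrightarrow> wgt lam M = lam $ j"
    and f: "\<And>M. mcoeff f M \<noteq> 0 \<Longrightarrow> wgt lam M = w"
    and nz: "mcoeff (der N f) M \<noteq> 0"
  shows "wgt lam M = w"
proof -
  obtain j where "mcoeff (N $ j * mpartial j f) M \<noteq> 0"
    using mcoeff_sum_nonzero[OF nz[unfolded der_def]] by blast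
  then obtain a b where ab: "a + b = M" "mcoeff (N $ j) a \<noteq> 0" "mcoeff (mpartial j f) b \<noteq> 0"
    by (rule mcoeff_mult_nonzero)
  then have "mcoeff f (b + axis j 1) \<noteq> 0" by (auto simp: mcoeff_mpartial)
  then have "wgt lam (b + axis j 1) = w" by (rule f)
  then show ?thesis using ab(1) N[OF ab(2)] by (auto simp: wgt_add)
qed

text \<open>The pairs \<open>(p, q)\<close> that represent the fraction \<open>a / b\<close> form a space that is stable under the derivation \<open>G\<close>,
as \<open>a / b\<close> is a first integral. On series of weight \<open>w\<close> the operator \<open>G - w\<close> raises the weighted order, so
modulo order \<open>k\<close> the weight components of \<open>(a, b)\<close> lie in generalized eigenspaces and hence, again modulo
order \<open>k\<close>, in this space. Letting \<open>k\<close> grow removes the error.\<close>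

theorem weight_components_of_quotient:
  fixes G :: "'n :: finite fvec" and a b :: "(complex, 'n) mfps"
  assumes c: "\<And>j. c j \<ge> 1"
    and nf: "normal_form lam G"
    and G: "\<And>i. wge c (c i + 1) (G $ i - dvf lam $ i)"
    and ab: "der G a * b = a * der G b" and b0: "b \<noteq> 0"
  shows "wpart lam w a * b = a * wpart lam w b"
proof -
  define N where "N = G - dvf lam"
  have Nw: "wgt lam M = lam $ j" if "mcoeff (N $ j) M \<noteq> 0" for j M
  proof (cases "M = axis j 1")
    case False
    with that have "mcoeff (G $ j) M \<noteq> 0" by (simp add: N_def dvf_def mcoeff_mvar)
    then show ?thesis using nf by (simp add: normal_form_iff)
  qed simp
  define T where "T w = (\<lambda>(p, q). (der G p - mconst w * p, der G q - mconst w * q))" for w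
  define sc where "sc r = (\<lambda>(p :: (complex, 'n) mfps, q :: (complex, 'n) mfps). (mconst r * p, mconst r * q))" for r
  \<comment> \<open>The solutions of \<open>p * b = a * q\<close>, up to terms of weighted degree at least \<open>k\<close>.\<close>
  define U where "U k = {(p, q). \<exists>p' q'. p' * b = a * q' \<and> wge c k (p - p') \<and> wge c k (q - q')}" for k
  have UI: "(p, q) \<in> U k" if "p' * b = a * q'" "wge c k (p - p')" "wge c k (q - q')" for p' q' p q k
    using that by (auto simp: U_def)
  have Gge: "wge c (c j + 0) (G $ j)" for j
  proof -
    have "wge c (c j) ((G $ j - dvf lam $ j) + dvf lam $ j)"
      using G[of j] by (intro wge_add) (auto simp: dvf_def intro: wge_mono wge_mult_right wge_mvar)
    then show ?thesis by simp
  qed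
  have stable: "shifted_operator_stable (U k) T sc" for k
  proof
    fix x y assume "x \<in> U k" "y \<in> U k"
    then obtain p q p' q' p2 q2 p2' q2' where
      x: "x = (p, q)" "p' * b = a * q'" "wge c k (p - p')" "wge c k (q - q')" and
      y: "y = (p2, q2)" "p2' * b = a * q2'" "wge c k (p2 - p2')" "wge c k (q2 - q2')"
      by (auto simp: U_def)
    have "(p' - p2') * b = a * (q' - q2')" using x y by (simp add: algebra_simps)
    moreover have "wge c k (p - p2 - (p' - p2'))" "wge c k (q - q2 - (q' - q2'))"
      using wge_diff[OF x(3) y(3)] wge_diff[OF x(4) y(4)] by (simp_all add: algebra_simps)
    ultimately show "x - y \<in> U k" using x(1) y(1) by (auto simp: U_def)
  next
    fix x w assume "x \<in> U k"
    then obtain p q p' q' where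
      x: "x = (p, q)" "p' * b = a * q'" "wge c k (p - p')" "wge c k (q - q')"
      by (auto simp: U_def)
    show "T w x \<in> U k"
    proof -
      have "b * (der G p' * b - a * der G q') = b * (der G (p' * b - a * q')) - der G b * (p' * b - a * q')
          - q' * (a * der G b - der G a * b) * 1"
        by (simp add: der_diff der_mult algebra_simps)
      then have "der G p' * b = a * der G q'" using b0 x(2) ab by simp
      then have "(der G p' - mconst w * p') * b = a * (der G q' - mconst w * q')"
        using x(2) by (simp add: algebra_simps)
      moreover have "wge c k (der G f - mconst w * f - (der G g - mconst w * g))"
        if "wge c k (f - g)" for f g
      proof -
        have "der G f - mconst w * f - (der G g - mconst w * g) = der G (f - g) - mconst w * (f - g)"
          by (simp add: der_diff algebra_simps)
        then show ?thesis
          using wge_diff[OF wge_der[OF Gge that], of "mconst w * (f - g)"] wge_mult_right[OF that]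
          by simp
      qed
      ultimately show ?thesis
        unfolding x(1) T_def prod.case using UI x(3,4) by blast
    qed
  next
    fix x r assume r: "r \<noteq> (0 :: complex)" and "sc r x \<in> U k"
    then obtain p q p' q' where
      x: "x = (p, q)" "p' * b = a * q'" "wge c k (mconst r * p - p')" "wge c k (mconst r * q - q')"
      by (cases x) (auto simp: U_def sc_def)
    have i: "mconst (inverse r) * (mconst r * f - g) = f - mconst (inverse r) * g"
      for f g :: "(complex, 'n) mfps"
      using r by (simp add: mfps_eq_iff right_diff_distrib)
    have "(mconst (inverse r) * p') * b = a * (mconst (inverse r) * q')"
      using x(2) by (simp add: mult_ac)
    moreover have "wge c k (p - mconst (inverse r) * p')" "wge c k (q - mconst (inverse r) * q')"
      using wge_mult_right[OF x(3), of "mconst (inverse r)"] wge_mult_right[OF x(4), of "mconst (inverse r)"]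
      by (simp_all only: i)
    ultimately show "x \<in> U k" unfolding x(1) by (rule UI)
  next
    fix x y w w'
    show "T w x - T w' x = sc (w' - w) x"
      by (cases x) (simp add: T_def sc_def mconst_diff algebra_simps)
    show "T w (x - y) = T w x - T w y"
      by (cases x, cases y) (simp add: T_def der_diff algebra_simps)
    have *: "der G (der G f - mconst u * f) - mconst u' * (der G f - mconst u * f) =
        der G (der G f - mconst u' * f) - mconst u * (der G f - mconst u' * f)" for f u u'
      by (simp only: der_diff der_mconst_mult right_diff_distrib mult.left_commute[of "mconst u"])
        simp
    show "T w (T w' x) = T w' (T w x)"
      by (cases x) (simp add: T_def *[where u = w' and u' = w])
  qed
  have nilp: "wge c n (fst ((T w ^^ n) (p, q))) \<and> wge c n (snd ((T w ^^ n) (p, q))) \<and>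
     (\<forall>M. mcoeff (fst ((T w ^^ n) (p, q))) M \<noteq> 0 \<longrightarrow> wgt lam M = w) \<and>
     (\<forall>M. mcoeff (snd ((T w ^^ n) (p, q))) M \<noteq> 0 \<longrightarrow> wgt lam M = w)"
    if pq: "\<And>M. mcoeff p M \<noteq> 0 \<Longrightarrow> wgt lam M = w" "\<And>M. mcoeff q M \<noteq> 0 \<Longrightarrow> wgt lam M = w"
    for w n p q
  proof (induction n)
    case (Suc n)
    obtain f g where fg: "(T w ^^ n) (p, q) = (f, g)" by fastforce
    have step: "der G h - mconst w * h = der N h" if "\<forall>M. mcoeff h M \<noteq> 0 \<longrightarrow> wgt lam M = w" for h
    proof -
      have "der (dvf lam) h = mconst w * h"
        using that by (auto simp: mfps_eq_iff mcoeff_der_dvf)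
      then show ?thesis by (simp add: N_def der_vec_diff)
    qed
    note IH = Suc[unfolded fg fst_conv snd_conv]
    have "T w (f, g) = (der N f, der N g)"
      unfolding T_def prod.case using step IH by blast
    then have eq: "(T w ^^ Suc n) (p, q) = (der N f, der N g)"
      by (simp only: fg funpow.simps o_apply)
    have "wge c (Suc n) (der N h)" if "wge c n h" for h
      using wge_der[of c 1 N n h] G that by (simp add: N_def Suc_eq_plus1)
    moreover have "\<forall>M. mcoeff (der N h) M \<noteq> 0 \<longrightarrow> wgt lam M = w"
      if "\<forall>M. mcoeff h M \<noteq> 0 \<longrightarrow> wgt lam M = w" for h
      using wgt_der_normal_form[OF Nw, where f = h and w = w] that by blast
    ultimately show ?case unfolding eq fst_conv snd_conv using IH by blast
  qed (use pq in auto)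
  have comp: "wge c k (wpart lam w a * b - a * wpart lam w b)" for k
  proof -
    interpret shifted_operator_stable "U k" T sc by (rule stable)
    define S where "S = wgt lam ` {M. wt c M < k}"
    have "finite {M. wt c M < k}"
    proof (rule finite_subset[OF _ finite_mdeg_le[of k]], safe)
      fix M :: "nat ^ 'n" assume "wt c M < k"
      moreover have "mdeg M \<le> wt c M"
        unfolding mdeg_def wt_def
        by (rule sum_mono) (use mult_right_mono[OF c] in force)
      ultimately show "mdeg M \<le> k" by simp
    qed
    then have S: "finite S" by (simp add: S_def)
    define v where "v w = (wpart lam w a, wpart lam w b)" for w
    have inU: "(p, q) \<in> U k" if "wge c k p" "wge c k q" for p q
      using that unfolding U_def by (auto intro!: exI[of _ 0])
    have "v w \<in> U k"
    proof (cases "w \<in> S")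
      case True
      have "fst (sum v S) = (\<Sum>w\<in>S. wpart lam w a)" "snd (sum v S) = (\<Sum>w\<in>S. wpart lam w b)"
        by (simp_all add: v_def fst_sum snd_sum)
      moreover have "wge c k ((\<Sum>w\<in>S. wpart lam w f) - f)" for f
        using S by (auto simp: wge_def mcoeff_sum S_def)
      ultimately have "(fst (sum v S), snd (sum v S)) \<in> U k" by (intro UI[where p' = a and q' = b]) simp_all
      then have "sum v S \<in> U k" by simp
      moreover have "(T w ^^ k) (v w) \<in> U k" for w
      proof -
        have pure: "mcoeff (wpart lam w f) M \<noteq> 0 \<Longrightarrow> wgt lam M = w" for f M
          by (simp split: if_splits)
        obtain f g where fg: "(T w ^^ k) (wpart lam w a, wpart lam w b) = (f, g)" by fastforce
        have "wge c k f" "wge c k g"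
          using nilp[of "wpart lam w a" w "wpart lam w b" k, OF pure[where f = a] pure[where f = b], unfolded fg fst_conv snd_conv]
          by blast+
        then show ?thesis unfolding v_def fg by (rule inU)
      qed
      ultimately show ?thesis using components_in_stable_subgroup[OF S _ _ True] by blast
    next
      case False
      then have "wge c k (wpart lam w f)" for f by (auto simp: wge_def S_def)
      then show ?thesis unfolding v_def by (intro inU)
    qed
    then obtain p q where pq: "p * b = a * q" "wge c k (wpart lam w a - p)" "wge c k (wpart lam w b - q)"
      by (auto simp: U_def v_def)
    have "wpart lam w a * b - a * wpart lam w b = (wpart lam w a - p) * b - a * (wpart lam w b - q)"
      using pq(1) by (simp add: algebra_simps)
    then show ?thesis using pq(2,3) by (metis wge_diff wge_mult_left wge_mult_right)
  qed
  have "mcoeff (wpart lam w a * b - a * wpart lam w b) M = 0" for M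
    using comp[of "wt c M + 1"] by (simp add: wge_def)
  then show ?thesis by (simp add: mfps_eq_iff)
qed

section \<open>Vector fields that annihilate all first integrals\<close>

text \<open>\<open>V\<close> annihilates every first integral \<open>a / b\<close> of \<open>G\<close>.\<close>

definition kills_integrals :: "'n :: finite fvec \<Rightarrow> 'n fvec \<Rightarrow> bool" where
  "kills_integrals G V \<longleftrightarrow>
     (\<forall>a b. b \<noteq> 0 \<longrightarrow> der G a * b = a * der G b \<longrightarrow> der V a * b = a * der V b)"

lemma kills_integrals_self: "kills_integrals G G"
  by (simp add: kills_integrals_def)

text \<open>A first integral \<open>a / b\<close> equals the quotient of the components of \<open>a\<close> and \<open>b\<close> of one weight \<open>w\<close>. The assumption
on \<open>\<mu>\<close> says that all monomials of weight \<open>w\<close> are eigenvectors of \<open>dvf \<mu>\<close> for the same eigenvalue, so the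
quotient has eigenvalue 0.\<close>

lemma kills_integrals_dvf:
  fixes G :: "'n :: finite fvec"
  assumes c: "\<And>j. c j \<ge> 1"
    and nf: "normal_form lam G"
    and G: "\<And>i. wge c (c i + 1) (G $ i - dvf lam $ i)"
    and \<mu>: "\<And>M M'. wgt lam M = wgt lam M' \<Longrightarrow> wgt \<mu> M = wgt \<mu> M'"
  shows "kills_integrals G (dvf \<mu>)"
  unfolding kills_integrals_def
proof (intro allI impI)
  fix a b :: "(complex, 'n) mfps"
  assume b0: "b \<noteq> 0" and ab: "der G a * b = a * der G b"
  obtain M where M: "mcoeff b M \<noteq> 0" using b0 by (auto simp: mfps_eq_iff)
  define w where "w = wgt lam M"
  let ?D = "der (dvf \<mu>)" and ?a = "wpart lam w a" and ?b = "wpart lam w b"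
  have "mcoeff ?b M \<noteq> 0" using M by (simp add: w_def)
  then have nz: "?b \<noteq> 0" by (metis mcoeff_0)
  have D: "?D (wpart lam w f) = mconst (wgt \<mu> M) * wpart lam w f" for f
  proof (rule mfps_eqI)
    fix K
    show "mcoeff (?D (wpart lam w f)) K = mcoeff (mconst (wgt \<mu> M) * wpart lam w f) K"
      using \<mu>[of K M] by (cases "wgt lam K = w") (simp_all add: mcoeff_der_dvf w_def)
  qed
  have eq: "?a * b = a * ?b" by (rule weight_components_of_quotient[OF c nf G ab b0])
  have "?D (?a * b) = ?D (a * ?b)" by (simp only: eq)
  then have "mconst (wgt \<mu> M) * (?a * b) + ?a * ?D b = ?D a * ?b + mconst (wgt \<mu> M) * (a * ?b)"
    by (simp only: der_mult D) (simp only: mult_ac)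
  then have eq2: "?a * ?D b = ?D a * ?b" by (simp add: eq)
  have "?b * (?D a * b) = (?D a * ?b) * b" by (simp only: mult_ac)
  also have "\<dots> = (?a * b) * ?D b" by (simp only: eq2[symmetric] mult_ac)
  also have "\<dots> = ?b * (a * ?D b)" unfolding eq by (simp only: mult_ac)
  finally show "?D a * b = a * ?D b" using nz by simp
qed

lemma killing_fields_dependent:
  fixes F G :: "'n :: finite fvec"
  assumes H: "transformation H" and HG: "transforms H F G"
    and n: "CARD('n) \<ge> 2"
    and int: "\<forall>j < CARD('n) - 2. first_integral F (\<psi> j)"
    and ind: "independent_functions (CARD('n) - 2) \<psi>"
    and V: "kills_integrals G V0" "kills_integrals G V1" "kills_integrals G V2"
  obtains a0 a1 a2 where "a0 \<noteq> 0 \<or> a1 \<noteq> 0 \<or> a2 \<noteq> 0"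
    "\<And>i. a0 * V0 $ i + a1 * V1 $ i + a2 * V2 $ i = 0"
proof -
  define m where "m = CARD('n) - 2"
  have "\<exists>p q. \<psi> j = Fract p q \<and> q \<noteq> 0" for j by (cases "\<psi> j") auto
  then obtain a b where ab: "\<And>j. \<psi> j = Fract (a j) (b j)" "\<And>j. b j \<noteq> 0" by metis
  define w where "w j = (\<chi> i. mpartial i (a j) * b j - a j * mpartial i (b j))" for j
  obtain U where U: "\<And>j k. j < m \<Longrightarrow> k < m \<Longrightarrow> (\<Sum>i\<in>UNIV. U k $ i * w j $ i) = 0 \<longleftrightarrow> j \<noteq> k"
    using independent_functions_dual[OF ind ab] unfolding w_def m_def by auto
  define V where "V s = (if s = 0 then V0 else if s = 1 then V1 else V2)" for s :: nat
  have kV: "kills_integrals G (V s)" for s using V by (simp add: V_def)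
  note H1 = order_ge_1_transformation[OF H]
  have ann: "(\<Sum>l\<in>UNIV. msubst (w j $ l) H * der (V s) (H $ l)) = 0" if "j < m" for j s
  proof -
    let ?a = "msubst (a j) H" and ?b = "msubst (b j) H"
    \<comment> \<open>Substitution of \<open>H\<close> turns the first integral of \<open>F\<close> into one of \<open>G\<close>.\<close>
    have "der F (a j) * b j = a j * der F (b j)"
      using int that first_integral_Fract[OF ab(2)] ab(1) by (simp add: m_def)
    then have "msubst (der F (a j) * b j) H = msubst (a j * der F (b j)) H" by simp
    then have "der G ?a * ?b = ?a * der G ?b"
      by (simp add: msubst_mult[OF H1(1)] der_msubst_transforms[OF H HG])
    moreover have "?b \<noteq> 0" using ab(2) by (simp add: msubst_eq_0_iff[OF H])
    ultimately have "der (V s) ?a * ?b = ?a * der (V s) ?b"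
      using kV by (simp add: kills_integrals_def)
    moreover have "(\<Sum>l\<in>UNIV. msubst (w j $ l) H * der (V s) (H $ l)) =
        der (V s) ?a * ?b - ?a * der (V s) ?b"
      by (simp add: w_def der_msubst[OF H] msubst_diff msubst_mult[OF H1(1)] sum_distrib_left
          sum_distrib_right algebra_simps sum_subtractf)
    ultimately show ?thesis by simp
  qed
  have "CARD('n) < m + 3" using n by (simp add: m_def)
  then have "\<exists>c. (\<exists>s<3. c s \<noteq> 0) \<and> (\<forall>i. (\<Sum>s<3. c s * V s $ i) = 0)"
    by (rule annihilator_dependent[OF H _ U ann])
  then obtain c where c: "\<exists>s<3. c s \<noteq> 0" "\<And>i. (\<Sum>s<3. c s * V s $ i) = 0" by blast
  have three: "{..<3 :: nat} = {0, 1, 2}" by auto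
  show thesis
  proof (rule that[of "c 0" "c 1" "c 2"])
    show "c 0 \<noteq> 0 \<or> c 1 \<noteq> 0 \<or> c 2 \<noteq> 0"
      using c(1) by (auto simp: numeral_3_eq_3 less_Suc_eq One_nat_def numeral_2_eq_2)
    show "c 0 * V0 $ i + c 1 * V1 $ i + c 2 * V2 $ i = 0" for i
      using c(2)[of i] by (simp add: three V_def add.assoc)
  qed
qed

lemma dependent_imp_det_eq_0:
  fixes a0 a1 a2 :: "'a :: idom"
  assumes nz: "a0 \<noteq> 0 \<or> a1 \<noteq> 0 \<or> a2 \<noteq> 0"
    and rel: "\<And>i. a0 * x i + a1 * y i + a2 * z i = 0"
  shows "z i * (x j * y k - x k * y j) - z j * (x i * y k - x k * y i) + z k * (x i * y j - x j * y i) = 0"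
    (is "?d = 0")
proof -
  note r = rel[of i] rel[of j] rel[of k]
  have "a0 * ?d = 0" using r by algebra
  moreover have "a1 * ?d = 0" using r by algebra
  moreover have "a2 * ?d = 0" using r by algebra
  ultimately show ?thesis using nz by auto
qed

definition minor2 :: "complex ^ 'n \<Rightarrow> complex ^ 'n \<Rightarrow> 'n \<Rightarrow> 'n \<Rightarrow> complex" where
  "minor2 u v j k = u $ j * v $ k - u $ k * v $ j"

text \<open>Three dependent vectors have vanishing \<open>3 \<times> 3\<close> minors; here two of them are diagonal linear fields, so the
minor becomes a linear relation between shifted coefficients of \<open>V\<close>.\<close>

lemma killing_field_relation:
  fixes F G :: "'n :: finite fvec"
  assumes H: "transformation H" and HG: "transforms H F G"
    and n: "CARD('n) \<ge> 2"
    and int: "\<forall>j < CARD('n) - 2. first_integral F (\<psi> j)"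
    and ind: "independent_functions (CARD('n) - 2) \<psi>"
    and V: "kills_integrals G (dvf u)" "kills_integrals G (dvf v)" "kills_integrals G V"
  shows "minor2 u v j k * mcoeff (mvar j * (mvar k * V $ i)) M
       - minor2 u v i k * mcoeff (mvar i * (mvar k * V $ j)) M
       + minor2 u v i j * mcoeff (mvar i * (mvar j * V $ k)) M = 0"
proof -
  obtain a0 a1 a2 where a: "a0 \<noteq> 0 \<or> a1 \<noteq> 0 \<or> a2 \<noteq> 0"
    "\<And>i. a0 * dvf u $ i + a1 * dvf v $ i + a2 * V $ i = 0"
    using killing_fields_dependent[OF H HG n int ind V] by metis
  have "V $ i * (dvf u $ j * dvf v $ k - dvf u $ k * dvf v $ j)
      - V $ j * (dvf u $ i * dvf v $ k - dvf u $ k * dvf v $ i)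
      + V $ k * (dvf u $ i * dvf v $ j - dvf u $ j * dvf v $ i) = 0"
    by (rule dependent_imp_det_eq_0[of a0 a1 a2 "\<lambda>i. dvf u $ i" "\<lambda>i. dvf v $ i" "\<lambda>i. V $ i", OF a])
  moreover have "dvf u $ j * dvf v $ k - dvf u $ k * dvf v $ j = mconst (minor2 u v j k) * (mvar j * mvar k)"
    for j k
    by (simp add: dvf_def minor2_def mconst_diff mconst_mult algebra_simps)
  ultimately have "mconst (minor2 u v j k) * (mvar j * (mvar k * V $ i))
      - mconst (minor2 u v i k) * (mvar i * (mvar k * V $ j))
      + mconst (minor2 u v i j) * (mvar i * (mvar j * V $ k)) = 0"
    by (simp add: mult_ac)
  from arg_cong[OF this, of "\<lambda>f. mcoeff f M"] show ?thesis by simp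
qed

text \<open>Cramer's rule: the relations are the \<open>3 \<times> 3\<close> minors of \<open>u\<close>, \<open>v\<close>, \<open>g\<close> that contain the columns \<open>j\<close>, \<open>k\<close>.\<close>

lemma minor2_solve:
  assumes nz: "minor2 u v j k \<noteq> 0"
    and rel: "\<And>i. minor2 u v j k * g $ i - minor2 u v i k * g $ j + minor2 u v i j * g $ k = 0"
  shows "\<exists>\<alpha> \<beta>. g = \<alpha> *s u + \<beta> *s v"
proof (intro exI)
  let ?d = "minor2 u v j k"
  show "g = ((g $ j * v $ k - g $ k * v $ j) / ?d) *s u + ((u $ j * g $ k - u $ k * g $ j) / ?d) *s v"
  proof (simp add: vec_eq_iff, rule allI)
    fix i
    have "?d * g $ i = (g $ j * v $ k - g $ k * v $ j) * u $ i + (u $ j * g $ k - u $ k * g $ j) * v $ i"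
      using rel[of i] by (simp add: minor2_def algebra_simps)
    then show "g $ i = (g $ j * v $ k - g $ k * v $ j) * u $ i / ?d + (u $ j * g $ k - u $ k * g $ j) * v $ i / ?d"
      using nz by (simp add: nonzero_eq_divide_eq add_divide_distrib[symmetric] mult.commute)
  qed
qed

abbreviation (input) vcnj :: "complex ^ 'n \<Rightarrow> complex ^ 'n" where
  "vcnj v \<equiv> (\<chi> i. cnj (v $ i))"

lemma wgt_vcnj: "wgt (vcnj v) M = cnj (wgt v M)"
  by (simp add: wgt_def)

lemma pair_vcnj: "pair Q (vcnj v) = cnj (pair Q v)"
  by (simp add: pair_def)

lemma independent_imp_minor2:
  fixes u v :: "complex ^ 'n :: finite"
  assumes "u \<noteq> v" "vec.independent {u, v}"
  shows "\<exists>j k. minor2 u v j k \<noteq> 0"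
proof (rule ccontr)
  assume "\<not> (\<exists>j k. minor2 u v j k \<noteq> 0)"
  then have eq: "u $ j * v $ k = u $ k * v $ j" for j k by (simp add: minor2_def)
  have "u \<noteq> 0" using assms(2) by (metis insertI1 vec.dependent_zero)
  then obtain j where j: "u $ j \<noteq> 0" by (auto simp: vec_eq_iff)
  \<comment> \<open>Vanishing minors make \<open>u $ j *s v - v $ j *s u\<close> a nontrivial relation.\<close>
  define c where "c x = (if x = v then u $ j else - v $ j)" for x
  have "(\<Sum>x\<in>{u, v}. c x *s x) = 0"
  proof -
    have "(\<Sum>x\<in>{u, v}. c x *s x) = (- v $ j) *s u + u $ j *s v"
      using assms(1) by (simp add: c_def)
    also have "\<dots> = 0" using eq[of j] by (simp add: vec_eq_iff algebra_simps)
    finally show ?thesis .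
  qed
  moreover have "\<exists>x\<in>{u, v}. c x \<noteq> 0" using j by (auto simp: c_def)
  ultimately have "vec.dependent {u, v}" using vec.dependent_finite[of "{u, v}"] by blast
  with assms(2) show False by simp
qed

lemma card_ge_2_of_minor2:
  fixes j k :: "'n :: finite"
  assumes "minor2 u v j k \<noteq> 0"
  shows "CARD('n) \<ge> 2"
proof -
  have "j \<noteq> k" using assms by (auto simp: minor2_def)
  then have "card {j, k} \<le> CARD('n)" by (intro card_mono) auto
  then show ?thesis using \<open>j \<noteq> k\<close> by simp
qed

lemma vf_coeff_outside: "Q \<notin> Ni i \<Longrightarrow> vf_coeff G Q $ i = 0"
  by (simp add: vf_coeff_def)

text \<open>Multiplying by two variables makes the coefficients that belong to one \<open>Q\<close> in three different components
comparable: all of them sit at the monomial \<open>Q + e\<^sub>i + e\<^sub>j + e\<^sub>k\<close>.\<close>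

lemma mcoeff_shifted_vf_coeff:
  fixes G :: "'n :: finite fvec"
  assumes ge: "\<And>s. (Q + axis i 1 + axis j 1 + axis k 1) $ s \<ge> 0"
  shows "mcoeff (mvar j * (mvar k * G $ i)) (\<chi> s. nat ((Q + axis i 1 + axis j 1 + axis k 1) $ s))
    = vf_coeff G Q $ i"
    (is "mcoeff ?f ?M = _")
proof (cases "Q \<in> Ni i")
  case True
  let ?N = "\<chi> s. nat ((Q + axis i 1) $ s)"
  have pos: "(Q + axis i 1) $ s \<ge> 0" for s using True by (auto simp: Ni_def axis_def)
  have "?M = ?N + axis k 1 + axis j 1"
    using pos by (auto simp: vec_eq_iff axis_def nat_add_distrib)
  then show ?thesis using True by (simp add: vf_coeff_def)
next
  case False
  have "mcoeff ?f ?M = 0"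
  proof (rule ccontr)
    assume nz: "mcoeff ?f ?M \<noteq> 0"
    then have j: "?M $ j \<noteq> 0" by (auto simp: mcoeff_mvar_mult split: if_splits)
    with nz have k: "(?M - axis j 1) $ k \<noteq> 0"
      by (simp add: mcoeff_mvar_mult[of j] mcoeff_mvar_mult[of k] split: if_splits)
    have pos: "(Q + axis i 1) $ s \<ge> 0" for s
      using ge[of s] j k by (auto simp: axis_def split: if_splits)
    have "Q $ i \<ge> -1" using pos[of i] by simp
    moreover have "Q $ s \<ge> 0" if "s \<noteq> i" for s using pos[of s] that by (simp add: axis_def)
    ultimately have "Q \<in> Ni i" by (simp add: Ni_def)
    then show False using False by simp
  qed
  then show ?thesis using vf_coeff_outside[OF False, of G] by simp
qed

text \<open>If \<open>Q + e\<^sub>i + e\<^sub>j + e\<^sub>k\<close> has a negative entry, then \<open>Q\<close> has the entry -1 outside of \<open>i\<close>, \<open>j\<close>, \<open>k\<close>, and the three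
coefficients vanish.\<close>

lemma vf_coeff_relation:
  fixes G :: "'n :: finite fvec"
  assumes Q: "Q \<in> NN"
    and rel: "\<And>M. d1 * mcoeff (mvar j * (mvar k * G $ i)) M
       - d2 * mcoeff (mvar i * (mvar k * G $ j)) M
       + d3 * mcoeff (mvar i * (mvar j * G $ k)) M = 0"
  shows "d1 * vf_coeff G Q $ i - d2 * vf_coeff G Q $ j + d3 * vf_coeff G Q $ k = 0"
proof (cases "\<forall>s. (Q + axis i 1 + axis j 1 + axis k 1) $ s \<ge> 0")
  case True
  have p: "Q + axis j 1 + axis i 1 + axis k 1 = Q + axis i 1 + axis j 1 + axis k 1"
    "Q + axis k 1 + axis i 1 + axis j 1 = Q + axis i 1 + axis j 1 + axis k 1"
    by (simp_all add: add_ac)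
  show ?thesis
    using rel[of "\<chi> s. nat ((Q + axis i 1 + axis j 1 + axis k 1) $ s)"]
      mcoeff_shifted_vf_coeff[of Q i j k G] mcoeff_shifted_vf_coeff[of Q j i k G]
      mcoeff_shifted_vf_coeff[of Q k i j G] True
    unfolding p by simp
next
  case False
  then obtain s where s: "(Q + axis i 1 + axis j 1 + axis k 1) $ s < 0" by (auto simp: not_le simp del: vector_add_component)
  have "Q $ s \<ge> -1" using Q by (auto simp: NN_def Ni_def) (metis (full_types) le_minus_one_simps(1) order.trans)
  with s have "s \<noteq> i" "s \<noteq> j" "s \<noteq> k" "Q $ s < 0" by (auto simp: axis_def split: if_splits)
  then have "Q \<notin> Ni i" "Q \<notin> Ni j" "Q \<notin> Ni k" by (auto simp: Ni_def not_le)
  then show ?thesis by (simp add: vf_coeff_outside)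
qed

text \<open>The fields \<open>dvf lam\<close>, \<open>dvf (vcnj lam)\<close>, \<open>G\<close>, and \<open>dvf \<mu>\<close> for \<open>\<mu>\<close> orthogonal to the integer relations of
\<open>lam\<close>, all annihilate the \<open>n - 2\<close> independent first integrals, so any three of them are dependent. The
orthogonality is stated with differences \<open>M - M'\<close> of exponents, which are all integer vectors.\<close>

theorem integrals_force_tangency:
  fixes F G :: "'n :: finite fvec"
  assumes H: "transformation H" and HG: "transforms H F G" and nf: "normal_form lam G"
    and c: "\<And>j. c j \<ge> 1"
    and G: "\<And>i. wge c (c i + 1) (G $ i - dvf lam $ i)"
    and int: "\<forall>j < CARD('n) - 2. first_integral F (\<psi> j)"
    and ind: "independent_functions (CARD('n) - 2) \<psi>"
    and minor: "minor2 lam (vcnj lam) j0 k0 \<noteq> 0"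
  shows normal_form_tangent: "\<And>Q. Q \<in> NN \<Longrightarrow> \<exists>\<alpha> \<beta>. vf_coeff G Q = \<alpha> *s lam + \<beta> *s vcnj lam"
    and orthogonal_lattice: "\<And>\<mu>. (\<And>M M'. wgt lam M = wgt lam M' \<Longrightarrow> wgt \<mu> M = wgt \<mu> M')
      \<Longrightarrow> \<exists>\<alpha> \<beta>. \<mu> = \<alpha> *s lam + \<beta> *s vcnj lam"
proof -
  note n = card_ge_2_of_minor2[OF minor]
  note kd = kills_integrals_dvf[OF c nf G]
  have k: "kills_integrals G (dvf lam)" "kills_integrals G (dvf (vcnj lam))"
    by (rule kd; simp add: wgt_vcnj)+
  note rel = killing_field_relation[OF H HG n int ind k]
  show "\<exists>\<alpha> \<beta>. vf_coeff G Q = \<alpha> *s lam + \<beta> *s vcnj lam" if "Q \<in> NN" for Q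
    by (rule minor2_solve[OF minor]) (rule vf_coeff_relation[OF that rel[OF kills_integrals_self]])
  show "\<exists>\<alpha> \<beta>. \<mu> = \<alpha> *s lam + \<beta> *s vcnj lam"
    if \<mu>: "\<And>M M'. wgt lam M = wgt lam M' \<Longrightarrow> wgt \<mu> M = wgt \<mu> M'" for \<mu>
  proof (rule minor2_solve[OF minor])
    fix i
    have "kills_integrals G (dvf \<mu>)" by (rule kd) (rule \<mu>)
    \<comment> \<open>For a diagonal linear field the whole relation sits at the monomial \<open>x\<^sub>i x\<^sub>j x\<^sub>k\<close>.\<close>
    from rel[OF this, of j0 k0 i "axis i 1 + axis j0 1 + axis k0 1"]
    have "minor2 lam (vcnj lam) j0 k0 * mcoeff (mvar j0 * (mvar k0 * dvf \<mu> $ i)) (axis i 1 + axis k0 1 + axis j0 1)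
       - minor2 lam (vcnj lam) i k0 * mcoeff (mvar i * (mvar k0 * dvf \<mu> $ j0)) (axis j0 1 + axis k0 1 + axis i 1)
       + minor2 lam (vcnj lam) i j0 * mcoeff (mvar i * (mvar j0 * dvf \<mu> $ k0)) (axis k0 1 + axis j0 1 + axis i 1) = 0"
      by (simp add: add_ac)
    then show "minor2 lam (vcnj lam) j0 k0 * \<mu> $ i - minor2 lam (vcnj lam) i k0 * \<mu> $ j0
       + minor2 lam (vcnj lam) i j0 * \<mu> $ k0 = 0"
      unfolding mcoeff_mvar_mult_add by (simp add: dvf_def mcoeff_mvar)
  qed
qed

text \<open>If \<open>Q\<close> has a negative entry, at \<open>l\<close> say, then only the \<open>l\<close>-th entry of the coefficient \<open>vf_coeff G Q\<close> can be
nonzero. Being a combination of \<open>lam\<close> and its conjugate, this vector is orthogonal to \<open>Q\<close>, so that entry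
vanishes too.\<close>

lemma condition_AS_of_tangency:
  fixes G :: "'n :: finite fvec"
  assumes nf: "normal_form lam G"
    and tan: "\<And>Q. Q \<in> NN \<Longrightarrow> \<exists>\<alpha> \<beta>. vf_coeff G Q = \<alpha> *s lam + \<beta> *s vcnj lam"
    and ne: "lam \<noteq> vcnj lam" and ind: "vec.independent {lam, vcnj lam}"
  shows "condition_AS lam G"
    and vf_coeff_outside_Mplus: "\<And>Q. Q \<in> NN \<Longrightarrow> Q \<notin> Mplus lam \<Longrightarrow> vf_coeff G Q = 0"
proof -
  show out: "vf_coeff G Q = 0" if Q: "Q \<in> NN" "Q \<notin> Mplus lam" for Q
  proof (rule ccontr)
    assume nz: "vf_coeff G Q \<noteq> 0"
    then have p: "pair Q lam = 0" using nf Q(1) by (auto simp: normal_form_def)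
    then have "pair Q (vcnj lam) = 0" by (simp add: pair_vcnj)
    obtain \<alpha> \<beta> where g: "vf_coeff G Q = \<alpha> *s lam + \<beta> *s vcnj lam" using tan[OF Q(1)] by blast
    have "(\<Sum>i\<in>UNIV. of_int (Q $ i) * vf_coeff G Q $ i) = \<alpha> * pair Q lam + \<beta> * pair Q (vcnj lam)"
      unfolding g by (simp add: pair_def sum_distrib_left sum.distrib algebra_simps)
    then have 0: "(\<Sum>i\<in>UNIV. of_int (Q $ i) * vf_coeff G Q $ i) = 0"
      using p \<open>pair Q (vcnj lam) = 0\<close> by simp
    obtain l where l: "Q $ l < 0" using Q(2) p by (auto simp: Mplus_def not_le)
    then have off: "vf_coeff G Q $ i = 0" if "i \<noteq> l" for i
      using that by (intro vf_coeff_outside) (force simp: Ni_def)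
    have "(\<Sum>i\<in>UNIV. of_int (Q $ i) * vf_coeff G Q $ i) = of_int (Q $ l) * vf_coeff G Q $ l"
      using off by (subst sum.remove[of _ l]) auto
    with 0 l have "vf_coeff G Q $ l = 0" by simp
    with off have "vf_coeff G Q = 0" by (metis vec_eq_iff zero_index)
    with nz show False by simp
  qed
  define \<mu> where "\<mu> j = (if j = 0 then lam else vcnj lam)" for j :: nat
  have two: "{..<2 :: nat} = {0, 1}" by auto
  have im: "\<mu> ` {..<2} = {lam, vcnj lam}" by (auto simp: two \<mu>_def)
  have sub: "Mplus lam \<subseteq> NN"
  proof
    fix P assume "P \<in> Mplus lam"
    then have "P $ i \<ge> 0" for i by (simp add: Mplus_def)
    then have "P \<in> Ni undefined" by (auto simp: Ni_def intro: order.trans[of _ 0])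
    then show "P \<in> NN" by (auto simp: NN_def)
  qed
  have "additive_decomposition lam 2 \<mu>"
    unfolding additive_decomposition_def im
  proof (intro conjI exI)
    show "inj_on \<mu> {..<2}" using ne by (auto simp: inj_on_def two \<mu>_def)
    show "lam = (\<Sum>j<2. (if j = 0 then 1 else 0) *s \<mu> j)" by (simp add: two \<mu>_def)
  qed (use ind in auto)
  moreover have "diophantine_hull lam 2 \<mu>"
    unfolding diophantine_hull_def
    by (rule exI[of _ 1]) (auto simp: \<mu>_def pair_vcnj)
  moreover have "G = vf_series (Mplus lam) (vf_coeff G)"
  proof -
    have "vf_series (Mplus lam) (vf_coeff G) = vf_series NN (vf_coeff G)"
      using sub out by (auto simp: vf_series_def vec_eq_iff mfps_eq_iff)
    then show ?thesis by (simp add: vf_series_vf_coeff)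
  qed
  moreover have "vf_coeff G P \<in> vec.span (\<mu> ` {..<2})" if P: "P \<in> Mplus lam" for P
  proof -
    obtain \<alpha> \<beta> where "vf_coeff G P = \<alpha> *s lam + \<beta> *s vcnj lam" using tan[of P] sub P by blast
    moreover have "lam \<in> vec.span {lam, vcnj lam}" "vcnj lam \<in> vec.span {lam, vcnj lam}"
      by (auto intro: vec.span_base)
    ultimately show ?thesis unfolding im by (simp add: vec.span_add vec.span_scale)
  qed
  ultimately show "condition_AS lam G" unfolding condition_AS_def by blast
qed

section \<open>Absence of small divisors\<close>

lemma common_denominator_rat:
  fixes x :: "'i \<Rightarrow> rat"
  assumes "finite I"
  shows "\<exists>D>0. \<forall>i\<in>I. of_int D * x i \<in> \<int>"
  using assms
proof (induction I rule: finite_induct)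
  case empty
  then show ?case by (intro exI[of _ 1]) auto
next
  case (insert j I)
  then obtain D where D: "D > 0" "\<And>i. i \<in> I \<Longrightarrow> of_int D * x i \<in> \<int>" by auto
  obtain p q where pq: "quotient_of (x j) = (p, q)" by fastforce
  have q: "q > 0" using pq by (rule quotient_of_denom_pos)
  have xj: "of_int q * x j = of_int p" using quotient_of_div[OF pq] q by simp
  have "of_int (D * q) * x i \<in> \<int>" if "i \<in> insert j I" for i
  proof (cases "i = j")
    case True
    have "of_int (D * q) * x i = of_int (D * p)" unfolding True using xj by (simp add: mult.assoc)
    then show ?thesis by (metis Ints_of_int)
  next
    case False
    then have "of_int q * (of_int D * x i) \<in> \<int>" using D(2) that by auto
    then show ?thesis by (simp add: mult_ac)
  qed
  then show ?case using D(1) q by (intro exI[of _ "D * q"]) simp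
qed

interpretation rat_complex: vector_space "\<lambda>(q :: rat) (z :: complex). of_rat q * z"
  by unfold_locales (simp_all add: of_rat_add of_rat_mult algebra_simps)

text \<open>In a basis \<open>B\<close> of the rational span of the entries, \<open>lam = (\<Sum>b\<in>B. b *s \<mu> b)\<close> with rational vectors \<open>\<mu> b\<close>.
Every integer relation of \<open>lam\<close> is one of \<open>\<mu> b\<close>, because \<open>B\<close> is independent over the rationals; by
assumption \<open>\<mu> b\<close> is therefore a combination of \<open>lam\<close> and its conjugate, and \<open>\<bar>pair Q (\<mu> b)\<bar>\<close> is at most a
constant times \<open>\<bar>pair Q lam\<bar>\<close>. The numbers \<open>pair Q (\<mu> b)\<close> are rational with a fixed denominator, so a small
value of \<open>\<bar>pair Q lam\<bar>\<close> forces all of them, and then \<open>pair Q lam\<close>, to vanish.\<close>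

theorem weights_discrete:
  fixes lam :: "complex ^ 'n :: finite"
  assumes orth: "\<And>\<mu>. (\<And>M M'. wgt lam M = wgt lam M' \<Longrightarrow> wgt \<mu> M = wgt \<mu> M')
      \<Longrightarrow> \<exists>\<alpha> \<beta>. \<mu> = \<alpha> *s lam + \<beta> *s vcnj lam"
  obtains \<delta> where "\<delta> > 0" "\<And>Q. pair Q lam \<noteq> 0 \<Longrightarrow> \<delta> \<le> norm (pair Q lam)"
proof -
  obtain B where B: "B \<subseteq> range (($) lam)" "rat_complex.independent B"
    "range (($) lam) \<subseteq> rat_complex.span B"
    by (rule rat_complex.maximal_independent_subset)
  have fin: "finite B" by (rule finite_subset[OF B(1)]) simp
  define r where "r i b = rat_complex.representation B (lam $ i) b" for i b
  have span: "lam $ i \<in> rat_complex.span B" for i using B(3) by auto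
  have lam: "lam $ i = (\<Sum>b\<in>B. of_rat (r i b) * b)" for i
    unfolding r_def using rat_complex.sum_representation_eq[OF B(2) span fin order_refl] by simp
  define \<mu> :: "complex \<Rightarrow> complex ^ 'n" where "\<mu> b = (\<chi> i. of_rat (r i b))" for b
  have "wgt (\<mu> b) M = of_rat (rat_complex.representation B (wgt lam M) b)" for b M
  proof -
    have "wgt lam M = (\<Sum>i\<in>UNIV. of_rat (of_nat (M $ i)) * lam $ i)" by (simp add: wgt_def)
    then have "rat_complex.representation B (wgt lam M) =
        (\<lambda>b. \<Sum>i\<in>UNIV. of_nat (M $ i) * r i b)"
      by (simp only: rat_complex.representation_sum[OF B(2) rat_complex.span_scale[OF span]]
          rat_complex.representation_scale[OF B(2) span] r_def)
    then show ?thesis by (simp add: wgt_def \<mu>_def of_rat_sum of_rat_mult)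
  qed
  then have "\<exists>\<alpha> \<beta>. \<mu> b = \<alpha> *s lam + \<beta> *s vcnj lam" for b
    by (intro orth) simp
  then obtain \<alpha> \<beta> where ab: "\<And>b. \<mu> b = \<alpha> b *s lam + \<beta> b *s vcnj lam" by metis
  define C where "C = (\<Sum>b\<in>B. norm (\<alpha> b) + norm (\<beta> b))"
  have bound: "norm (pair Q (\<mu> b)) \<le> C * norm (pair Q lam)" if "b \<in> B" for Q b
  proof -
    have "pair Q (\<mu> b) = \<alpha> b * pair Q lam + \<beta> b * pair Q (vcnj lam)"
      unfolding ab by (simp add: pair_def sum_distrib_left sum.distrib algebra_simps)
    then have "norm (pair Q (\<mu> b)) \<le> norm (\<alpha> b * pair Q lam) + norm (\<beta> b * pair Q (vcnj lam))"
      by (metis norm_triangle_ineq)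
    also have "\<dots> = (norm (\<alpha> b) + norm (\<beta> b)) * norm (pair Q lam)"
      by (simp add: pair_vcnj norm_mult algebra_simps)
    also have "\<dots> \<le> C * norm (pair Q lam)"
      unfolding C_def using fin that by (intro mult_right_mono member_le_sum) auto
    finally show ?thesis .
  qed
  have "finite (UNIV \<times> B :: ('n \<times> complex) set)" using fin by simp
  then obtain D where D0: "D > 0" and D': "\<forall>p\<in>UNIV \<times> B. of_int D * r (fst p) (snd p) \<in> \<int>"
    using common_denominator_rat[of "UNIV \<times> B" "\<lambda>p. r (fst p) (snd p)"] by blast
  have D: "of_int D * r i b \<in> \<int>" if "b \<in> B" for i b
    using D'[rule_format, of "(i, b)"] that by simp
  have int: "of_int D * pair Q (\<mu> b) \<in> \<int>" if b: "b \<in> B" for Q b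
  proof -
    have "\<forall>i. \<exists>z. of_int D * r i b = of_int z" using D[OF b] by (auto simp: Ints_def)
    from choice[OF this] obtain z where z: "\<And>i. of_int D * r i b = of_int (z i)" by blast
    have "of_int D * \<mu> b $ i = of_int (z i)" for i
      using arg_cong[OF z[of i], of "of_rat :: rat \<Rightarrow> complex"] by (simp add: \<mu>_def of_rat_mult)
    then have "of_int D * pair Q (\<mu> b) = (\<Sum>i\<in>UNIV. of_int (Q $ i) * of_int (z i))"
      unfolding pair_def sum_distrib_left
      by (intro sum.cong) (simp_all only: mult.left_commute[of "of_int D"])
    also have "\<dots> \<in> \<int>" by (intro Ints_sum Ints_mult Ints_of_int)
    finally show ?thesis .
  qed
  have C0: "C \<ge> 0" unfolding C_def by (intro sum_nonneg) simp
  show thesis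
  proof (rule that[of "1 / (of_int D * (C + 1))"])
    show "1 / (of_int D * (C + 1)) > 0" using D0 C0 by simp
    fix Q assume Q: "pair Q lam \<noteq> 0"
    have "pair Q lam = (\<Sum>b\<in>B. b * pair Q (\<mu> b))"
      unfolding pair_def sum_distrib_left
      by (subst sum.swap) (simp add: lam[of i for i] \<mu>_def sum_distrib_left mult_ac)
    then obtain b where b: "b \<in> B" "pair Q (\<mu> b) \<noteq> 0"
      using Q by (metis (no_types, lifting) mult_zero_right sum.neutral)
    have "1 \<le> norm (of_int D * pair Q (\<mu> b))"
    proof -
      obtain z where z: "of_int D * pair Q (\<mu> b) = of_int z" using int[OF b(1)] by (auto elim: Ints_cases)
      then have "z \<noteq> 0" using b(2) D0 by auto
      then have "1 \<le> \<bar>of_int z :: real\<bar>" by linarith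
      then show ?thesis by (simp only: z norm_of_int)
    qed
    also have "\<dots> = of_int D * norm (pair Q (\<mu> b))" using D0 by (simp add: norm_mult)
    also have "\<dots> \<le> of_int D * ((C + 1) * norm (pair Q lam))"
    proof (rule mult_left_mono)
      have "C * norm (pair Q lam) \<le> (C + 1) * norm (pair Q lam)" by (simp add: algebra_simps)
      then show "norm (pair Q (\<mu> b)) \<le> (C + 1) * norm (pair Q lam)"
        using bound[OF b(1), of Q] by linarith
    qed (use D0 in simp)
    finally show "1 / (of_int D * (C + 1)) \<le> norm (pair Q lam)"
      using D0 C0 by (simp add: divide_le_eq mult_ac)
  qed
qed

text \<open>The numbers \<open>omega lam k\<close> lie between \<open>\<delta>\<close> and the absolute value of a nonzero entry of \<open>lam\<close>, so their
logarithms are bounded and the series is dominated by a geometric one.\<close>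

lemma condition_omega_of_gap:
  fixes lam :: "complex ^ 'n :: finite"
  assumes "lam \<noteq> 0" and d: "\<delta> > 0" "\<And>Q. pair Q lam \<noteq> 0 \<Longrightarrow> \<delta> \<le> norm (pair Q lam)"
  shows "condition_omega lam"
proof -
  obtain i where i: "lam $ i \<noteq> 0" using assms(1) by (auto simp: vec_eq_iff)
  define S where "S k = {norm (pair Q lam) |Q. Q \<in> NN \<and> pair Q lam \<noteq> 0 \<and> qnorm Q < 2 ^ k}" for k :: nat
  have fin: "finite (S k)" for k
  proof (rule finite_subset[OF _ finite_imageI[OF finite_qnorm_less]])
    show "S k \<subseteq> (\<lambda>Q. norm (pair Q lam)) ` {Q \<in> NN. qnorm Q < 2 ^ k}" by (auto simp: S_def)
  qed
  have mem: "norm (lam $ i) \<in> S (Suc k)" for k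
  proof -
    let ?Q = "- axis i 1 :: int ^ 'n"
    have "?Q \<in> Ni i" by (auto simp: Ni_def axis_def)
    then have "?Q \<in> NN" by (auto simp: NN_def)
    moreover have p: "pair ?Q lam = - lam $ i"
    proof -
      have "pair ?Q lam = (\<Sum>j\<in>UNIV. if j = i then - lam $ j else 0)"
        unfolding pair_def by (rule sum.cong) (auto simp: axis_def)
      then show ?thesis by simp
    qed
    moreover have "qnorm ?Q = 1"
      by (simp add: qnorm_def sum_negf axis_def)
    moreover have "(1 :: int) < 2 ^ Suc k" by (rule one_less_power) auto
    ultimately show ?thesis unfolding S_def using i by (auto intro!: exI[of _ ?Q])
  qed
  have om: "omega lam k = Min (S k)" for k by (simp add: omega_def S_def)
  have lo: "\<delta> \<le> omega lam (Suc k)" and hi: "omega lam (Suc k) \<le> norm (lam $ i)" for k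
  proof -
    show "omega lam (Suc k) \<le> norm (lam $ i)" unfolding om using fin mem by (rule Min_le)
    have "Min (S (Suc k)) \<in> S (Suc k)" using fin mem[of k] by (intro Min_in) auto
    then show "\<delta> \<le> omega lam (Suc k)" unfolding om using d(2) by (auto simp: S_def)
  qed
  define C where "C = \<bar>ln \<delta>\<bar> + \<bar>ln (norm (lam $ i))\<bar>"
  have bound: "\<bar>ln (inverse (omega lam (Suc k)))\<bar> \<le> C" for k
  proof -
    have pos: "omega lam (Suc k) > 0" using lo[of k] d(1) by linarith
    have "ln \<delta> \<le> ln (omega lam (Suc k))" "ln (omega lam (Suc k)) \<le> ln (norm (lam $ i))"
      using lo[of k] hi[of k] d(1) pos i by simp_all
    then show ?thesis using pos by (simp add: ln_inverse C_def)
  qed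
  have le: "norm (ln (inverse (omega lam (Suc k))) / 2 ^ Suc k) \<le> C * (1 / 2) ^ Suc k" for k
  proof -
    have "norm (ln (inverse (omega lam (Suc k))) / 2 ^ Suc k) =
        \<bar>ln (inverse (omega lam (Suc k)))\<bar> * (1 / 2) ^ Suc k"
      by (simp add: power_one_over)
    also have "\<dots> \<le> C * (1 / 2) ^ Suc k"
      by (rule mult_right_mono[OF bound]) simp
    finally show ?thesis .
  qed
  have sum: "summable (\<lambda>k. C * (1 / 2 :: real) ^ Suc k)"
    by (intro summable_mult, subst summable_Suc_iff) (rule summable_geometric, simp)
  show ?thesis
    unfolding condition_omega_def by (rule summable_comparison_test'[OF sum, of 0]) (rule le)
qed

section \<open>Convergence\<close>

lemma mconst_minus: "mconst (- a) = - mconst a"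
  by (auto simp: mfps_eq_iff mcoeff_mconst)

text \<open>The \<open>\<ell>\<^sub>1\<close> norm on the polydisc of radius \<open>t\<close>, truncated at degree \<open>m\<close> so that it is finite for every
formal series.\<close>

definition truncnorm :: "real \<Rightarrow> nat \<Rightarrow> (complex, 'n :: finite) mfps \<Rightarrow> real" where
  "truncnorm t m f = (\<Sum>M | mdeg M \<le> m. norm (mcoeff f M) * t ^ mdeg M)"

lemma truncnorm_mono_coeff:
  assumes "t \<ge> 0" "\<And>M. norm (mcoeff f M) \<le> norm (mcoeff g M)"
  shows "truncnorm t m f \<le> truncnorm t m g"
  unfolding truncnorm_def using assms by (intro sum_mono mult_right_mono) auto

lemma truncnorm_nonneg: "t \<ge> 0 \<Longrightarrow> 0 \<le> truncnorm t m f"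
  unfolding truncnorm_def by (intro sum_nonneg) simp

lemma truncnorm_add: "t \<ge> 0 \<Longrightarrow> truncnorm t m (f + g) \<le> truncnorm t m f + truncnorm t m g"
  unfolding truncnorm_def sum.distrib[symmetric] distrib_right[symmetric] mcoeff_add
  by (intro sum_mono mult_right_mono norm_triangle_ineq) simp

lemma truncnorm_diff: "t \<ge> 0 \<Longrightarrow> truncnorm t m (f - g) \<le> truncnorm t m f + truncnorm t m g"
  unfolding truncnorm_def sum.distrib[symmetric] distrib_right[symmetric] mcoeff_diff
  by (intro sum_mono mult_right_mono norm_triangle_ineq4) simp

lemma truncnorm_mconst_mult: "truncnorm t m (mconst a * f) = norm a * truncnorm t m f"
  unfolding truncnorm_def mcoeff_mconst_mult norm_mult sum_distrib_left by (simp only: mult.assoc)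

text \<open>The shifts by the orders of the factors let degree \<open>m + 1\<close> of a product of series without constant terms be
controlled by degree \<open>m\<close> of the factors, which drives the induction in \<open>normalizing_converges\<close>.\<close>

lemma truncnorm_mult:
  fixes f g :: "(complex, 'n :: finite) mfps"
  assumes t: "t \<ge> 0" and f: "order_ge p f" and g: "order_ge q g"
  shows "truncnorm t m (f * g) \<le> truncnorm t (m - q) f * truncnorm t (m - p) g"
proof -
  define A where "A a b = norm (mcoeff f a) * t ^ mdeg a * (norm (mcoeff g b) * t ^ mdeg b)" for a b
  have A0: "A a b \<ge> 0" for a b using t by (simp add: A_def)
  have "truncnorm t m (f * g) \<le> (\<Sum>M | mdeg M \<le> m. \<Sum>(a, b)\<in>splits M. A a b)"
    unfolding truncnorm_def
  proof (rule sum_mono)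
    fix M :: "nat ^ 'n"
    have "norm (mcoeff (f * g) M) * t ^ mdeg M \<le>
        (\<Sum>(a, b)\<in>splits M. norm (mcoeff f a * mcoeff g b)) * t ^ mdeg M"
      unfolding mcoeff_mult case_prod_unfold using t by (intro mult_right_mono norm_sum) auto
    also have "\<dots> = (\<Sum>(a, b)\<in>splits M. A a b)"
      unfolding sum_distrib_right case_prod_unfold
      by (rule sum.cong) (auto simp: splits_def A_def norm_mult mdeg_add power_add)
    finally show "norm (mcoeff (f * g) M) * t ^ mdeg M \<le> (\<Sum>(a, b)\<in>splits M. A a b)" .
  qed
  also have "\<dots> = (\<Sum>(M, a, b)\<in>(SIGMA M:{M. mdeg M \<le> m}. splits M). A a b)"
    by (subst sum.Sigma) (auto simp: case_prod_unfold)
  also have "\<dots> = (\<Sum>(a, b)\<in>{(a, b). mdeg (a + b) \<le> m}. A a b)"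
    by (rule sum.reindex_bij_witness[of _ "\<lambda>(a, b). (a + b, a, b)" "\<lambda>(M, a, b). (a, b)"])
      (auto simp: splits_def)
  also have "\<dots> \<le> (\<Sum>(a, b)\<in>{a. mdeg a \<le> m - q} \<times> {b. mdeg b \<le> m - p}. A a b)"
  proof -
    have fa: "p \<le> mdeg a" if "mcoeff f a \<noteq> 0" for a using f that by (meson not_le order_ge_def)
    have gb: "q \<le> mdeg b" if "mcoeff g b \<noteq> 0" for b using g that by (meson not_le order_ge_def)
    have "(\<Sum>(a, b)\<in>{(a, b). mdeg (a + b) \<le> m}. A a b) =
        (\<Sum>(a, b)\<in>{(a, b). mdeg (a + b) \<le> m \<and> p \<le> mdeg a \<and> q \<le> mdeg b}. A a b)"
    proof (rule sum.mono_neutral_right)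
      show "finite {(a :: nat ^ 'n, b). mdeg (a + b) \<le> m}"
        by (rule finite_subset[of _ "{a. mdeg a \<le> m} \<times> {b. mdeg b \<le> m}"]) (auto simp: mdeg_add)
    qed (use fa gb in \<open>auto simp: A_def\<close>)
    also have "\<dots> \<le> (\<Sum>(a, b)\<in>{a. mdeg a \<le> m - q} \<times> {b. mdeg b \<le> m - p}. A a b)"
      using A0 by (intro sum_mono2) (auto simp: mdeg_add)
    finally show ?thesis .
  qed
  also have "\<dots> = truncnorm t (m - q) f * truncnorm t (m - p) g"
    unfolding truncnorm_def sum_product A_def by (simp add: sum.cartesian_product)
  finally show ?thesis .
qed

lemma truncnorm_mvar_mult:
  "truncnorm t (Suc m) (mvar i * f) = t * truncnorm t m f"
proof -
  have "truncnorm t (Suc m) (mvar i * f) =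
      (\<Sum>M | mdeg M \<le> Suc m \<and> M $ i \<noteq> 0. norm (mcoeff (mvar i * f) M) * t ^ mdeg M)"
    unfolding truncnorm_def by (rule sum.mono_neutral_right) (auto simp: mcoeff_mvar_mult)
  also have "\<dots> = (\<Sum>M | mdeg M \<le> m. t * (norm (mcoeff f M) * t ^ mdeg M))"
  proof (rule sum.reindex_bij_witness[of _ "\<lambda>M. M + axis i 1" "\<lambda>M. M - axis i 1"], goal_cases)
    case (2 M)
    then show ?case using arg_cong[OF axis_add_diff[of M i], of mdeg] by (simp add: mdeg_add)
  next
    case (5 M)
    then have "mdeg M = mdeg (M - axis i 1) + 1"
      using arg_cong[OF axis_add_diff[of M i], of mdeg] by (simp add: mdeg_add)
    then show ?case using 5 by (simp add: mcoeff_mvar_mult power_add)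
  qed (auto simp: axis_add_diff mdeg_add)
  finally show ?thesis by (simp add: truncnorm_def sum_distrib_left)
qed

lemma truncnorm_1: "truncnorm t m (1 :: (complex, 'n :: finite) mfps) \<le> 1"
proof -
  have "truncnorm t m (1 :: (complex, 'n) mfps) = (\<Sum>M :: nat ^ 'n | mdeg M \<le> m. if M = 0 then 1 else 0)"
    unfolding truncnorm_def by (rule sum.cong) (auto simp: mcoeff_1)
  then show ?thesis by simp
qed

lemma truncnorm_mvar:
  assumes "t \<ge> 0"
  shows "truncnorm t m (mvar i :: (complex, 'n :: finite) mfps) \<le> t"
proof -
  have "truncnorm t m (mvar i :: (complex, 'n) mfps) =
      (\<Sum>M :: nat ^ 'n | mdeg M \<le> m. if M = axis i 1 then t else 0)"
    unfolding truncnorm_def by (rule sum.cong) (auto simp: mcoeff_mvar)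
  then show ?thesis using assms by simp
qed

lemma truncnorm_mpow:
  assumes t: "t \<ge> 0" and H: "\<And>i. truncnorm t m (H $ i) \<le> s"
  shows "truncnorm t m (mpow H M) \<le> s ^ mdeg M"
proof (induction M rule: exponent_induct)
  case 0
  then show ?case using truncnorm_1 by simp
next
  case (step M i)
  have s: "0 \<le> s" using H[of i] truncnorm_nonneg[OF t, of m "H $ i"] by linarith
  have "truncnorm t m (mpow H M * H $ i) \<le> truncnorm t (m - 0) (mpow H M) * truncnorm t (m - 0) (H $ i)"
    by (rule truncnorm_mult[OF t]) (auto simp: order_ge_def)
  also have "\<dots> \<le> s ^ mdeg M * s"
    using step H s truncnorm_nonneg[OF t] by (intro mult_mono) auto
  finally show ?case by (simp add: mpow_add mdeg_add power_add)
qed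

lemma truncnorm_mpow_Suc:
  assumes t: "t \<ge> 0" and H: "\<And>i. truncnorm t m (H $ i) \<le> s" and H1: "\<And>i. order_ge 1 (H $ i)"
    and M: "mdeg M \<ge> 2"
  shows "truncnorm t (Suc m) (mpow H M) \<le> s ^ mdeg M"
proof -
  have "M \<noteq> 0" using M by auto
  then obtain i where i: "M $ i \<noteq> 0" by (auto simp: vec_eq_iff)
  define N where "N = M - axis i 1"
  have MN: "M = N + axis i 1" using axis_add_diff[OF i] by (simp add: N_def)
  then have N: "mdeg M = mdeg N + 1" by (simp add: mdeg_add)
  have s: "0 \<le> s" using H[of i] truncnorm_nonneg[OF t, of m "H $ i"] by linarith
  have "order_ge 1 (mpow H N)"
    unfolding order_ge_eq_wge
    by (rule wge_mono[OF wge_mpow[of "\<lambda>_. 1" "\<lambda>_. 1" H N]])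
      (use H1 M N in \<open>auto simp: order_ge_eq_wge mdeg_eq_wt\<close>)
  then have "truncnorm t (Suc m) (mpow H N * H $ i) \<le>
      truncnorm t (Suc m - 1) (mpow H N) * truncnorm t (Suc m - 1) (H $ i)"
    by (rule truncnorm_mult[OF t _ H1])
  also have "\<dots> \<le> s ^ mdeg N * s"
    using truncnorm_mpow[OF t H, of N] H[of i] s truncnorm_nonneg[OF t] by (intro mult_mono) auto
  finally show ?thesis using N by (simp add: MN mpow_add power_add)
qed

text \<open>Since \<open>f\<close> starts with quadratic terms, substituting a map of norm at most \<open>s\<close> yields a factor \<open>s\<^sup>2\<close>, and
only the terms of \<open>H\<close> up to degree \<open>m\<close> enter the terms of degree \<open>m + 1\<close>.\<close>

lemma truncnorm_msubst:
  assumes t: "t \<ge> 0" and H: "\<And>i. truncnorm t m (H $ i) \<le> s" and H1: "\<And>i. order_ge 1 (H $ i)"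
    and f: "order_ge 2 (f :: (complex, 'n :: finite) mfps)" and \<rho>: "s \<le> \<rho>" "\<rho> > 0" and C: "truncnorm \<rho> (Suc m) f \<le> C"
  shows "truncnorm t (Suc m) (msubst f H) \<le> (s / \<rho>)\<^sup>2 * C"
proof -
  have s: "0 \<le> s" using H[of undefined] truncnorm_nonneg[OF t, of m "H $ undefined"] by linarith
  have "truncnorm t (Suc m) (msubst f H) \<le>
      (\<Sum>P | mdeg P \<le> Suc m. \<Sum>M | mdeg M \<le> Suc m. norm (mcoeff f M) * norm (mcoeff (mpow H M) P) * t ^ mdeg P)"
    unfolding truncnorm_def sum_distrib_right[symmetric]
  proof (intro sum_mono mult_right_mono)
    fix P :: "nat ^ 'n" assume "P \<in> {P. mdeg P \<le> Suc m}"
    then have "norm (mcoeff (msubst f H) P) = norm (\<Sum>M | mdeg M \<le> Suc m. mcoeff f M * mcoeff (mpow H M) P)"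
      using mcoeff_msubst[OF H1, of P "Suc m" f] by simp
    also have "\<dots> \<le> (\<Sum>M | mdeg M \<le> Suc m. norm (mcoeff f M * mcoeff (mpow H M) P))"
      by (rule norm_sum)
    finally show "norm (mcoeff (msubst f H) P) \<le> (\<Sum>M | mdeg M \<le> Suc m. norm (mcoeff f M) * norm (mcoeff (mpow H M) P))"
      by (simp add: norm_mult)
  qed (use t in simp)
  also have "\<dots> = (\<Sum>M | mdeg M \<le> Suc m. norm (mcoeff f M) * truncnorm t (Suc m) (mpow H M))"
    unfolding truncnorm_def sum_distrib_left by (subst sum.swap) (simp add: mult.assoc)
  also have "\<dots> \<le> (\<Sum>M | mdeg M \<le> Suc m. (s / \<rho>)\<^sup>2 * (norm (mcoeff f M) * \<rho> ^ mdeg M))"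
  proof (rule sum_mono)
    fix M
    show "norm (mcoeff f M) * truncnorm t (Suc m) (mpow H M) \<le> (s / \<rho>)\<^sup>2 * (norm (mcoeff f M) * \<rho> ^ mdeg M)"
    proof (cases "mdeg M < 2")
      case True
      then show ?thesis using f by (simp add: order_ge_def)
    next
      case False
      then have "truncnorm t (Suc m) (mpow H M) \<le> s ^ mdeg M"
        by (intro truncnorm_mpow_Suc[OF t H H1]) simp
      also have "\<dots> = (s / \<rho>) ^ mdeg M * \<rho> ^ mdeg M" using \<rho>(2) by (simp add: power_divide)
      also have "\<dots> \<le> (s / \<rho>)\<^sup>2 * \<rho> ^ mdeg M"
        using False s \<rho> by (intro mult_right_mono power_decreasing) auto
      finally have "norm (mcoeff f M) * truncnorm t (Suc m) (mpow H M) \<le>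
          norm (mcoeff f M) * ((s / \<rho>)\<^sup>2 * \<rho> ^ mdeg M)"
        by (rule mult_left_mono) simp
      then show ?thesis by (simp only: mult.left_commute)
    qed
  qed
  also have "\<dots> = (s / \<rho>)\<^sup>2 * truncnorm \<rho> (Suc m) f" by (simp add: truncnorm_def sum_distrib_left)
  also have "\<dots> \<le> (s / \<rho>)\<^sup>2 * C" using C by (intro mult_left_mono) auto
  finally show ?thesis .
qed

lemma prod_power_const: "(\<Prod>i\<in>UNIV. (a :: 'a :: comm_monoid_mult) ^ (M $ i)) = a ^ mdeg M"
  by (simp add: mdeg_def power_sum)

lemma truncnorm_bounded_of_mconvergent:
  assumes "mconvergent f"
  shows "\<exists>\<rho>>0. \<exists>C. \<forall>m. truncnorm \<rho> m f \<le> C"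
proof -
  obtain r where r: "r > 0" "\<And>z. (\<forall>i. norm (z $ i) < r) \<Longrightarrow>
      (\<lambda>M. mcoeff f M * (\<Prod>i\<in>UNIV. (z $ i) ^ (M $ i))) summable_on UNIV"
    using assms unfolding mconvergent_def by blast
  define g where "g M = mcoeff f M * complex_of_real (r / 2) ^ mdeg M" for M
  have "g summable_on UNIV"
    using r(2)[of "\<chi> i. complex_of_real (r / 2)"] r(1) by (simp add: g_def[abs_def] prod_power_const)
  then have sum: "(\<lambda>M. norm (g M)) summable_on UNIV"
    by (simp add: summable_on_iff_abs_summable_on_complex)
  have g: "norm (g M) = norm (mcoeff f M) * (r / 2) ^ mdeg M" for M
    using r(1) by (simp add: g_def norm_mult norm_power norm_divide)
  have "truncnorm (r / 2) m f \<le> infsum (\<lambda>M. norm (g M)) UNIV" for m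
    unfolding truncnorm_def g[symmetric] using sum by (intro finite_sum_le_infsum) auto
  then show ?thesis using r(1) by (intro exI[of _ "r / 2"]) auto
qed

lemma mconvergent_of_truncnorm_bounded:
  fixes f :: "(complex, 'n :: finite) mfps"
  assumes t: "t > 0" and C: "\<And>m. truncnorm t m f \<le> C"
  shows "mconvergent f"
  unfolding mconvergent_def
proof (intro exI[of _ t] conjI allI impI t)
  have *: "(\<lambda>M. norm (mcoeff f M) * t ^ mdeg M) summable_on UNIV"
  proof (rule nonneg_bdd_above_summable_on)
    show "bdd_above (sum (\<lambda>M. norm (mcoeff f M) * t ^ mdeg M) ` {F. F \<subseteq> UNIV \<and> finite F})"
    proof (rule bdd_aboveI2[of _ _ C])
      fix F :: "(nat ^ 'n) set" assume "F \<in> {F. F \<subseteq> UNIV \<and> finite F}"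
      then have F: "finite F" by simp
      define m where "m = (\<Sum>M\<in>F. mdeg M)"
      have "F \<subseteq> {M. mdeg M \<le> m}" unfolding m_def using F by (auto intro: member_le_sum)
      then have "sum (\<lambda>M. norm (mcoeff f M) * t ^ mdeg M) F \<le> truncnorm t m f"
        unfolding truncnorm_def using t by (intro sum_mono2) auto
      then show "sum (\<lambda>M. norm (mcoeff f M) * t ^ mdeg M) F \<le> C" using C[of m] by linarith
    qed
  qed (use t in auto)
  fix z :: "complex ^ 'n" assume z: "\<forall>i. norm (z $ i) < t"
  have "(\<lambda>M. norm (mcoeff f M * (\<Prod>i\<in>UNIV. (z $ i) ^ (M $ i)))) summable_on UNIV"
  proof (rule Infinite_Sum.abs_summable_on_comparison_test'[OF *])
    fix M :: "nat ^ 'n"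
    have "norm (\<Prod>i\<in>UNIV. (z $ i) ^ (M $ i)) = (\<Prod>i\<in>UNIV. norm (z $ i) ^ (M $ i))"
      by (simp add: prod_norm[symmetric] norm_power)
    also have "\<dots> \<le> (\<Prod>i\<in>UNIV. t ^ (M $ i))"
      using z by (intro prod_mono conjI power_mono) (auto intro: less_imp_le)
    also have "\<dots> = t ^ mdeg M" by (rule prod_power_const)
    finally show "norm (mcoeff f M * (\<Prod>i\<in>UNIV. (z $ i) ^ (M $ i))) \<le> norm (mcoeff f M) * t ^ mdeg M"
      using t by (simp add: norm_mult mult_left_mono)
  qed
  then show "(\<lambda>M. mcoeff f M * (\<Prod>i\<in>UNIV. (z $ i) ^ (M $ i))) summable_on UNIV"
    by (rule abs_summable_summable)
qed


lemma wgt_mcoeff_mult: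
  assumes f: "\<And>M. mcoeff f M \<noteq> 0 \<Longrightarrow> wgt lam M = 0"
    and g: "\<And>M. mcoeff g M \<noteq> 0 \<Longrightarrow> wgt lam M \<noteq> w"
    and M: "wgt lam M = w"
  shows "mcoeff (f * g) M = 0"
proof (rule ccontr)
  assume "mcoeff (f * g) M \<noteq> 0"
  then obtain a b where "a + b = M" "mcoeff f a \<noteq> 0" "mcoeff g b \<noteq> 0" by (rule mcoeff_mult_nonzero)
  then show False using f[of a] g[of b] M by (auto simp: wgt_add)
qed

text \<open>With \<open>h = H - x\<close>, the series \<open>k i\<close> has the coefficients of \<open>h i\<close> times their divisors, and \<open>l i\<close> the same with
conjugated divisors, so \<open>k\<close> and \<open>l\<close> have equal norms, and these dominate \<open>\<delta>\<close> times the norm of \<open>h\<close>. In the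
conjugation equation \<open>k i\<close> is nonresonant and \<open>mvar i * g i\<close>, the nonlinear part of \<open>G\<close>, is resonant. The
resonant part of the equation bounds \<open>g\<close>, hence \<open>u\<close> and \<open>v\<close>, by the substituted nonlinearity \<open>Z\<close>; the
nonresonant part then turns the bound \<open>t\<close> for the norm of \<open>k\<close> up to degree \<open>m\<close> into a constant multiple of
\<open>t\<^sup>2\<close> up to degree \<open>m + 1\<close>. Hence this bound reproduces itself on a polydisc of small radius \<open>t\<close>.\<close>

theorem normalizing_converges:
  fixes F H G :: "'n :: finite fvec"
  assumes H: "transformation H" and HG: "transforms H F G"
    and hres: "\<And>i M. mcoeff (H $ i - mvar i) M \<noteq> 0 \<Longrightarrow> wgt lam M \<noteq> lam $ i"
    and F: "\<And>i. order_ge 2 (F $ i - dvf lam $ i)" and conv: "\<And>i. mconvergent (F $ i)"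
    and G: "\<And>i. G $ i = dvf lam $ i + mvar i * (mconst (lam $ i) * u + mconst (cnj (lam $ i)) * v)"
    and ures: "\<And>M. mcoeff u M \<noteq> 0 \<Longrightarrow> wgt lam M = 0" and vres: "\<And>M. mcoeff v M \<noteq> 0 \<Longrightarrow> wgt lam M = 0"
    and u1: "order_ge 1 u" and v1: "order_ge 1 v"
    and minor: "minor2 lam (vcnj lam) j0 k0 \<noteq> 0"
    and \<delta>: "\<delta> > 0" "\<And>i M. wgt lam M \<noteq> lam $ i \<Longrightarrow> \<delta> \<le> norm (wgt lam M - lam $ i)"
  shows "mconvergent (H $ i)"
proof -
  note H1 = order_ge_1_transformation[OF H]
  define X where "X = F - dvf lam"
  define h where "h i = H $ i - mvar i" for i
  define g where "g i = mconst (lam $ i) * u + mconst (cnj (lam $ i)) * v" for i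
  define k where "k i = der (dvf lam) (h i) - mconst (lam $ i) * h i" for i
  define l where "l i = der (dvf (vcnj lam)) (h i) - mconst (cnj (lam $ i)) * h i" for i
  define Z where "Z i = msubst (X $ i) H" for i
  have Hi: "H $ i = mvar i + h i" for i by (simp add: h_def)
  have kc: "mcoeff (k i) M = (wgt lam M - lam $ i) * mcoeff (h i) M"
    and lc: "mcoeff (l i) M = cnj (wgt lam M - lam $ i) * mcoeff (h i) M" for i M
    by (simp_all add: k_def l_def mcoeff_der_dvf wgt_vcnj left_diff_distrib)
  \<comment> \<open>The conjugation equation, solved for the part that carries the divisors.\<close>
  have key: "k i + mvar i * g i = Z i - g i * h i - u * k i - v * l i" for i
  proof -
    have "der G f = der (dvf lam) f + u * der (dvf lam) f + v * der (dvf (vcnj lam)) f" for f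
      unfolding der_def sum_distrib_left sum.distrib[symmetric]
      by (rule sum.cong) (simp_all add: G dvf_def algebra_simps)
    moreover have "der (dvf lam) (H $ i) = mconst (lam $ i) * H $ i + k i"
      by (simp add: Hi der_add der_mvar k_def) (simp add: dvf_def algebra_simps)
    moreover have "der (dvf (vcnj lam)) (H $ i) = mconst (cnj (lam $ i)) * H $ i + l i"
      by (simp add: Hi der_add der_mvar l_def) (simp add: dvf_def algebra_simps)
    moreover have "der G (H $ i) = mconst (lam $ i) * H $ i + Z i"
    proof -
      have "msubst (F $ i) H = msubst (dvf lam $ i + X $ i) H" by (simp add: X_def)
      also have "\<dots> = mconst (lam $ i) * H $ i + Z i"
        by (simp add: msubst_add dvf_def msubst_mult[OF H1(1)] msubst_mvar[OF H1(1)] Z_def)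
      finally show ?thesis using HG by (simp add: transforms_iff)
    qed
    ultimately show ?thesis by (simp add: g_def Hi algebra_simps)
  qed
  have h_res: "mcoeff (h i) M \<noteq> 0 \<Longrightarrow> wgt lam M \<noteq> lam $ i" for i M using hres by (simp add: h_def)
  have k_res: "mcoeff (k i) M \<noteq> 0 \<Longrightarrow> wgt lam M \<noteq> lam $ i"
    and l_res: "mcoeff (l i) M \<noteq> 0 \<Longrightarrow> wgt lam M \<noteq> lam $ i" for i M
    by (auto simp: kc lc)
  have g_res: "mcoeff (g i) M \<noteq> 0 \<Longrightarrow> wgt lam M = 0" for i M
    using ures[of M] vres[of M]
    by (cases "mcoeff u M = 0"; cases "mcoeff v M = 0") (auto simp: g_def)
  have xg_res: "mcoeff (mvar i * g i) M \<noteq> 0 \<Longrightarrow> wgt lam M = lam $ i" for i M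
  proof -
    assume "mcoeff (mvar i * g i) M \<noteq> 0"
    then have "M $ i \<noteq> 0" "mcoeff (g i) (M - axis i 1) \<noteq> 0"
      by (auto simp: mcoeff_mvar_mult split: if_splits)
    then have "wgt lam (M - axis i 1 + axis i 1) = lam $ i"
      using g_res by (simp add: wgt_add)
    then show "wgt lam M = lam $ i" using \<open>M $ i \<noteq> 0\<close> by (simp add: axis_add_diff)
  qed
  have k_le: "norm (mcoeff (k i) M) \<le> norm (mcoeff (Z i - g i * h i - u * k i - v * l i) M)" for i M
  proof (cases "wgt lam M = lam $ i")
    case True
    then have "mcoeff (k i) M = 0" using k_res[of i M] by blast
    then show ?thesis by simp
  next
    case False
    then have "mcoeff (mvar i * g i) M = 0" using xg_res[of i M] by blast
    then show ?thesis unfolding key[symmetric] by simp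
  qed
  have xg_le: "norm (mcoeff (mvar i * g i) M) \<le> norm (mcoeff (Z i) M)" for i M
  proof (cases "wgt lam M = lam $ i")
    case True
    have "mcoeff (g i * h i) M = 0" by (rule wgt_mcoeff_mult[OF _ _ True]; erule g_res h_res)
    moreover have "mcoeff (u * k i) M = 0" by (rule wgt_mcoeff_mult[OF _ _ True]; erule ures k_res)
    moreover have "mcoeff (v * l i) M = 0" by (rule wgt_mcoeff_mult[OF _ _ True]; erule vres l_res)
    moreover have "mcoeff (k i) M = 0" using True k_res[of i M] by blast
    ultimately show ?thesis using arg_cong[OF key[of i], of "\<lambda>f. mcoeff f M"] by simp
  next
    case False
    then have "mcoeff (mvar i * g i) M = 0" using xg_res[of i M] by blast
    then show ?thesis by simp
  qed
  have h2: "order_ge 2 (h i)" for i using H1(2) by (simp add: h_def)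
  have k1: "order_ge 1 (k i)" "order_ge 1 (l i)" "order_ge 1 (h i)" for i
    using h2[of i] by (auto simp: order_ge_def kc lc)
  have g1: "order_ge 1 (g i)" for i using u1 v1 by (auto simp: order_ge_def g_def)
  have X2: "order_ge 2 (X $ i)" for i using F by (simp add: X_def)
  \<comment> \<open>A common polydisc for the nonlinear terms.\<close>
  have "\<exists>\<rho>>0. \<exists>C. \<forall>m. truncnorm \<rho> m (F $ i) \<le> C" for i
    by (rule truncnorm_bounded_of_mconvergent[OF conv])
  then obtain \<rho>' C' where \<rho>': "\<And>i. \<rho>' i > 0" "\<And>i m. truncnorm (\<rho>' i) m (F $ i) \<le> C' i" by metis
  define \<rho> where "\<rho> = Min (range \<rho>')"
  define C where "C = (\<Sum>i\<in>UNIV. \<bar>C' i\<bar>)"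
  have \<rho>: "\<rho> > 0" "\<rho> \<le> \<rho>' i" for i using \<rho>'(1) by (auto simp: \<rho>_def)
  have C0: "C \<ge> 0" by (auto simp: C_def intro: sum_nonneg)
  have XC: "truncnorm \<rho> m (X $ i) \<le> C" for m i
  proof -
    have "norm (mcoeff (X $ i) M) \<le> norm (mcoeff (F $ i) M)" for M
    proof (cases "mdeg M < 2")
      case False
      then have "M \<noteq> axis i 1" by auto
      then show ?thesis by (simp add: X_def dvf_def mcoeff_mvar)
    qed (use X2[of i] in \<open>simp add: order_ge_def\<close>)
    then have "truncnorm \<rho> m (X $ i) \<le> truncnorm \<rho> m (F $ i)"
      using \<rho>(1) by (intro truncnorm_mono_coeff) auto
    also have "\<dots> \<le> truncnorm (\<rho>' i) m (F $ i)"
      unfolding truncnorm_def using \<rho>(1) \<rho>(2)[of i] by (intro sum_mono mult_left_mono power_mono) auto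
    also have "\<dots> \<le> \<bar>C' i\<bar>" using \<rho>'(2)[of i m] by linarith
    also have "\<dots> \<le> C" unfolding C_def by (rule member_le_sum) auto
    finally show ?thesis .
  qed
  \<comment> \<open>For \<open>k\<close> of norm at most \<open>t\<close> the following quantities are bounded: \<open>H\<close> by \<open>t * K\<close>, \<open>Z\<close> by
    \<open>C1 * t\<^sup>2\<close>, \<open>u\<close> and \<open>v\<close> by \<open>L * (C1 * t)\<close>, and the next truncation of \<open>k\<close> by \<open>C2 * t\<^sup>2\<close>.\<close>
  define K where "K = 1 + 1 / \<delta>"
  define C1 where "C1 = (K / \<rho>)\<^sup>2 * C"
  define L where "L = (norm (lam $ j0) + norm (lam $ k0)) / norm (minor2 lam (vcnj lam) j0 k0)"
  define C2 where "C2 = C1 * (1 + 1 / \<delta> + 2 * L)"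
  define t where "t = min (\<rho> / K) (1 / (C2 + 1))"
  have K: "K > 0" using \<delta>(1) by (simp add: K_def add_pos_pos)
  have C1: "C1 \<ge> 0" using C0 by (simp add: C1_def)
  have L: "L \<ge> 0" by (simp add: L_def)
  have C2: "C2 \<ge> 0" unfolding C2_def using C1 L \<delta>(1) by (intro mult_nonneg_nonneg) auto
  have t: "t > 0" "t * K \<le> \<rho>" "C2 * t \<le> 1"
  proof -
    show "t > 0" using K \<rho>(1) C2 by (simp add: t_def)
    have "t \<le> \<rho> / K" by (simp add: t_def)
    then show "t * K \<le> \<rho>" using K by (simp add: pos_le_divide_eq)
    have "C2 * t \<le> C2 * (1 / (C2 + 1))" using C2 by (intro mult_left_mono) (simp_all add: t_def)
    also have "\<dots> \<le> 1" using C2 by simp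
    finally show "C2 * t \<le> 1" .
  qed
  have t0: "t \<ge> 0" using t(1) by simp
  let ?S = "truncnorm t"
  have h_le: "?S m (h i) \<le> t / \<delta>" if "?S m (k i) \<le> t" for m i
  proof -
    have "norm (mcoeff (mconst (of_real \<delta>) * h i) M) \<le> norm (mcoeff (k i) M)" for M
    proof (cases "mcoeff (h i) M = 0")
      case False
      then have "\<delta> \<le> norm (wgt lam M - lam $ i)" using h_res \<delta>(2) by blast
      then show ?thesis using \<delta>(1) by (simp add: kc norm_mult mult_right_mono)
    qed simp
    then have "?S m (mconst (of_real \<delta>) * h i) \<le> ?S m (k i)" by (rule truncnorm_mono_coeff[OF t0])
    then have "\<delta> * ?S m (h i) \<le> t" using that \<delta>(1) by (simp add: truncnorm_mconst_mult)
    then show ?thesis using \<delta>(1) by (simp add: pos_le_divide_eq mult.commute)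
  qed
  have H_le: "?S m (H $ i) \<le> t * K" if "?S m (k i) \<le> t" for m i
  proof -
    have "?S m (H $ i) \<le> ?S m (mvar i) + ?S m (h i)" unfolding Hi by (rule truncnorm_add[OF t0])
    also have "\<dots> \<le> t + t / \<delta>" by (intro add_mono truncnorm_mvar[OF t0] h_le that)
    finally show ?thesis by (simp add: K_def algebra_simps)
  qed
  have k_bound: "?S m (k i) \<le> t" for m i
  proof (induction m arbitrary: i)
    case 0
    have "{M :: nat ^ 'n. mdeg M \<le> 0} = {0}" by (auto simp: mdeg_eq_0_iff)
    then show ?case using k1(1)[of i] t0 by (simp add: truncnorm_def order_ge_def)
  next
    case (Suc m)
    note Hm = H_le[OF Suc] and hm = h_le[OF Suc]
    have Zm: "?S (Suc m) (Z i) \<le> C1 * t\<^sup>2" for i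
    proof -
      have "?S (Suc m) (Z i) \<le> (t * K / \<rho>)\<^sup>2 * C"
        unfolding Z_def by (rule truncnorm_msubst[OF t0 Hm H1(1) X2 t(2) \<rho>(1) XC])
      then show ?thesis by (simp add: C1_def power_divide power_mult_distrib mult_ac)
    qed
    have gm: "?S m (g i) \<le> C1 * t" for i
    proof -
      have "t * ?S m (g i) = ?S (Suc m) (mvar i * g i)" by (simp add: truncnorm_mvar_mult)
      also have "\<dots> \<le> ?S (Suc m) (Z i)" by (rule truncnorm_mono_coeff[OF t0 xg_le])
      also have "\<dots> \<le> t * (C1 * t)" using Zm[of i] by (simp add: power2_eq_square mult_ac)
      finally show ?thesis using t(1) by simp
    qed
    \<comment> \<open>Cramer's rule recovers \<open>u\<close> and \<open>v\<close> from \<open>g j0\<close> and \<open>g k0\<close>.\<close>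
    have comb: "?S m f \<le> L * (C1 * t)"
      if "mconst (minor2 lam (vcnj lam) j0 k0) * f = mconst a * g j0 - mconst b * g k0"
        "norm a = norm (lam $ k0)" "norm b = norm (lam $ j0)" for f a b
    proof -
      let ?d = "norm (minor2 lam (vcnj lam) j0 k0)"
      have "?d * ?S m f = ?S m (mconst a * g j0 - mconst b * g k0)"
        by (simp add: that(1)[symmetric] truncnorm_mconst_mult)
      also have "\<dots> \<le> ?S m (mconst a * g j0) + ?S m (mconst b * g k0)" by (rule truncnorm_diff[OF t0])
      also have "\<dots> = norm (lam $ k0) * ?S m (g j0) + norm (lam $ j0) * ?S m (g k0)"
        by (simp add: truncnorm_mconst_mult that)
      also have "\<dots> \<le> norm (lam $ k0) * (C1 * t) + norm (lam $ j0) * (C1 * t)"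
        by (intro add_mono mult_left_mono gm) auto
      also have "\<dots> = (?d * L) * (C1 * t)" using minor by (simp add: L_def distrib_right)
      finally show ?thesis using minor by (simp add: mult.assoc)
    qed
    have um: "?S m u \<le> L * (C1 * t)"
      by (rule comb[of _ "cnj (lam $ k0)" "cnj (lam $ j0)"])
        (simp_all add: g_def minor2_def mconst_diff mconst_mult algebra_simps)
    have vm: "?S m v \<le> L * (C1 * t)"
      by (rule comb[of _ "- lam $ k0" "- lam $ j0"])
        (simp_all add: g_def minor2_def mconst_diff mconst_mult mconst_minus algebra_simps)
    have lm: "?S m (l i) \<le> t" for i
    proof -
      have "norm (mcoeff (l i) M) \<le> norm (mcoeff (k i) M)" for M
        by (simp only: kc lc norm_mult complex_mod_cnj order_refl)
      then have "?S m (l i) \<le> ?S m (k i)" by (rule truncnorm_mono_coeff[OF t0])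
      then show ?thesis using Suc[of i] by linarith
    qed
    have prod: "?S (Suc m) (p * q) \<le> a * b"
      if "order_ge 1 p" "order_ge 1 q" "?S m p \<le> a" "?S m q \<le> b" for p q a b
    proof -
      have "?S (Suc m) (p * q) \<le> ?S (Suc m - 1) p * ?S (Suc m - 1) q"
        by (rule truncnorm_mult[OF t0 that(1,2)])
      also have "\<dots> \<le> a * b"
        using that truncnorm_nonneg[OF t0, of m p] truncnorm_nonneg[OF t0, of m q]
        by (intro mult_mono) auto
      finally show ?thesis .
    qed
    have "?S (Suc m) (k i) \<le> ?S (Suc m) (Z i - g i * h i - u * k i - v * l i)"
      by (rule truncnorm_mono_coeff[OF t0 k_le])
    also have "\<dots> \<le> ?S (Suc m) (Z i) + ?S (Suc m) (g i * h i) + ?S (Suc m) (u * k i) + ?S (Suc m) (v * l i)"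
      using truncnorm_diff[OF t0, of "Suc m" "Z i - g i * h i - u * k i" "v * l i"]
        truncnorm_diff[OF t0, of "Suc m" "Z i - g i * h i" "u * k i"]
        truncnorm_diff[OF t0, of "Suc m" "Z i" "g i * h i"] by linarith
    also have "\<dots> \<le> C1 * t\<^sup>2 + (C1 * t) * (t / \<delta>) + (L * (C1 * t)) * t + (L * (C1 * t)) * t"
      by (intro add_mono Zm prod gm hm um vm lm Suc g1 k1 u1 v1)
    also have "\<dots> = (C2 * t) * t" by (simp add: C2_def power2_eq_square algebra_simps)
    also have "\<dots> \<le> 1 * t" using t(3) t0 by (intro mult_right_mono)
    finally show ?case by simp
  qed
  show ?thesis
    by (rule mconvergent_of_truncnorm_bounded[OF t(1) H_le[OF k_bound]])
qed

section \<open>Structure of the normal form\<close>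

text \<open>The coefficient vectors of \<open>G\<close> are \<open>\<alpha> *s lam + \<beta> *s vcnj lam\<close>; the coefficients \<open>\<alpha>\<close>, \<open>\<beta>\<close> at the
resonant exponents other than 0 are collected into \<open>u\<close> and \<open>v\<close>. All exponents are nonnegative, so component \<open>i\<close>
is divisible by \<open>mvar i\<close>.\<close>

theorem normal_form_factorization:
  fixes G :: "'n :: finite fvec"
  assumes nf: "normal_form lam G"
    and tan: "\<And>Q. Q \<in> NN \<Longrightarrow> \<exists>\<alpha> \<beta>. vf_coeff G Q = \<alpha> *s lam + \<beta> *s vcnj lam"
    and out: "\<And>Q. Q \<in> NN \<Longrightarrow> Q \<notin> Mplus lam \<Longrightarrow> vf_coeff G Q = 0"
    and diag: "\<And>i. mcoeff (G $ i) (axis i 1) = lam $ i"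
  obtains u v where "order_ge 1 u" "order_ge 1 v"
    "\<And>M. mcoeff u M \<noteq> 0 \<Longrightarrow> wgt lam M = 0" "\<And>M. mcoeff v M \<noteq> 0 \<Longrightarrow> wgt lam M = 0"
    "\<And>i. G $ i = dvf lam $ i + mvar i * (mconst (lam $ i) * u + mconst (cnj (lam $ i)) * v)"
proof -
  define q where "q M = (\<chi> s. int (M $ s))" for M :: "nat ^ 'n"
  have lower: "lower i (M + axis i 1) = q M" for i and M :: "nat ^ 'n"
    by (simp add: lower_def q_def vec_eq_iff axis_def)
  have lowerNN: "lower i M \<in> NN" for i :: 'n and M using lower_in_Ni by (auto simp: NN_def)
  have coeff: "vf_coeff G (lower i M) $ i = mcoeff (G $ i) M" for i M
    by (simp add: vf_coeff_def lower_in_Ni nat_lower del: vector_add_component)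
  have qNN: "q M \<in> NN" for M using lowerNN[of undefined "M + axis undefined 1"] by (simp only: lower)
  obtain \<alpha> \<beta> where ab: "\<And>M. vf_coeff G (q M) = \<alpha> M *s lam + \<beta> M *s vcnj lam"
    using tan[OF qNN] by metis
  define R where "R = {M. M \<noteq> 0 \<and> wgt lam M = 0}"
  define u where "u = Abs_mfps (\<lambda>M. if M \<in> R then \<alpha> M else 0)"
  define v where "v = Abs_mfps (\<lambda>M. if M \<in> R then \<beta> M else 0)"
  show thesis
  proof
    show "order_ge 1 u" "order_ge 1 v"
      by (auto simp: order_ge_def u_def v_def R_def mdeg_eq_0_iff)
    show "wgt lam M = 0" if "mcoeff u M \<noteq> 0" for M using that by (auto simp: u_def R_def split: if_splits)
    show "wgt lam M = 0" if "mcoeff v M \<noteq> 0" for M using that by (auto simp: v_def R_def split: if_splits)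
    fix i
    show "G $ i = dvf lam $ i + mvar i * (mconst (lam $ i) * u + mconst (cnj (lam $ i)) * v)"
    proof (rule mfps_eqI)
      fix M
      show "mcoeff (G $ i) M =
          mcoeff (dvf lam $ i + mvar i * (mconst (lam $ i) * u + mconst (cnj (lam $ i)) * v)) M"
      proof (cases "M $ i = 0")
        case True
        then have "lower i M \<notin> Mplus lam" by (auto simp: Mplus_def lower_def intro!: exI[of _ i])
        then have "mcoeff (G $ i) M = 0" using out[OF lowerNN] coeff[of i M] by simp
        moreover have "M \<noteq> axis i 1" using True by auto
        ultimately show ?thesis using True by (simp add: dvf_def mcoeff_mvar mcoeff_mvar_mult)
      next
        case False
        define N where "N = M - axis i 1"
        have M: "M = N + axis i 1" using axis_add_diff[OF False] by (simp add: N_def)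
        have N0: "M = axis i 1 \<longleftrightarrow> N = 0" unfolding M by simp
        have shift: "mcoeff (mvar i * f) M = mcoeff f N" for f :: "(complex, 'n) mfps" by (simp add: M)
        consider "N = 0" | "N \<in> R" | "N \<noteq> 0" "N \<notin> R" by blast
        then show ?thesis
        proof cases
          case 1
          then show ?thesis using diag[of i] N0 unfolding mcoeff_add[of "dvf lam $ i"] shift
            by (simp add: dvf_def mcoeff_mvar u_def v_def R_def)
        next
          case 2
          then have "M \<noteq> axis i 1" using N0 by (auto simp: R_def)
          moreover have "mcoeff (G $ i) M = \<alpha> N * lam $ i + \<beta> N * cnj (lam $ i)"
            using coeff[of i M] ab[of N] by (simp add: M lower)
          ultimately show ?thesis using 2
            by (simp add: shift dvf_def mcoeff_mvar u_def v_def mult.commute[of "\<alpha> N"]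
                mult.commute[of "\<beta> N"])
        next
          case 3
          then have "wgt lam N \<noteq> 0" by (simp add: R_def)
          then have "wgt lam M \<noteq> lam $ i" by (simp add: M wgt_add)
          then have "mcoeff (G $ i) M = 0" using nf by (auto simp: normal_form_iff)
          then show ?thesis using 3 N0
            by (simp add: shift dvf_def mcoeff_mvar u_def v_def)
        qed
      qed
    qed
  qed
qed

theorem proposition77:
  fixes lam :: "'n :: {finite, linorder} cvec"
    and A :: "'n cmat"
    and F X :: "'n fvec"
  assumes "lower_jordan lam A"
    and "F = linear_vf A + X"
    and "\<forall>i. order_ge 2 (X $ i)"
    and "\<forall>i. mconvergent (F $ i)"
    and "lam \<noteq> (\<chi> i. cnj (lam $ i))"
    and "vec.independent {lam, (\<chi> i. cnj (lam $ i))}"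
    and "\<exists>\<psi> :: nat \<Rightarrow> 'n fmero.
           (\<forall>j < CARD('n) - 2. first_integral F (\<psi> j)) \<and>
           independent_functions (CARD('n) - 2) \<psi>"
  shows "(\<forall>G. is_normal_form_of lam F G \<longrightarrow> condition_AS lam G) \<and>
         condition_omega lam \<and>
         (\<exists>H. normalizing lam F H \<and> (\<forall>i. mconvergent (H $ i)))"
proof -
  note A = assms(1) and F = assms(2) and X = assms(3)
  obtain \<psi> where int: "\<forall>j < CARD('n) - 2. first_integral F (\<psi> j)"
    and ind: "independent_functions (CARD('n) - 2) \<psi>" using assms(7) by blast
  obtain j0 k0 where minor: "minor2 lam (vcnj lam) j0 k0 \<noteq> 0"
    using independent_imp_minor2[OF assms(5,6)] by blast
  have jwt: "jwt j \<ge> 1" for j :: 'n using jwt_bounds(1)[of j] by simp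
  have GA: "order_ge 2 (G $ i - linear_vf A $ i)" if "transformation H" "transforms H F G" for H G i
    by (rule normal_form_linear_part[OF that F X])
  have Gw: "wge jwt (jwt i + 1) (G $ i - dvf lam $ i)" if "transformation H" "transforms H F G" for H G i
    by (rule wge_jordan[OF A GA[OF that]])
  have AS: "condition_AS lam G" "\<And>Q. Q \<in> NN \<Longrightarrow> \<exists>\<alpha> \<beta>. vf_coeff G Q = \<alpha> *s lam + \<beta> *s vcnj lam"
      "\<And>Q. Q \<in> NN \<Longrightarrow> Q \<notin> Mplus lam \<Longrightarrow> vf_coeff G Q = 0"
    if "transformation H" "transforms H F G" "normal_form lam G" for H G
  proof -
    show tan: "\<exists>\<alpha> \<beta>. vf_coeff G Q = \<alpha> *s lam + \<beta> *s vcnj lam" if "Q \<in> NN" for Q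
      by (rule normal_form_tangent[OF \<open>transformation H\<close> \<open>transforms H F G\<close> \<open>normal_form lam G\<close>
            jwt Gw[OF \<open>transformation H\<close> \<open>transforms H F G\<close>] int ind minor that])
    show "condition_AS lam G"
      by (rule condition_AS_of_tangency[OF \<open>normal_form lam G\<close> tan assms(5,6)])
    show "vf_coeff G Q = 0" if "Q \<in> NN" "Q \<notin> Mplus lam" for Q
      by (rule vf_coeff_outside_Mplus[OF \<open>normal_form lam G\<close> tan assms(5,6) that])
  qed
  obtain H G where H: "transformation H" and HG: "transforms H F G" and nf: "normal_form lam G"
    and hres: "\<And>i M. mcoeff (H $ i - mvar i) M \<noteq> 0 \<Longrightarrow> wgt lam M \<noteq> lam $ i"
  proof (rule formal_normal_form[of jwt F lam])
    show "wge jwt (jwt i + 1) (F $ i - dvf lam $ i)" for i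
      by (rule wge_jordan[OF A]) (use F X in simp)
    show "mcoeff (F $ i) (axis l 1) = 0" if "lam $ i \<noteq> lam $ l" for i l
      using jordan_linear_coeff[OF A that] X by (simp add: F mcoeff_linear_vf_axis order_ge_def)
  qed (use jwt in auto)
  obtain \<delta> where \<delta>: "\<delta> > 0" "\<And>Q. pair Q lam \<noteq> 0 \<Longrightarrow> \<delta> \<le> norm (pair Q lam)"
    using weights_discrete[OF orthogonal_lattice[OF H HG nf jwt Gw[OF H HG] int ind minor]] by metis
  have lin: "mcoeff (G $ i) (axis l 1) = A $ i $ l" for i l
    using GA[OF H HG, of i] by (auto simp: order_ge_def mcoeff_linear_vf_axis)
  obtain u v where uv: "order_ge 1 u" "order_ge 1 v"
    "\<And>M. mcoeff u M \<noteq> 0 \<Longrightarrow> wgt lam M = 0" "\<And>M. mcoeff v M \<noteq> 0 \<Longrightarrow> wgt lam M = 0"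
    "\<And>i. G $ i = dvf lam $ i + mvar i * (mconst (lam $ i) * u + mconst (cnj (lam $ i)) * v)"
    by (rule normal_form_factorization[OF nf AS(2,3)[OF H HG nf]])
      (use A lin in \<open>auto simp: lower_jordan_def\<close>)
  \<comment> \<open>The normal form has no off-diagonal linear terms, so \<open>A\<close> is diagonal.\<close>
  have "linear_vf A $ i = dvf lam $ i" for i
  proof -
    have off: "A $ i $ l = 0" if "l \<noteq> i" for l
    proof -
      have "mcoeff (mvar i * f) (axis l 1) = 0" for f :: "(complex, 'n) mfps"
        using that by (simp add: mcoeff_mvar_mult axis_def)
      then have "mcoeff (G $ i) (axis l 1) = 0"
        unfolding uv(5) using that by (simp add: dvf_def mcoeff_mvar axis_eq_axis)
      then show ?thesis by (simp add: lin)
    qed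
    have "linear_vf A $ i = (\<Sum>j\<in>UNIV. if j = i then dvf lam $ i else 0)"
      unfolding linear_vf_def vec_lambda_beta
      using off A by (intro sum.cong) (auto simp: dvf_def lower_jordan_def)
    then show ?thesis by simp
  qed
  then have F2: "order_ge 2 (F $ i - dvf lam $ i)" for i using F X by simp
  have gap: "\<delta> \<le> norm (wgt lam M - lam $ i)" if "wgt lam M \<noteq> lam $ i" for i M
    using \<delta>(2)[of "lower i M"] that by (simp add: pair_lower)
  have "mconvergent (H $ i)" for i
    using normalizing_converges[OF H HG hres F2 _ uv(5,3,4,1,2) minor \<delta>(1) gap] assms(4) by blast
  moreover have "normalizing lam F H" unfolding normalizing_def using H HG nf by blast
  moreover have "condition_omega lam"
  proof (rule condition_omega_of_gap[OF _ \<delta>])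
    show "lam \<noteq> 0" using minor by (auto simp: minor2_def)
  qed
  ultimately show ?thesis using AS(1) unfolding is_normal_form_of_def by blast
qed

end
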